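(* Let $(Z^{(n)}(t))_{t\in [0,1]}$ be the continuous stochastic process $$Z^{(n)}(t) = \frac{\tilde K_{t}^{(n)} - t^2 n}{\sqrt{n}},$$ and let $W$ be a standard Wiener process. Then, for $n\to\infty$, the process $Z^{(n)}$ converges weakly with respect to the $\sup$-norm on $C([0,1])$ to a limiting process $Z^{\infty}$ that is given by $$Z^{\infty}(t) = (1-t)\, W\big(t^2 / (1-t)\big)$$ (with $Z^\infty(1)=0$). Furthermore, for $s,t\in[0,1]$ with $s < t$, the limiting process satisfies $$\mathbb{E} Z^{\infty}(t) = 0,\quad \mathbb{V} Z^{\infty}(t) = t^2 (1 - t), \quad \operatorname{Cov}(Z^{\infty}(s), Z^{\infty}(t)) = s^2 (1 - t).$$
   Context: A labeled tree of size $n$ is an (unrooted) tree with vertex set $[n]=\{1,\dots,n\}$. For $1\le j\le n$, let $K_j^{(n)}$ be the number of edges in the subgraph induced by the vertices in $[j]$ of a random labeled tree chosen uniformly among the $n^{n-2}$ labeled trees of size $n$ (the same random tree for all $j$), and set $K_0^{(n)}=0$. The linearly interpolated process $(\tilde K_t^{(n)})_{t\in[0,1]}$ is $$\tilde K_t^{(n)} = (1 + \lfloor tn\rfloor - tn) K_{\lfloor tn\rfloor}^{(n)} + (tn - \lfloor tn\rfloor) K_{\lceil tn\rceil}^{(n)}.$$ $\mathbb{V}$ denotes variance. *)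

theory Defs
  imports "HOL-Probability.Probability"
begin

section \<open>Uniformly random labeled trees\<close>

text \<open>A graph is given by a vertex set \<open>V\<close> and a set \<open>E\<close> of edges, each edge being a
  two-element subset of \<open>V\<close>.\<close>

definition graph_connected :: "'v set \<Rightarrow> 'v set set \<Rightarrow> bool" where
  "graph_connected V E \<longleftrightarrow> (\<forall>u\<in>V. \<forall>v\<in>V. (u, v) \<in> {(x, y). {x, y} \<in> E}\<^sup>*)"

definition graph_cycle :: "'v set set \<Rightarrow> 'v list \<Rightarrow> bool" where
  "graph_cycle E vs \<longleftrightarrow> 3 \<le> length vs \<and> distinct vs \<and>
     (\<forall>i<length vs. {vs ! i, vs ! (Suc i mod length vs)} \<in> E)"

definition is_tree :: "'v set \<Rightarrow> 'v set set \<Rightarrow> bool" where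
  "is_tree V E \<longleftrightarrow> E \<subseteq> {e. e \<subseteq> V \<and> card e = 2} \<and>
     graph_connected V E \<and> (\<nexists>vs. graph_cycle E vs)"

definition labeled_trees :: "nat \<Rightarrow> nat set set set" where
  "labeled_trees n = {E. is_tree {1..n} E}"

definition random_labeled_tree :: "nat \<Rightarrow> nat set set pmf" where
  "random_labeled_tree n = pmf_of_set (labeled_trees n)"

definition induced_edges :: "nat \<Rightarrow> nat set set \<Rightarrow> nat" where
  "induced_edges j E = card {e \<in> E. e \<subseteq> {1..j}}"


section \<open>The interpolated and rescaled process, and its limit\<close>

text \<open>These are processes on the probability space \<^term>\<open>measure_pmf (random_labeled_tree n)\<close>;
  the sample point is the edge set \<open>E\<close> of the tree. The index \<open>n = 0\<close> is harmless, as division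
  by \<open>0\<close> makes \<^term>\<open>0\<close> the value of the rescaled process.\<close>

definition K_interp :: "nat \<Rightarrow> real \<Rightarrow> nat set set \<Rightarrow> real" where
  "K_interp n t E =
     (1 + real_of_int \<lfloor>t * real n\<rfloor> - t * real n) * real (induced_edges (nat \<lfloor>t * real n\<rfloor>) E)
     + (t * real n - real_of_int \<lfloor>t * real n\<rfloor>) * real (induced_edges (nat \<lceil>t * real n\<rceil>) E)"

definition Z_proc :: "nat \<Rightarrow> real \<Rightarrow> nat set set \<Rightarrow> real" where
  "Z_proc n t E = (K_interp n t E - t\<^sup>2 * real n) / sqrt (real n)"

definition Z_limit :: "(real \<Rightarrow> 'a \<Rightarrow> real) \<Rightarrow> real \<Rightarrow> 'a \<Rightarrow> real" where
  "Z_limit W t \<omega> = (if t = 1 then 0 else (1 - t) * W (t\<^sup>2 / (1 - t)) \<omega>)"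


section \<open>Standard Wiener processes and covariance\<close>

text \<open>The time set is \<open>[0, \<infinity>)\<close>; the values \<^term>\<open>W t\<close> for negative \<open>t\<close> are unconstrained.\<close>

locale std_wiener_process = prob_space M for M :: "'a measure" +
  fixes W :: "real \<Rightarrow> 'a \<Rightarrow> real"
  assumes W_measurable: "\<And>t. 0 \<le> t \<Longrightarrow> random_variable borel (W t)"
    and W_start: "AE \<omega> in M. W 0 \<omega> = 0"
    and W_increment: "\<And>s t. 0 \<le> s \<Longrightarrow> s < t \<Longrightarrow>
          distributed M lborel (\<lambda>\<omega>. W t \<omega> - W s \<omega>) (normal_density 0 (sqrt (t - s)))"
    and W_indep: "\<And>(u :: nat \<Rightarrow> real) n. 0 \<le> u 0 \<Longrightarrow> (\<And>i. i < n \<Longrightarrow> u i < u (Suc i)) \<Longrightarrow>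
          indep_vars (\<lambda>_. borel) (\<lambda>i \<omega>. W (u (Suc i)) \<omega> - W (u i) \<omega>) {..<n}"
    and W_continuous: "AE \<omega> in M. continuous_on {0..} (\<lambda>t. W t \<omega>)"

definition covariance :: "'a measure \<Rightarrow> ('a \<Rightarrow> real) \<Rightarrow> ('a \<Rightarrow> real) \<Rightarrow> real" where
  "covariance M X Y =
     (\<integral>\<omega>. (X \<omega> - (\<integral>\<omega>'. X \<omega>' \<partial>M)) * (Y \<omega> - (\<integral>\<omega>'. Y \<omega>' \<partial>M)) \<partial>M)"


section \<open>Weak convergence in \<open>C([0,1])\<close> with the sup norm\<close>

text \<open>The points of this metric space are the continuous functions on \<open>[0,1]\<close>, represented by
  functions that are \<^term>\<open>undefined\<close> outside \<open>[0,1]\<close>; the metric is the supremum distance.\<close>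

definition C01 :: "(real \<Rightarrow> real) metric" where
  "C01 = cfunspace (top_of_set {0..1}) euclidean_metric"

lemma mspace_C01: "mspace C01 = {f \<in> extensional {0..1}. continuous_on {0..1} f}"
proof -
  have "bounded (f ` {0..1})" if "continuous_on {0..1} f" for f :: "real \<Rightarrow> real"
    using that by (intro compact_imp_bounded compact_continuous_image) auto
  then show ?thesis
    by (auto simp: C01_def)
qed

lemma mdist_C01:
  assumes "f \<in> mspace C01" "g \<in> mspace C01"
  shows "mdist C01 f g = (SUP t\<in>{0..1}. \<bar>f t - g t\<bar>)"
  using assms unfolding C01_def mdist_cfunspace_eq_mdist_funspace
  by (auto simp: Met_TC.fdist_def Met_TC.fspace_def dist_real_def)

definition borel_C01 :: "(real \<Rightarrow> real) measure" where
  "borel_C01 = sigma (mspace C01) {U. openin (mtopology_of C01) U}"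

definition weak_conv_C01 ::
    "(nat \<Rightarrow> (real \<Rightarrow> real) measure) \<Rightarrow> (real \<Rightarrow> real) measure \<Rightarrow> bool" where
  "weak_conv_C01 \<mu> \<nu> \<longleftrightarrow>
     (\<forall>F :: (real \<Rightarrow> real) \<Rightarrow> real.
        continuous_map (mtopology_of C01) euclidean F \<and> bounded (F ` mspace C01) \<longrightarrow>
        (\<lambda>n. \<integral>f. F f \<partial>(\<mu> n)) \<longlonglongrightarrow> (\<integral>f. F f \<partial>\<nu>))"

text \<open>A process whose paths are almost surely continuous on \<open>[0,1]\<close> is regarded as a random element
  of \<open>C([0,1])\<close> by altering it on a null set: \<^term>\<open>Z_limit W\<close> is in general continuous at
  \<open>1\<close> only almost surely. The law of the random element does not depend on the alteration.\<close>

definition C01_version :: "'a measure \<Rightarrow> (real \<Rightarrow> 'a \<Rightarrow> real) \<Rightarrow> ('a \<Rightarrow> real \<Rightarrow> real) \<Rightarrow> bool" where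
  "C01_version M X Y \<longleftrightarrow>
     Y \<in> measurable M borel_C01 \<and> (AE \<omega> in M. \<forall>t\<in>{0..1}. Y \<omega> t = X t \<omega>)"

definition process_weak_conv_C01 ::
    "(nat \<Rightarrow> 'a measure) \<Rightarrow> (nat \<Rightarrow> real \<Rightarrow> 'a \<Rightarrow> real) \<Rightarrow>
     'b measure \<Rightarrow> (real \<Rightarrow> 'b \<Rightarrow> real) \<Rightarrow> bool" where
  "process_weak_conv_C01 M X N Z \<longleftrightarrow>
     (\<exists>Y Y'. (\<forall>n. C01_version (M n) (X n) (Y n)) \<and> C01_version N Z Y' \<and>
        weak_conv_C01 (\<lambda>n. distr (M n) borel_C01 (Y n)) (distr N borel_C01 Y'))"

end

theory Submission
  imports Defs "HOL-Computational_Algebra.Polynomial"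
begin

text \<open>
The proof replaces the random tree by independent uniform variables and then proves a functional
  central limit theorem for these.

  Let \<open>d\<^sub>r\<close> be the number of edges whose larger endpoint is \<open>r\<close>, so that
  \<open>K\<^sub>j = d\<^sub>2 + \<dots> + d\<^sub>j\<close>. Reveal the vertices \<open>1, 2, \<dots>, n\<close> one after the other: the vertex \<open>r\<close> is
  joined to at most one vertex in each component of the forest revealed so far. Suppose that a forest
  on \<open>{1..k}\<close> has components \<open>C\<^sub>1, \<dots>, C\<^sub>m\<close>, and write \<open>s\<^sub>k = y\<^sub>k\<^sub>+\<^sub>1 + \<dots> + y\<^sub>n\<close>. The trees that
  induce this forest on \<open>{1..k}\<close>, each weighted by the product of \<open>y\<^sub>r ^ d\<^sub>r\<close> over \<open>r > k\<close>, have total weight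
  \<open>1/n \<cdot> (\<Prod>i. |C\<^sub>i|) \<cdot> s\<^sub>k ^ (m - 1) \<cdot> (\<Prod>r>k. r y\<^sub>r + s\<^sub>r)\<close>. This follows by induction from \<open>k = n\<close>
  down to \<open>k = 1\<close>, where the choice of the components to which a new vertex is joined leads to a
  binomial expansion (\<open>sum_extensions\<close>). For \<open>k = 1\<close> the last product is also the generating function
  of the maps \<open>u\<close> from \<open>{2..n}\<close> to \<open>{1..n}\<close> by the values \<open>max r (u r)\<close>, since
  \<open>r y\<^sub>r + s\<^sub>r\<close> is the sum of \<open>y\<^bsub>max r v\<^esub>\<close> over \<open>v\<close>. Hence \<open>(K\<^sub>j)\<close> has the law of the process that
  counts, for each \<open>j\<close>, the \<open>r \<in> {2..j}\<close> with \<open>u r \<le> j\<close>, where the \<open>u r\<close> are independent and uniform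
  on \<open>{1..n}\<close> (\<open>induced_edges_law\<close>).

  Every linear combination of the centred counts at several \<open>j\<close> is a sum over \<open>r\<close> of independent
  bounded variables. Therefore the characteristic functions of the rescaled process converge to
  Gaussian ones with covariance \<open>s\<^sup>2 (1 - t)\<close> for \<open>s \<le> t\<close> (\<open>fluct_char_limit\<close>), and the fourth moment
  of an increment is at most a constant times the square of the time difference
  (\<open>fluct_path_fourth_moment\<close>). The process \<open>(1 - t) W (t\<^sup>2 / (1 - t))\<close> has the same covariance and
  satisfies a bound of the same kind.

  These two facts imply weak convergence (\<open>process_convergence\<close>). Chaining along dyadic times turns
  the moment bound into a bound, uniform in \<open>n\<close>, for the expected distance between a path and the
  polygon through its values at the multiples of \<open>2 ^ (- m)\<close>. A polygon is a continuous function of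
  finitely many values, to which a continuity theorem for characteristic functions of random vectors
  applies (\<open>levy_continuity_vector\<close>). Such approximations suffice for Lipschitz functionals, and
  Lipschitz functionals determine weak convergence (\<open>weak_convergence_of_lipschitz\<close>).

  Paths are handled as bounded continuous functions on the real line that are constant on either side
  of \<open>[0,1]\<close>. Chaining also shows that almost all paths of the limit process are continuous at
  \<open>t = 1\<close>, where the time change \<open>t\<^sup>2 / (1 - t)\<close> runs off to infinity.
\<close>

section \<open>Acyclic graphs and their components\<close>

definition adj :: "'v set set \<Rightarrow> ('v \<times> 'v) set" where
  "adj E = {(x, y). {x, y} \<in> E}"

lemma adj_iff: "(x, y) \<in> adj E \<longleftrightarrow> {x, y} \<in> E"
  by (simp add: adj_def)

lemma adj_mono: "E \<subseteq> F \<Longrightarrow> (adj E)\<^sup>* \<subseteq> (adj F)\<^sup>*"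
  by (rule rtrancl_mono) (auto simp: adj_def)

lemma adj_sym: "(x, y) \<in> (adj E)\<^sup>* \<Longrightarrow> (y, x) \<in> (adj E)\<^sup>*"
proof -
  have "sym ((adj E)\<^sup>*)"
    by (intro sym_rtrancl) (auto simp: sym_def adj_def insert_commute)
  then show "(x, y) \<in> (adj E)\<^sup>* \<Longrightarrow> (y, x) \<in> (adj E)\<^sup>*"
    by (rule symD)
qed

lemma reachable_closed:
  assumes "(x, y) \<in> (adj E)\<^sup>*" "x \<in> S"
    and "\<And>a b. a \<in> S \<Longrightarrow> {a, b} \<in> E \<Longrightarrow> b \<in> S"
  shows "y \<in> S"
  using assms(1,2) by (induction rule: rtrancl_induct) (auto simp: adj_def intro: assms(3))

text \<open>Every edge is a bridge. In this form acyclicity concerns reachability only, which is easier to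
  follow through the addition of a vertex than a cycle given as a list of vertices.\<close>

definition forest :: "'v set set \<Rightarrow> bool" where
  "forest E \<longleftrightarrow> (\<forall>u v. u \<noteq> v \<longrightarrow> {u, v} \<in> E \<longrightarrow> (u, v) \<notin> (adj (E - {{u, v}}))\<^sup>*)"

text \<open>The rest of the cycle connects the two ends of its closing edge.\<close>

lemma nonbridge_of_cycle:
  assumes "graph_cycle E vs"
  shows "\<not> forest E"
proof -
  define L where "L = length vs"
  have L: "3 \<le> L" and dist: "distinct vs"
    and e: "\<And>i. i < L \<Longrightarrow> {vs ! i, vs ! (Suc i mod L)} \<in> E"
    using assms by (auto simp: graph_cycle_def L_def)
  define u v where "u = vs ! 0" and "v = vs ! (L - 1)"
  have nth: "vs ! i = vs ! j \<longleftrightarrow> i = j" if "i < L" "j < L" for i j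
    using that dist by (simp add: nth_eq_iff_index_eq L_def)
  have "(u, vs ! i) \<in> (adj (E - {{u, v}}))\<^sup>*" if "i < L" for i
    using that
  proof (induction i)
    case 0
    then show ?case by (simp add: u_def)
  next
    case (Suc i)
    have "{vs ! i, vs ! Suc i} \<in> E"
      using e[of i] Suc.prems by simp
    moreover have "{vs ! i, vs ! Suc i} \<noteq> {u, v}"
      using Suc.prems L unfolding u_def v_def doubleton_eq_iff
      by (subst (1 2 3 4) nth) auto
    ultimately have "(vs ! i, vs ! Suc i) \<in> adj (E - {{u, v}})"
      by (simp add: adj_iff)
    then show ?case
      using Suc by (meson Suc_lessD rtrancl.rtrancl_into_rtrancl)
  qed
  from this[of "L - 1"] have "(u, v) \<in> (adj (E - {{u, v}}))\<^sup>*"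
    using L by (simp add: v_def)
  moreover have "u \<noteq> v" "{u, v} \<in> E"
    using nth[of 0 "L - 1"] L e[of "L - 1"] by (auto simp: u_def v_def insert_commute)
  ultimately show ?thesis
    unfolding forest_def by blast
qed

text \<open>A shortest walk that avoids the edge \<open>uv\<close> becomes a cycle when closed up by \<open>uv\<close>.\<close>

lemma cycle_of_nonbridge:
  assumes "u \<noteq> v" "{u, v} \<in> E" "(u, v) \<in> (adj (E - {{u, v}}))\<^sup>*"
  shows "\<exists>vs. graph_cycle E vs"
proof -
  let ?A = "adj (E - {{u, v}})"
  define n where "n = (LEAST n. (u, v) \<in> ?A ^^ n)"
  have n: "(u, v) \<in> ?A ^^ n"
    unfolding n_def using assms(3) by (metis LeastI rtrancl_imp_relpow)
  then obtain f where f: "f 0 = u" "f n = v" "\<And>i. i < n \<Longrightarrow> (f i, f (Suc i)) \<in> ?A"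
    by (auto simp: relpow_fun_conv)
  have path: "(f i, f (i + d)) \<in> ?A ^^ d" if "i + d \<le> n" for i d
    using that
  proof (induction d)
    case (Suc d)
    then show ?case using f(3)[of "i + d"] by auto
  qed simp
  \<comment> \<open>A repeated vertex on a shortest walk could be cut out.\<close>
  have inj: "f i \<noteq> f j" if "i < j" "j \<le> n" for i j
  proof
    assume eq: "f i = f j"
    have "(u, f i) \<in> ?A ^^ i" using path[of 0 i] that f by simp
    moreover have "(f i, v) \<in> ?A ^^ (n - j)" using path[of j "n - j"] that f eq by simp
    ultimately have "(u, v) \<in> ?A ^^ (i + (n - j))"
      by (auto simp: relpow_add)
    then have "n \<le> i + (n - j)"
      unfolding n_def by (rule Least_le)
    then show False using that by simp
  qed
  define vs where "vs = map f [0..<Suc n]"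
  have "n \<noteq> 0" using f assms(1) by metis
  moreover have "n \<noteq> 1"
    using f(1,2) f(3)[of 0] by (auto simp: adj_def)
  ultimately have "3 \<le> length vs" by (simp add: vs_def)
  moreover have "distinct vs"
    unfolding vs_def distinct_map
    by (intro conjI distinct_upt inj_onI)
       (metis atLeastLessThan_iff inj less_Suc_eq_le linorder_neqE_nat set_upt)
  moreover have "{vs ! i, vs ! (Suc i mod length vs)} \<in> E" if "i < length vs" for i
  proof (cases "i = n")
    case True
    then have "{vs ! i, vs ! (Suc i mod length vs)} = {u, v}"
      using f by (auto simp: vs_def nth_append)
    then show ?thesis using assms(2) by simp
  next
    case False
    then have "i < n" using that by (simp add: vs_def)
    then have "vs ! i = f i" "vs ! (Suc i mod length vs) = f (Suc i)"
      by (simp_all add: vs_def nth_append del: upt_Suc)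
    then show ?thesis using f(3)[OF \<open>i < n\<close>] by (auto simp: adj_def)
  qed
  ultimately show ?thesis unfolding graph_cycle_def by blast
qed

lemma forest_iff_no_cycle: "forest E \<longleftrightarrow> (\<nexists>vs. graph_cycle E vs)"
  using nonbridge_of_cycle cycle_of_nonbridge unfolding forest_def by metis

lemma is_tree_iff:
  "is_tree V E \<longleftrightarrow> E \<subseteq> {e. e \<subseteq> V \<and> card e = 2} \<and> forest E \<and> (\<forall>u\<in>V. \<forall>v\<in>V. (u, v) \<in> (adj E)\<^sup>*)"
  unfolding is_tree_def graph_connected_def forest_iff_no_cycle adj_def by blast

definition component :: "'v set set \<Rightarrow> 'v \<Rightarrow> 'v set" where
  "component E v = (adj E)\<^sup>* `` {v}"

lemma in_component: "u \<in> component E v \<longleftrightarrow> (v, u) \<in> (adj E)\<^sup>*"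
  by (simp add: component_def)

lemma component_refl [simp]: "v \<in> component E v"
  by (simp add: in_component)

lemma component_eq: "u \<in> component E v \<Longrightarrow> component E u = component E v"
  unfolding component_def using adj_sym by (fastforce intro: rtrancl_trans)

lemma component_closed: "{a, b} \<in> E \<Longrightarrow> a \<in> component E v \<Longrightarrow> b \<in> component E v"
  by (auto simp: in_component adj_def intro: rtrancl_into_rtrancl)

lemma component_subset: "v \<in> V \<Longrightarrow> E \<subseteq> Pow V \<Longrightarrow> component E v \<subseteq> V"
  unfolding component_def by (blast intro: reachable_closed[of v _ E V])

definition star :: "'v \<Rightarrow> 'v set \<Rightarrow> 'v set set" where
  "star j N = (\<lambda>v. {j, v}) ` N"

lemma forest_mono: "forest F \<Longrightarrow> E \<subseteq> F \<Longrightarrow> forest E"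
  unfolding forest_def using adj_mono by (metis (no_types) Diff_mono order_refl subset_iff)

text \<open>A cycle through the new vertex \<open>j\<close> passes through two neighbours of \<open>j\<close>, and the rest of it
  connects them in the old graph. In terms of bridges: an edge at \<open>j\<close> is a bridge because the
  component of its other end contains no further neighbour of \<open>j\<close>, and an old edge remains a bridge
  because a detour through \<open>j\<close> ends in a different component.\<close>

lemma forest_star_iff:
  assumes E: "E \<subseteq> Pow V" and j: "j \<notin> V" and N: "N \<subseteq> V"
  shows "forest (E \<union> star j N) \<longleftrightarrow>
     forest E \<and> (\<forall>u\<in>N. \<forall>v\<in>N. component E u = component E v \<longrightarrow> u = v)"
proof (intro iffI conjI ballI impI)
  assume F: "forest (E \<union> star j N)"
  show "forest E" using F by (rule forest_mono) auto
  fix u v assume u: "u \<in> N" and v: "v \<in> N" and c: "component E u = component E v"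
  show "u = v"
  proof (rule ccontr)
    assume "u \<noteq> v"
    let ?E = "E \<union> star j N - {{j, u}}"
    have "(j, v) \<in> adj ?E" using v \<open>u \<noteq> v\<close> j N u by (auto simp: adj_def star_def doubleton_eq_iff)
    moreover have "E \<subseteq> ?E" using E j by auto
    then have "(v, u) \<in> (adj ?E)\<^sup>*"
      using c adj_mono[of E ?E] by (metis component_refl in_component subsetD)
    ultimately have "(j, u) \<in> (adj ?E)\<^sup>*" by (rule converse_rtrancl_into_rtrancl)
    moreover have "j \<noteq> u" "{j, u} \<in> E \<union> star j N" using u N j by (auto simp: star_def)
    ultimately show False using F unfolding forest_def by blast
  qed
next
  assume "forest E \<and> (\<forall>u\<in>N. \<forall>v\<in>N. component E u = component E v \<longrightarrow> u = v)"
  then have F: "forest E" and uniq: "\<And>u v. u \<in> N \<Longrightarrow> v \<in> N \<Longrightarrow> component E u = component E v \<Longrightarrow> u = v"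
    by blast+
  let ?E = "E \<union> star j N"
  have star_edge: "(a = j \<and> b \<in> N) \<or> (b = j \<and> a \<in> N)" if "{a, b} \<in> star j N" for a b
    using that by (auto simp: star_def doubleton_eq_iff)
  have jE: "a \<noteq> j \<and> b \<noteq> j" if "{a, b} \<in> E" for a b using that E j by auto
  show "forest ?E" unfolding forest_def
  proof (intro allI impI notI)
    fix a b assume "a \<noteq> b" and ab: "{a, b} \<in> ?E" and conn: "(a, b) \<in> (adj (?E - {{a, b}}))\<^sup>*"
    have False if u: "u \<in> N" and e: "{a, b} = {j, u}" for u
    proof -
      have "(u, j) \<in> (adj (?E - {{a, b}}))\<^sup>*"
        using conn e adj_sym by (metis doubleton_eq_iff)
      moreover have "y \<in> component E u" if x: "x \<in> component E u" and xy: "{x, y} \<in> ?E - {{a, b}}" for x y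
      proof (cases "{x, y} \<in> E")
        case True
        then show ?thesis using x by (rule component_closed)
      next
        case False
        have "j \<notin> component E u" using component_subset[of u V E] E N u j by blast
        then have "y = j" "x \<in> N" using False xy star_edge x by blast+
        then have "x = u" using uniq[of x u] u component_eq[OF x] by blast
        then show ?thesis using xy e \<open>y = j\<close> by (simp add: insert_commute)
      qed
      ultimately have "j \<in> component E u" by (rule reachable_closed[OF _ component_refl])
      then show False using component_subset[of u V E] E N u j by blast
    qed
    then have abE: "{a, b} \<in> E" using ab by (auto simp: star_def)
    let ?E' = "E - {{a, b}}"
    have sub: "component ?E' x \<subseteq> component E x" for x
      using adj_mono[of ?E' E] by (auto simp: in_component)
    define R where "R = component ?E' a"
    \<comment> \<open>This set contains all that can be reached from \<open>a\<close> without the edge \<open>ab\<close>: if a neighbour \<open>u\<close> of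
      \<open>j\<close> is reached in the old graph, then also \<open>j\<close> and the components of its other neighbours.\<close>
    define S where "S = R \<union> {x. \<exists>u\<in>N \<inter> R. x = j \<or> (\<exists>v\<in>N. v \<noteq> u \<and> x \<in> component E v)}"
    have "y \<in> S" if x: "x \<in> S" and xy: "{x, y} \<in> ?E - {{a, b}}" for x y
    proof (cases "{x, y} \<in> E")
      case True
      then have xyE: "{x, y} \<in> ?E'" using xy by auto
      from x consider "x \<in> R" | "x = j" | u v where "u \<in> N \<inter> R" "v \<in> N" "v \<noteq> u" "x \<in> component E v"
        unfolding S_def by blast
      then show ?thesis
      proof cases
        case 1
        then show ?thesis using component_closed[OF xyE] unfolding S_def R_def by blast
      next
        case 2
        then show ?thesis using jE True by blast
      next
        case 3
        then show ?thesis using component_closed[OF True, of v] unfolding S_def by blast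
      qed
    next
      case False
      then have "(x = j \<and> y \<in> N) \<or> (y = j \<and> x \<in> N)" using xy star_edge by auto
      then show ?thesis
      proof
        assume xj: "x = j \<and> y \<in> N"
        have "j \<notin> R" using component_subset[of a V E] sub[of a] E abE j unfolding R_def by blast
        moreover have "j \<notin> component E v" if "v \<in> N" for v
          using component_subset[of v V E] E N that j by blast
        ultimately obtain u where "u \<in> N \<inter> R" using x xj unfolding S_def by blast
        then show ?thesis using xj component_refl[of y E] unfolding S_def by (cases "y = u") blast+
      next
        assume yj: "y = j \<and> x \<in> N"
        show ?thesis
        proof (cases "x \<in> R")
          case True
          then show ?thesis using yj unfolding S_def by blast
        next
          case False
          then obtain u where "u \<in> N \<inter> R" using x unfolding S_def by blast
          then show ?thesis using yj unfolding S_def by blast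
        qed
      qed
    qed
    moreover have "a \<in> S" by (simp add: S_def R_def)
    ultimately have "b \<in> S" using reachable_closed[OF conn] by blast
    moreover have "b \<notin> R" using F abE \<open>a \<noteq> b\<close> unfolding R_def in_component forest_def by blast
    moreover have "b \<noteq> j" using jE abE by blast
    ultimately obtain u v where uv: "u \<in> N" "u \<in> R" "v \<in> N" "v \<noteq> u" "b \<in> component E v"
      unfolding S_def by blast
    have "component E b = component E a"
      by (intro component_eq component_closed[OF abE]) simp
    moreover have "component E u = component E a" using uv sub by (intro component_eq) (auto simp: R_def)
    moreover have "component E b = component E v" using uv by (intro component_eq) auto
    ultimately show False using uniq uv by metis
  qed
qed

lemma component_star:
  assumes E: "E \<subseteq> Pow V" and j: "j \<notin> V" and N: "N \<subseteq> V"
  shows "component (E \<union> star j N) j = insert j (\<Union>u\<in>N. component E u)" (is "?L = ?R")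
    and "v \<in> V \<Longrightarrow> component E v \<inter> N = {} \<Longrightarrow> component (E \<union> star j N) v = component E v"
    and "v \<in> V \<Longrightarrow> component E v \<inter> N \<noteq> {} \<Longrightarrow> component (E \<union> star j N) v = component (E \<union> star j N) j"
proof -
  let ?E = "E \<union> star j N"
  have star_edge: "(a = j \<and> b \<in> N) \<or> (b = j \<and> a \<in> N)" if "{a, b} \<in> star j N" for a b
    using that by (auto simp: star_def doubleton_eq_iff)
  have sub: "component E x \<subseteq> component ?E x" for x
    using adj_mono[of E ?E] by (auto simp: in_component)
  have jc: "j \<notin> component E v" if "v \<in> V" for v
    using component_subset[of v V E] E that j by blast
  have N_j: "component ?E u = component ?E j" if "u \<in> N" for u
    by (intro component_eq component_closed[of j u ?E j]) (use that in \<open>auto simp: star_def\<close>)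
  show "?L = ?R"
  proof
    have "component E u \<subseteq> ?L" if "u \<in> N" for u using N_j[OF that] sub[of u] by simp
    then show "?R \<subseteq> ?L" by auto
    show "?L \<subseteq> ?R"
    proof
      fix x assume "x \<in> ?L"
      then have "(j, x) \<in> (adj ?E)\<^sup>*" by (simp add: in_component)
      then show "x \<in> ?R"
      proof (rule reachable_closed)
        fix a b assume a: "a \<in> ?R" and "{a, b} \<in> ?E"
        then consider "{a, b} \<in> E" | "{a, b} \<in> star j N" by blast
        then show "b \<in> ?R"
        proof cases
          case 1
          then have "a \<noteq> j" using E j by auto
          then show ?thesis using a component_closed[OF 1] by blast
        next
          case 2
          then have "b = j \<or> b \<in> N" using star_edge by blast
          then show ?thesis using component_refl[of b E] by blast
        qed
      qed simp
    qed
  qed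
  show "component ?E v = component E v" if v: "v \<in> V" and c: "component E v \<inter> N = {}"
  proof
    show "component ?E v \<subseteq> component E v"
    proof
      fix x assume "x \<in> component ?E v"
      then have "(v, x) \<in> (adj ?E)\<^sup>*" by (simp add: in_component)
      then show "x \<in> component E v"
      proof (rule reachable_closed)
        fix a b assume a: "a \<in> component E v" and ab: "{a, b} \<in> ?E"
        have "{a, b} \<notin> star j N" using a c jc[OF v] star_edge by blast
        then show "b \<in> component E v" using component_closed[of a b E v] ab a by blast
      qed simp
    qed
  qed (rule sub)
  show "component ?E v = component ?E j" if meets: "v \<in> V" "component E v \<inter> N \<noteq> {}"
  proof -
    obtain u where "u \<in> N" "u \<in> component E v" using meets by blast
    then have "component ?E u = component ?E v" using sub[of v] by (intro component_eq) auto
    then show ?thesis using N_j[OF \<open>u \<in> N\<close>] by simp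
  qed
qed

definition components :: "'v set \<Rightarrow> 'v set set \<Rightarrow> 'v set set" where
  "components V E = component E ` V"

lemma Union_components: "E \<subseteq> Pow V \<Longrightarrow> \<Union>(components V E) = V"
  using component_subset[of _ V E] component_refl[of _ E] unfolding components_def by blast

lemma disjoint_components: "disjoint (components V E)"
  unfolding components_def
proof (rule disjointI, clarify)
  fix a b assume "component E a \<noteq> component E b"
  then show "component E a \<inter> component E b = {}"
    using component_eq by (metis disjoint_iff)
qed

lemma finite_components [simp]: "finite V \<Longrightarrow> finite (components V E)"
  by (simp add: components_def)

lemma components_star:
  assumes E: "E \<subseteq> Pow V" and j: "j \<notin> V" and N: "N \<subseteq> V"
  defines "A \<equiv> {C \<in> components V E. C \<inter> N \<noteq> {}}"
  shows "components (insert j V) (E \<union> star j N) = insert (insert j (\<Union>A)) (components V E - A)"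
proof -
  have "C = component E u" if "C \<in> components V E" "u \<in> C" for C u
    using that component_eq unfolding components_def by fastforce
  moreover have "component E u \<in> components V E" if "u \<in> N" for u
    using that N by (auto simp: components_def)
  ultimately have UA: "(\<Union>u\<in>N. component E u) = \<Union>A"
    using component_refl[of _ E] unfolding A_def by blast
  have "component (E \<union> star j N) ` V \<subseteq> insert (insert j (\<Union>A)) (components V E - A)"
  proof clarify
    fix v assume "v \<in> V" and *: "component (E \<union> star j N) v \<notin> components V E - A"
    then have "component E v \<inter> N \<noteq> {}"
      using component_star(2)[OF E j N, of v] by (auto simp: A_def components_def)
    then show "component (E \<union> star j N) v = insert j (\<Union>A)"
      using component_star(3)[OF E j N \<open>v \<in> V\<close>] component_star(1)[OF E j N] UA by simp
  qed
  moreover have "components V E - A \<subseteq> component (E \<union> star j N) ` V"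
  proof
    fix C assume "C \<in> components V E - A"
    then obtain v where "v \<in> V" "C = component E v" "component E v \<inter> N = {}"
      by (auto simp: components_def A_def)
    then show "C \<in> component (E \<union> star j N) ` V"
      using component_star(2)[OF E j N, of v] by blast
  qed
  ultimately show ?thesis
    unfolding components_def[of "insert j V"] image_insert component_star(1)[OF E j N] UA by blast
qed

text \<open>For the set \<open>P\<close> of components of a forest, these are the possible neighbourhoods of a new vertex.\<close>

definition transversals :: "'v set set \<Rightarrow> 'v set set" where
  "transversals P = {N. N \<subseteq> \<Union>P \<and> (\<forall>C\<in>P. \<forall>u\<in>N \<inter> C. \<forall>v\<in>N \<inter> C. u = v)}"

text \<open>A transversal selects one element from each of the sets that it meets.\<close>

lemma transversals_choice:
  assumes "disjoint P" "A \<subseteq> P"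
  shows "bij_betw (\<lambda>f. f ` A) (PiE A (\<lambda>C. C)) {N \<in> transversals P. {C \<in> P. C \<inter> N \<noteq> {}} = A}"
proof (rule bij_betwI')
  have other: "C = D" if "C \<in> P" "D \<in> P" "v \<in> C" "v \<in> D" for C D v
    using that assms(1) by (meson disjointD disjoint_iff)
  have nth: "f C \<in> C" if "f \<in> PiE A (\<lambda>C. C)" "C \<in> A" for f C
    using that by (auto dest: PiE_mem)
  show "(f ` A = g ` A) = (f = g)" if f: "f \<in> PiE A (\<lambda>C. C)" and g: "g \<in> PiE A (\<lambda>C. C)" for f g
  proof
    assume eq: "f ` A = g ` A"
    show "f = g"
    proof (rule PiE_ext[OF f g])
      fix C assume C: "C \<in> A"
      then obtain D where D: "D \<in> A" "f C = g D" using eq by blast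
      then have "C = D" using other[of C D "f C"] nth[OF f C] nth[OF g] C assms(2) by auto
      then show "f C = g C" using D by simp
    qed
  qed simp
  show "f ` A \<in> {N \<in> transversals P. {C \<in> P. C \<inter> N \<noteq> {}} = A}" if f: "f \<in> PiE A (\<lambda>C. C)" for f
  proof -
    have fC: "C \<in> P \<Longrightarrow> D \<in> A \<Longrightarrow> f D \<in> C \<Longrightarrow> C = D" for C D
      using other[of C D "f D"] nth[OF f] assms(2) by auto
    have "f ` A \<in> transversals P"
      unfolding transversals_def using nth[OF f] assms(2) by (auto dest: fC)
    moreover have "{C \<in> P. C \<inter> f ` A \<noteq> {}} = A"
    proof (intro equalityI subsetI)
      fix C assume "C \<in> A"
      then show "C \<in> {C \<in> P. C \<inter> f ` A \<noteq> {}}" using nth[OF f, of C] assms(2) by blast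
    qed (auto dest: fC)
    ultimately show ?thesis by blast
  qed
  show "\<exists>f\<in>PiE A (\<lambda>C. C). N = f ` A" if N: "N \<in> {N \<in> transversals P. {C \<in> P. C \<inter> N \<noteq> {}} = A}" for N
  proof
    define f where "f = restrict (\<lambda>C. SOME v. v \<in> C \<inter> N) A"
    have f: "f C \<in> C \<inter> N" if "C \<in> A" for C
    proof -
      have "\<exists>v. v \<in> C \<inter> N" using N that by blast
      then show ?thesis unfolding f_def using that by (simp del: Int_iff) (rule someI_ex)
    qed
    show "f \<in> PiE A (\<lambda>C. C)" using f by (auto simp: f_def)
    show "N = f ` A"
    proof
      show "f ` A \<subseteq> N" using f by auto
      show "N \<subseteq> f ` A"
      proof
        fix v assume v: "v \<in> N"
        then obtain C where C: "C \<in> P" "v \<in> C" using N by (auto simp: transversals_def)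
        then have "C \<in> A" using N v by blast
        moreover have "f C = v"
          using f[OF \<open>C \<in> A\<close>] v C N by (auto simp: transversals_def)
        ultimately show "v \<in> f ` A" by blast
      qed
    qed
  qed
qed

text \<open>Here \<open>A\<close> is the set of components to which a new vertex is joined, and \<open>x + (\<Sum>C\<in>A. c C)\<close> is the
  size of the resulting component if \<open>x = 1\<close> and \<open>c\<close> is the cardinality. In the induction \<open>x\<close> has to
  vary: putting a further component \<open>C\<close> into \<open>A\<close> replaces \<open>x\<close> by \<open>x + c C\<close>.\<close>

lemma sum_subsets_weighted:
  fixes x y s :: "'a::comm_semiring_1" and c :: "'b \<Rightarrow> 'a"
  assumes "finite P" "P \<noteq> {}"
  shows "(\<Sum>A\<in>Pow P. y ^ card A * s ^ card (P - A) * (x + (\<Sum>C\<in>A. c C))) =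
    (y + s) ^ (card P - 1) * (x * (y + s) + y * (\<Sum>C\<in>P. c C))"
  using assms
proof (induction P arbitrary: x rule: finite_ne_induct)
  case (singleton C)
  have "Pow {C} = {{}, {C}}" by auto
  then show ?case by (simp add: algebra_simps)
next
  case (insert C P)
  let ?f = "\<lambda>P x A. y ^ card A * s ^ card (P - A) * (x + (\<Sum>C\<in>A. c C))"
  have "Pow (insert C P) = Pow P \<union> insert C ` Pow P" by (rule Pow_insert)
  moreover have "Pow P \<inter> insert C ` Pow P = {}" using insert.hyps by auto
  ultimately have "sum (?f (insert C P) x) (Pow (insert C P)) =
      sum (?f (insert C P) x) (Pow P) + sum (?f (insert C P) x) (insert C ` Pow P)"
    using insert.hyps by (simp add: sum.union_disjoint)
  also have "sum (?f (insert C P) x) (Pow P) = s * sum (?f P x) (Pow P)"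
    unfolding sum_distrib_left
  proof (intro sum.cong refl)
    fix A assume A: "A \<in> Pow P"
    then have "insert C P - A = insert C (P - A)" using insert.hyps by auto
    then have "card (insert C P - A) = Suc (card (P - A))" using insert.hyps A by simp
    then show "?f (insert C P) x A = s * ?f P x A" by (simp add: algebra_simps)
  qed
  also have "sum (?f (insert C P) x) (insert C ` Pow P) = sum (\<lambda>A. ?f (insert C P) x (insert C A)) (Pow P)"
    using insert.hyps by (subst sum.reindex) (auto intro!: inj_onI simp: o_def insert_eq_iff dest: PowD)
  also have "\<dots> = y * sum (?f P (x + c C)) (Pow P)"
    unfolding sum_distrib_left
  proof (intro sum.cong refl)
    fix A assume A: "A \<in> Pow P"
    then have "C \<notin> A" "finite A" using insert.hyps finite_subset by auto
    moreover have "insert C P - insert C A = P - A" using insert.hyps A by auto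
    ultimately show "?f (insert C P) x (insert C A) = y * ?f P (x + c C) A" by (simp add: algebra_simps)
  qed
  also have "s * sum (?f P x) (Pow P) + y * sum (?f P (x + c C)) (Pow P) =
      (y + s) ^ (card P - 1) * (y + s) * (x * (y + s) + y * (c C + (\<Sum>C\<in>P. c C)))"
    unfolding insert.IH by (simp add: algebra_simps)
  also have "(y + s) ^ (card P - 1) * (y + s) = (y + s) ^ (card (insert C P) - 1)"
    using insert.hyps by (cases "card P") (auto simp: card_gt_0_iff power_Suc2 simp del: power_Suc)
  finally show ?case using insert.hyps by simp
qed

text \<open>This is one step of the recursion for the weighted number of trees: \<open>y\<close> is the weight of an edge
  between the new vertex \<open>j\<close> and the old ones, and \<open>s\<close> is the total weight of the vertices still to
  come. A set \<open>A\<close> of components can be joined to \<open>j\<close> in \<open>(\<Prod>C\<in>A. card C)\<close> ways, the same factor that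
  the components in \<open>A\<close> lose by being merged.\<close>

lemma sum_transversals:
  fixes y s :: "'a::comm_semiring_1"
  assumes V: "finite V" "V \<noteq> {}" and j: "j \<notin> V" and E: "E \<subseteq> Pow V"
  shows "(\<Sum>N\<in>transversals (components V E). y ^ card N *
        (of_nat (\<Prod>C\<in>components (insert j V) (E \<union> star j N). card C) *
         s ^ (card (components (insert j V) (E \<union> star j N)) - 1))) =
    of_nat (\<Prod>C\<in>components V E. card C) * (y + s) ^ (card (components V E) - 1) *
      (of_nat (Suc (card V)) * y + s)"
proof -
  define P where "P = components V E"
  define T where "T = (\<lambda>A. {N \<in> transversals P. {C \<in> P. C \<inter> N \<noteq> {}} = A})"
  define h where "h N = y ^ card N * (of_nat (\<Prod>C\<in>components (insert j V) (E \<union> star j N). card C) *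
         s ^ (card (components (insert j V) (E \<union> star j N)) - 1))" for N
  have P: "finite P" "P \<noteq> {}" "disjoint P" "\<Union>P = V"
    unfolding P_def using V disjoint_components Union_components[OF E]
    by (simp_all, simp add: components_def)
  have finC: "finite C" if "C \<in> P" for C using that P V by (meson Union_upper finite_subset)
  have finT: "finite (transversals P)"
    by (rule finite_subset[of _ "Pow V"]) (use V P in \<open>auto simp: transversals_def\<close>)
  have "sum h (transversals P) = (\<Sum>A\<in>Pow P. sum h (T A))"
    unfolding T_def using finT P by (subst sum.group) auto
  also have "\<dots> = (\<Sum>A\<in>Pow P. of_nat (\<Prod>C\<in>P. card C) *
      (y ^ card A * s ^ card (P - A) * (1 + (\<Sum>C\<in>A. of_nat (card C)))))"
  proof (intro sum.cong refl)
    fix A assume "A \<in> Pow P"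
    then have A: "A \<subseteq> P" "finite A" using P finite_subset by auto
    have "h N = y ^ card A * (of_nat (\<Prod>C\<in>P - A. card C) * of_nat (Suc (\<Sum>C\<in>A. card C)) * s ^ card (P - A))"
      if N: "N \<in> T A" for N
    proof -
      have "N \<in> (\<lambda>f. f ` A) ` PiE A (\<lambda>C. C)"
        using N bij_betw_imp_surj_on[OF transversals_choice[OF P(3) A(1)]] unfolding T_def by simp
      then obtain f where f: "f \<in> PiE A (\<lambda>C. C)" "N = f ` A" by auto
      have "inj_on f A"
      proof (rule inj_onI)
        fix C D assume CD: "C \<in> A" "D \<in> A" "f C = f D"
        then have "f C \<in> C" "f C \<in> D" using PiE_mem[OF f(1), of C] PiE_mem[OF f(1), of D] by simp_all
        then show "C = D" using disjointD[OF P(3), of C D] CD A(1) by blast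
      qed
      then have cN: "card N = card A" using f by (simp add: card_image)
      have "N \<subseteq> V" using N P unfolding T_def transversals_def by auto
      moreover have "A = {C \<in> components V E. C \<inter> N \<noteq> {}}" using N unfolding T_def P_def by auto
      ultimately have comps: "components (insert j V) (E \<union> star j N) = insert (insert j (\<Union>A)) (P - A)"
        using components_star[OF E j] unfolding P_def by simp
      have UA: "\<Union>A \<subseteq> V" using A P by blast
      have new: "insert j (\<Union>A) \<notin> P - A" using P j by auto
      have "card (\<Union>A) = (\<Sum>C\<in>A. card C)"
        using pairwise_subset[OF P(3) A(1)] finC A by (intro card_Union_disjoint) auto
      moreover have "finite (\<Union>A)" "j \<notin> \<Union>A" using UA V j finite_subset by auto
      ultimately have "card (insert j (\<Union>A)) = Suc (\<Sum>C\<in>A. card C)" by simp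
      then show ?thesis
        unfolding h_def comps cN using new P(1) by (simp add: algebra_simps)
    qed
    then have "sum h (T A) = of_nat (card (T A)) *
        (y ^ card A * (of_nat (\<Prod>C\<in>P - A. card C) * of_nat (Suc (\<Sum>C\<in>A. card C)) * s ^ card (P - A)))"
      by simp
    also have "card (T A) = (\<Prod>C\<in>A. card C)"
      using bij_betw_same_card[OF transversals_choice[OF P(3) A(1)]] A unfolding T_def
      by (simp add: card_PiE)
    also have "of_nat (\<Prod>C\<in>A. card C) *
        (y ^ card A * (of_nat (\<Prod>C\<in>P - A. card C) * of_nat (Suc (\<Sum>C\<in>A. card C)) * s ^ card (P - A))) =
      of_nat ((\<Prod>C\<in>P - A. card C) * (\<Prod>C\<in>A. card C)) * (y ^ card A * s ^ card (P - A) * (1 + (\<Sum>C\<in>A. of_nat (card C))))"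
      by (simp add: mult_ac)
    also have "(\<Prod>C\<in>P - A. card C) * (\<Prod>C\<in>A. card C) = (\<Prod>C\<in>P. card C)"
      using P A by (simp add: prod.subset_diff)
    finally show "sum h (T A) = of_nat (\<Prod>C\<in>P. card C) *
      (y ^ card A * s ^ card (P - A) * (1 + (\<Sum>C\<in>A. of_nat (card C))))" .
  qed
  also have "\<dots> = of_nat (\<Prod>C\<in>P. card C) *
      ((y + s) ^ (card P - 1) * (1 * (y + s) + y * (\<Sum>C\<in>P. of_nat (card C))))"
    unfolding sum_distrib_left[symmetric] sum_subsets_weighted[OF P(1,2)] ..
  also have "(\<Sum>C\<in>P. of_nat (card C)) = (of_nat (card V) :: 'a)"
    using card_Union_disjoint[OF P(3) finC] P by (simp flip: of_nat_sum)
  also have "1 * (y + s) + y * of_nat (card V) = of_nat (Suc (card V)) * y + s"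
    by (simp add: algebra_simps)
  finally show ?thesis unfolding P_def h_def by (simp add: mult.assoc)
qed

section \<open>The generating function of trees by larger endpoints of edges\<close>

definition new_edges :: "nat set set \<Rightarrow> nat \<Rightarrow> nat" where
  "new_edges E r = card {e \<in> E. Max e = r}"

definition extensions :: "nat \<Rightarrow> nat \<Rightarrow> nat set set \<Rightarrow> nat set set set" where
  "extensions n k F = {E \<in> labeled_trees n. {e \<in> E. e \<subseteq> {1..k}} = F}"

lemma labeled_trees_subset: "E \<in> labeled_trees n \<Longrightarrow> E \<subseteq> Pow {1..n}"
  by (auto simp: labeled_trees_def is_tree_def)

lemma finite_labeled_trees: "finite (labeled_trees n)"
  by (rule finite_subset[of _ "Pow (Pow {1..n})"]) (blast dest: labeled_trees_subset, simp)

lemma finite_labeled_tree: "E \<in> labeled_trees n \<Longrightarrow> finite E"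
  using labeled_trees_subset finite_subset by (metis finite_Pow_iff finite_atLeastAtMost)

lemma finite_extensions: "finite (extensions n k F)"
  using finite_labeled_trees by (simp add: extensions_def)

lemma restrict_Suc:
  assumes "E \<subseteq> {e. e \<subseteq> {1..n} \<and> card e = 2}"
  shows "{e \<in> E. e \<subseteq> {1..Suc k}} = {e \<in> E. e \<subseteq> {1..k}} \<union> star (Suc k) {v \<in> {1..k}. {Suc k, v} \<in> E}"
    (is "?L = ?R")
proof
  show "?L \<subseteq> ?R"
  proof
    fix e assume e: "e \<in> ?L"
    show "e \<in> ?R"
    proof (cases "Suc k \<in> e")
      case True
      have "card e = 2" using e assms by auto
      then obtain v where v: "e = {Suc k, v}" "v \<noteq> Suc k"
        using True by (auto simp: card_2_iff)
      then have "v \<in> {1..k}" using e by auto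
      then show ?thesis using e v by (auto simp: star_def)
    next
      case False
      then have "e \<subseteq> {1..k}" using e by (auto simp: le_Suc_eq subset_iff)
      then show ?thesis using e by auto
    qed
  qed
qed (auto simp: star_def)

lemma star_inj:
  assumes "j \<notin> V" "F \<subseteq> Pow V" "N \<subseteq> V" "N' \<subseteq> V" "F \<union> star j N = F \<union> star j N'"
  shows "N = N'"
proof -
  have mem: "v \<in> N \<longleftrightarrow> {j, v} \<in> F \<union> star j N" if "N \<subseteq> V" "v \<in> V" for v N
    using assms(1,2) that by (auto simp: star_def doubleton_eq_iff)
  have "v \<in> N \<longleftrightarrow> v \<in> N'" for v
  proof (cases "v \<in> V")
    case True
    then show ?thesis using mem[of N v] mem[of N' v] assms(3-5) by simp
  qed (use assms(3,4) in blast)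
  then show ?thesis by blast
qed

text \<open>A tree that extends \<open>F\<close> induces on one more vertex a forest, and this is \<open>F\<close> with a star attached
  to a transversal of the components.\<close>

lemma extensions_Suc:
  assumes F: "F \<subseteq> Pow {1..k}" and k: "k < n"
  shows "extensions n k F =
    (\<Union>N\<in>transversals (components {1..k} F). extensions n (Suc k) (F \<union> star (Suc k) N))"
    (is "?L = ?R")
proof
  have U: "\<Union>(components {1..k} F) = {1..k}" by (rule Union_components[OF F])
  show "?L \<subseteq> ?R"
  proof
    fix E assume E: "E \<in> ?L"
    define N where "N = {v \<in> {1..k}. {Suc k, v} \<in> E}"
    have tree: "E \<subseteq> {e. e \<subseteq> {1..n} \<and> card e = 2}" "forest E"
      using E by (auto simp: extensions_def labeled_trees_def is_tree_iff)
    have *: "{e \<in> E. e \<subseteq> {1..Suc k}} = F \<union> star (Suc k) N"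
      using restrict_Suc[OF tree(1)] E unfolding N_def extensions_def by auto
    have "forest (F \<union> star (Suc k) N)"
      using tree(2) unfolding *[symmetric] by (rule forest_mono) auto
    then have uniq: "\<And>u v. u \<in> N \<Longrightarrow> v \<in> N \<Longrightarrow> component F u = component F v \<Longrightarrow> u = v"
    proof -
      have "N \<subseteq> {1..k}" "Suc k \<notin> {1..k}" by (auto simp: N_def)
      from forest_star_iff[OF F this(2,1)]
      show "\<And>u v. u \<in> N \<Longrightarrow> v \<in> N \<Longrightarrow> component F u = component F v \<Longrightarrow> u = v"
        using \<open>forest (F \<union> star (Suc k) N)\<close> by blast
    qed
    have "N \<in> transversals (components {1..k} F)"
      unfolding transversals_def U
    proof (intro CollectI conjI ballI)
      fix C u v assume "C \<in> components {1..k} F" "u \<in> N \<inter> C" "v \<in> N \<inter> C"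
      then show "u = v"
        using uniq[of u v] component_eq[of u F] component_eq[of v F] by (auto simp: components_def)
    qed (auto simp: N_def)
    then show "E \<in> ?R" using * E by (auto simp: extensions_def)
  qed
  show "?R \<subseteq> ?L"
  proof
    fix E assume "E \<in> ?R"
    then obtain N where N: "N \<in> transversals (components {1..k} F)"
      and E: "E \<in> labeled_trees n" "{e \<in> E. e \<subseteq> {1..Suc k}} = F \<union> star (Suc k) N"
      by (auto simp: extensions_def)
    have "{e \<in> E. e \<subseteq> {1..k}} = {e \<in> {e \<in> E. e \<subseteq> {1..Suc k}}. e \<subseteq> {1..k}}" by auto
    also have "\<dots> = F" unfolding E(2) using F by (auto simp: star_def)
    finally show "E \<in> ?L" using E by (auto simp: extensions_def)
  qed
qed

lemma new_edges_extension:
  assumes F: "F \<subseteq> Pow {1..k}" and N: "N \<subseteq> {1..k}" and E: "E \<in> extensions n (Suc k) (F \<union> star (Suc k) N)"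
  shows "new_edges E (Suc k) = card N"
proof -
  have R: "{e \<in> E. e \<subseteq> {1..Suc k}} = F \<union> star (Suc k) N" and tree: "E \<subseteq> {e. e \<subseteq> {1..n} \<and> card e = 2}"
    using E by (auto simp: extensions_def labeled_trees_def is_tree_iff)
  have fin: "finite e" "e \<noteq> {}" "e \<subseteq> {1..n}" if "e \<in> E" for e
    using tree that by (auto simp: card_2_iff subset_iff)
  have "{e \<in> E. Max e = Suc k} = star (Suc k) N"
  proof (intro equalityI subsetI)
    fix e assume e: "e \<in> {e \<in> E. Max e = Suc k}"
    have "x \<le> Suc k" if "x \<in> e" for x
    proof -
      have "Max e = Suc k" "finite e" using e fin(1)[of e] by auto
      then show ?thesis using that by (metis Max_ge)
    qed
    then have "e \<subseteq> {1..Suc k}" using fin(3)[of e] e by (auto simp: subset_iff)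
    moreover have Se: "Suc k \<in> e" using e Max_in[of e] fin[of e] by auto
    moreover from Se have "e \<notin> F" using F atLeastAtMost_iff[of "Suc k" 1 k] by (meson PowD Suc_n_not_le_n subsetD)
    ultimately show "e \<in> star (Suc k) N" using R e by blast
  next
    fix e assume e: "e \<in> star (Suc k) N"
    then have "e \<in> E" using R by blast
    moreover have "Max e = Suc k" using e N by (auto simp: star_def intro!: Max_eqI)
    ultimately show "e \<in> {e \<in> E. Max e = Suc k}" by simp
  qed
  moreover have "card (star (Suc k) N) = card N"
    unfolding star_def using N by (intro card_image) (auto simp: inj_on_def doubleton_eq_iff)
  ultimately show ?thesis by (simp add: new_edges_def)
qed

text \<open>The induction runs from \<open>k = n\<close> downwards. Multiplication by \<open>n\<close> avoids a division: for \<open>k = n\<close> the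
  right-hand side is \<open>(\<Prod>C. card C) * 0 ^ (m - 1)\<close> with \<open>m\<close> components, that is \<open>n\<close> if \<open>F\<close> is a tree
  and \<open>0\<close> otherwise.\<close>

lemma sum_extensions:
  fixes y :: "nat \<Rightarrow> 'a::comm_semiring_1"
  assumes "1 \<le> k" "k \<le> n" "F \<subseteq> {e. e \<subseteq> {1..k} \<and> card e = 2}" "forest F"
  shows "of_nat n * (\<Sum>E\<in>extensions n k F. \<Prod>r\<in>{k<..n}. y r ^ new_edges E r) =
     of_nat (\<Prod>C\<in>components {1..k} F. card C) * (\<Sum>r\<in>{k<..n}. y r) ^ (card (components {1..k} F) - 1)
      * (\<Prod>r\<in>{k<..n}. of_nat r * y r + (\<Sum>i\<in>{r<..n}. y i))"
  using assms(2,1,3,4)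
proof (induction k arbitrary: F rule: inc_induct)
  case base
  let ?P = "components {1..n} F"
  have F: "F \<subseteq> Pow {1..n}" using base by auto
  have fin: "finite ?P" by simp
  have ne: "?P \<noteq> {}" using base by (auto simp: components_def)
  show ?case
  proof (cases "card ?P = 1")
    case True
    then obtain C where C: "?P = {C}" by (rule card_1_singletonE)
    then have "C = {1..n}" using Union_components[OF F] by simp
    then have comp: "component F v = {1..n}" if "v \<in> {1..n}" for v
      using C that by (auto simp: components_def)
    have "(u, v) \<in> (adj F)\<^sup>*" if "u \<in> {1..n}" "v \<in> {1..n}" for u v
      using comp[OF that(1)] that(2) in_component[of v F u] by simp
    then have "F \<in> labeled_trees n" using base by (auto simp: labeled_trees_def is_tree_iff)
    moreover have "E = F" if "E \<in> extensions n n F" for E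
    proof -
      have "E \<subseteq> Pow {1..n}" using that labeled_trees_subset by (auto simp: extensions_def)
      then have "{e \<in> E. e \<subseteq> {1..n}} = E" by auto
      then show ?thesis using that by (auto simp: extensions_def)
    qed
    moreover have "{e \<in> F. e \<subseteq> {1..n}} = F" using F by auto
    ultimately have "extensions n n F = {F}" by (auto simp: extensions_def)
    then show ?thesis using C \<open>C = {1..n}\<close> by simp
  next
    case False
    then have "card ?P > 1" using fin ne by (metis One_nat_def Suc_lessI card_gt_0_iff)
    moreover have "extensions n n F = {}"
    proof (rule ccontr)
      assume "extensions n n F \<noteq> {}"
      then obtain E where "E \<in> labeled_trees n" "{e \<in> E. e \<subseteq> {1..n}} = F" by (auto simp: extensions_def)
      moreover from this(1) have "{e \<in> E. e \<subseteq> {1..n}} = E" using labeled_trees_subset[of E n] by blast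
      ultimately have "F \<in> labeled_trees n" by simp
      then have "component F v = {1..n}" if "v \<in> {1..n}" for v
        using that component_subset[OF that F] by (auto simp: labeled_trees_def is_tree_iff in_component)
      then have "?P \<subseteq> {{1..n}}" by (auto simp: components_def)
      then have "card ?P \<le> 1" using card_mono[of "{{1..n}}" ?P] by simp
      then show False using \<open>card ?P > 1\<close> by simp
    qed
    ultimately show ?thesis by (cases "card ?P - 1") simp_all
  qed
next
  case (step k)
  have F: "F \<subseteq> Pow {1..k}" using step.prems by auto
  have U: "\<Union>(components {1..k} F) = {1..k}" by (rule Union_components[OF F])
  let ?T = "transversals (components {1..k} F)"
  let ?F = "\<lambda>N. F \<union> star (Suc k) N"
  have iv: "{1..Suc k} = insert (Suc k) {1..k}" "{k<..n} = insert (Suc k) {Suc k<..n}"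
    using step.hyps by auto
  define s where "s = (\<Sum>r\<in>{Suc k<..n}. y r)"
  define R where "R = (\<Prod>r\<in>{Suc k<..n}. of_nat r * y r + (\<Sum>i\<in>{r<..n}. y i))"
  have N: "N \<subseteq> {1..k}" if "N \<in> ?T" for N using that U by (auto simp: transversals_def)
  have "finite ?T" by (rule finite_subset[of _ "Pow {1..k}"]) (use N in auto)
  moreover have "extensions n (Suc k) (?F N) \<inter> extensions n (Suc k) (?F N') = {}"
    if "N \<in> ?T" "N' \<in> ?T" "N \<noteq> N'" for N N'
  proof -
    have "?F N \<noteq> ?F N'" using star_inj[of "Suc k" "{1..k}" F N N'] F N that by auto
    then show ?thesis by (auto simp: extensions_def)
  qed
  ultimately have split: "(\<Sum>E\<in>extensions n k F. \<Prod>r\<in>{k<..n}. y r ^ new_edges E r) =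
      (\<Sum>N\<in>?T. \<Sum>E\<in>extensions n (Suc k) (?F N). \<Prod>r\<in>{k<..n}. y r ^ new_edges E r)"
    unfolding extensions_Suc[OF F step.hyps(2)]
    by (intro sum.UNION_disjoint) (auto simp: finite_extensions)
  have "of_nat n * (\<Sum>E\<in>extensions n k F. \<Prod>r\<in>{k<..n}. y r ^ new_edges E r) =
    (\<Sum>N\<in>?T. y (Suc k) ^ card N *
      (of_nat n * (\<Sum>E\<in>extensions n (Suc k) (?F N). \<Prod>r\<in>{Suc k<..n}. y r ^ new_edges E r)))"
    unfolding split sum_distrib_left
  proof (intro sum.cong refl)
    fix M E assume M: "M \<in> ?T" and E: "E \<in> extensions n (Suc k) (?F M)"
    have "new_edges E (Suc k) = card M" by (rule new_edges_extension[OF F N[OF M] E])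
    then show "of_nat n * (\<Prod>r\<in>{k<..n}. y r ^ new_edges E r) =
        y (Suc k) ^ card M * (of_nat n * (\<Prod>r\<in>{Suc k<..n}. y r ^ new_edges E r))"
      unfolding iv(2) by (simp add: mult_ac)
  qed
  also have "\<dots> = (\<Sum>N\<in>?T. y (Suc k) ^ card N *
     (of_nat (\<Prod>C\<in>components {1..Suc k} (?F N). card C) * s ^ (card (components {1..Suc k} (?F N)) - 1))) * R"
    unfolding sum_distrib_right
  proof (intro sum.cong refl)
    fix M assume M: "M \<in> ?T"
    have star: "star (Suc k) M \<subseteq> {e. e \<subseteq> {1..Suc k} \<and> card e = 2}"
    proof
      fix e assume "e \<in> star (Suc k) M"
      then obtain v where "v \<in> {1..k}" "e = {Suc k, v}" using N[OF M] by (auto simp: star_def)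
      then show "e \<in> {e. e \<subseteq> {1..Suc k} \<and> card e = 2}" by auto
    qed
    have "{1..k} \<subseteq> {1..Suc k}" by auto
    then have "F \<subseteq> {e. e \<subseteq> {1..Suc k} \<and> card e = 2}" using step.prems(2) by blast
    then have sub: "?F M \<subseteq> {e. e \<subseteq> {1..Suc k} \<and> card e = 2}" using star by blast
    have forest: "forest (?F M)"
    proof -
      have "u = v" if "u \<in> M" "v \<in> M" "component F u = component F v" for u v
      proof -
        have "component F u \<in> components {1..k} F" using N[OF M] that by (auto simp: components_def)
        moreover have "u \<in> component F u" "v \<in> component F u"
          using that(3) component_refl[of u F] component_refl[of v F] by metis+
        ultimately show ?thesis using M that(1,2) unfolding transversals_def by blast
      qed
      moreover have "Suc k \<notin> {1..k}" by simp
      ultimately show ?thesis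
        using forest_star_iff[OF F _ N[OF M], of "Suc k"] step.prems(3) by blast
    qed
    have "1 \<le> Suc k" by simp
    note IH = step.IH[OF this sub forest]
    show "y (Suc k) ^ card M *
      (of_nat n * (\<Sum>E\<in>extensions n (Suc k) (?F M). \<Prod>r\<in>{Suc k<..n}. y r ^ new_edges E r)) =
     y (Suc k) ^ card M *
     (of_nat (\<Prod>C\<in>components {1..Suc k} (?F M). card C) * s ^ (card (components {1..Suc k} (?F M)) - 1)) * R"
      unfolding IH s_def R_def by (simp only: mult.assoc)
  qed
  also have "(\<Sum>N\<in>?T. y (Suc k) ^ card N *
     (of_nat (\<Prod>C\<in>components {1..Suc k} (?F N). card C) * s ^ (card (components {1..Suc k} (?F N)) - 1))) =
    of_nat (\<Prod>C\<in>components {1..k} F. card C) * (y (Suc k) + s) ^ (card (components {1..k} F) - 1) *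
      (of_nat (Suc k) * y (Suc k) + s)"
    using sum_transversals[of "{1..k}" "Suc k" F "y (Suc k)" s] F step.prems unfolding iv(1) by simp
  finally show ?case unfolding iv(2) R_def s_def by (simp add: mult_ac)
qed

lemma sum_labeled_trees:
  fixes y :: "nat \<Rightarrow> 'a::comm_semiring_1"
  assumes "1 \<le> n"
  shows "of_nat n * (\<Sum>E\<in>labeled_trees n. \<Prod>r\<in>{1<..n}. y r ^ new_edges E r) =
     (\<Prod>r\<in>{1<..n}. of_nat r * y r + (\<Sum>i\<in>{r<..n}. y i))"
proof -
  have "\<not> e \<subseteq> {1..1}" if "E \<in> labeled_trees n" "e \<in> E" for E and e :: "nat set"
  proof -
    have "card e = 2" using that by (auto simp: labeled_trees_def is_tree_def)
    then show ?thesis using card_mono[of "{1..1::nat}" e] by auto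
  qed
  then have "extensions n 1 {} = labeled_trees n" by (auto simp: extensions_def)
  moreover have "forest {}" by (simp add: forest_def)
  moreover have "components {1..1::nat} {} = {{1}}"
    using component_subset[of 1 "{1..1::nat}" "{}"] component_refl[of "1::nat" "{}"] by (auto simp: components_def)
  ultimately show ?thesis using sum_extensions[of 1 n "{}" y] assms by simp
qed

section \<open>The law of the induced edge numbers\<close>

lemma digits_unique:
  fixes f g :: "nat \<Rightarrow> nat"
  assumes "\<And>r. f r < B" "\<And>r. g r < B" "(\<Sum>r<n. f r * B ^ r) = (\<Sum>r<n. g r * B ^ r)" "r < n"
  shows "f r = g r"
  using assms
proof (induction n arbitrary: f g r)
  case (Suc n)
  have shift: "(\<Sum>r<Suc n. h r * B ^ r) = h 0 + B * (\<Sum>r<n. h (Suc r) * B ^ r)" for h :: "nat \<Rightarrow> nat"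
    by (simp add: sum.lessThan_Suc_shift sum_distrib_left mult_ac del: sum.lessThan_Suc)
  have eq: "f 0 + B * (\<Sum>r<n. f (Suc r) * B ^ r) = g 0 + B * (\<Sum>r<n. g (Suc r) * B ^ r)"
    using Suc.prems(3) unfolding shift .
  then have "(f 0 + B * (\<Sum>r<n. f (Suc r) * B ^ r)) mod B = (g 0 + B * (\<Sum>r<n. g (Suc r) * B ^ r)) mod B"
    by simp
  then have 0: "f 0 = g 0" using Suc.prems(1,2)[of 0] by simp
  moreover have "B > 0" using Suc.prems(1)[of 0] by simp
  ultimately have "(\<Sum>r<n. f (Suc r) * B ^ r) = (\<Sum>r<n. g (Suc r) * B ^ r)" using eq by simp
  from Suc.IH[OF Suc.prems(1,2) this] have "r' < n \<Longrightarrow> f (Suc r') = g (Suc r')" for r' .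
  then show ?case using 0 Suc.prems(4) by (cases r) auto
qed simp

text \<open>The analogue of \<^const>\<open>new_edges\<close> for a map \<open>u\<close>: the pairs \<open>{r, u r}\<close> take the place of the edges.\<close>

definition level_size :: "nat \<Rightarrow> (nat \<Rightarrow> nat) \<Rightarrow> nat \<Rightarrow> nat" where
  "level_size n u s = card {r \<in> {1<..n}. max r (u r) = s}"

definition random_map :: "nat \<Rightarrow> (nat \<Rightarrow> nat) pmf" where
  "random_map n = Pi_pmf {1<..n} 0 (\<lambda>_. pmf_of_set {1..n})"

abbreviation maps :: "nat \<Rightarrow> (nat \<Rightarrow> nat) set" where
  "maps n \<equiv> PiE_dflt {1<..n} 0 (\<lambda>_. {1..n})"

lemma random_map_eq: "1 \<le> n \<Longrightarrow> random_map n = pmf_of_set (maps n)"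
  unfolding random_map_def by (rule Pi_pmf_of_set) auto

text \<open>The factor for \<open>r\<close> in the generating function of trees is the sum of \<open>y (max r v)\<close> over all
  \<open>v \<in> {1..n}\<close>. Expanding the product gives one term for each map.\<close>

lemma tree_map_polynomial:
  fixes y :: "nat \<Rightarrow> 'a::comm_semiring_1"
  assumes "1 \<le> n"
  shows "of_nat n * (\<Sum>E\<in>labeled_trees n. \<Prod>r\<in>{1<..n}. y r ^ new_edges E r) =
     (\<Sum>u\<in>maps n. \<Prod>r\<in>{1<..n}. y r ^ level_size n u r)"
proof -
  have "of_nat r * y r + (\<Sum>i\<in>{r<..n}. y i) = (\<Sum>v\<in>{1..n}. y (max r v))" if "r \<in> {1<..n}" for r
  proof -
    have "{1..n} = {1..r} \<union> {r<..n}" using that by auto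
    then have "(\<Sum>v\<in>{1..n}. y (max r v)) = (\<Sum>v\<in>{1..r}. y (max r v)) + (\<Sum>v\<in>{r<..n}. y (max r v))"
      by (simp add: sum.union_disjoint ivl_disj_int)
    also have "(\<Sum>v\<in>{1..r}. y (max r v)) = (\<Sum>v\<in>{1..r}. y r)" by (intro sum.cong) (auto simp: max_def)
    also have "(\<Sum>v\<in>{r<..n}. y (max r v)) = (\<Sum>v\<in>{r<..n}. y v)" by (intro sum.cong) (auto simp: max_def)
    finally show ?thesis by simp
  qed
  then have "(\<Prod>r\<in>{1<..n}. of_nat r * y r + (\<Sum>i\<in>{r<..n}. y i)) = (\<Prod>r\<in>{1<..n}. \<Sum>v\<in>{1..n}. y (max r v))"
    by (intro prod.cong) auto
  also have "\<dots> = (\<Sum>u\<in>PiE {1<..n} (\<lambda>_. {1..n}). \<Prod>r\<in>{1<..n}. y (max r (u r)))"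
    by (rule prod_sum_PiE) auto
  also have "\<dots> = (\<Sum>u\<in>maps n. \<Prod>r\<in>{1<..n}. y (max r (u r)))"
  proof (rule sum.reindex_bij_witness[of _ "\<lambda>u. restrict u {1<..n}" "\<lambda>u r. if r \<in> {1<..n} then u r else 0"])
    fix u :: "nat \<Rightarrow> nat" assume u: "u \<in> PiE {1<..n} (\<lambda>_. {1..n})"
    show "restrict (\<lambda>r. if r \<in> {1<..n} then u r else 0) {1<..n} = u"
      using u by (intro ext) (auto simp: restrict_def PiE_def extensional_def)
    show "(\<lambda>r. if r \<in> {1<..n} then u r else 0) \<in> maps n" using u by (auto simp: PiE_dflt_def)
    show "(\<Prod>r\<in>{1<..n}. y (max r (if r \<in> {1<..n} then u r else 0))) = (\<Prod>r\<in>{1<..n}. y (max r (u r)))"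
      by (intro prod.cong) auto
  next
    fix u assume u: "u \<in> maps n"
    then show "(\<lambda>r. if r \<in> {1<..n} then restrict u {1<..n} r else 0) = u"
      by (intro ext) (auto simp: PiE_dflt_def restrict_def)
    show "restrict u {1<..n} \<in> PiE {1<..n} (\<lambda>_. {1..n})" using u by (auto simp: PiE_dflt_def)
  qed
  also have "\<dots> = (\<Sum>u\<in>maps n. \<Prod>r\<in>{1<..n}. y r ^ level_size n u r)"
  proof (intro sum.cong refl)
    fix u assume u: "u \<in> maps n"
    have "(\<Prod>r\<in>{1<..n}. y (max r (u r))) = (\<Prod>s\<in>{1<..n}. \<Prod>r\<in>{r\<in>{1<..n}. max r (u r) = s}. y (max r (u r)))"
      using u by (intro prod.group[symmetric]) (auto simp: PiE_dflt_def split: if_splits)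
    also have "\<dots> = (\<Prod>s\<in>{1<..n}. y s ^ level_size n u s)"
      by (intro prod.cong refl) (simp add: level_size_def)
    finally show "(\<Prod>r\<in>{1<..n}. y (max r (u r))) = (\<Prod>r\<in>{1<..n}. y r ^ level_size n u r)" .
  qed
  finally show ?thesis using sum_labeled_trees[OF assms, of y] by simp
qed

lemma coeff_sum_monom_one:
  "finite S \<Longrightarrow> coeff (\<Sum>x\<in>S. monom (1::nat) (w x)) m = card {x \<in> S. w x = m}"
  by (simp add: coeff_sum flip: sum.inter_filter)

lemma coeff_of_nat_mult: "coeff (of_nat n * p) m = n * coeff p m" for p :: "nat poly"
  by (simp add: of_nat_poly)

text \<open>Kronecker substitution: for \<open>y r = X ^ (B ^ r)\<close> the generating functions become polynomials in one
  variable \<open>X\<close>, and if \<open>B\<close> exceeds all exponents, then the power of \<open>X\<close> still determines the whole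
  vector of exponents as its digits to base \<open>B\<close>.\<close>

lemma card_level_vectors:
  fixes v :: "nat \<Rightarrow> nat"
  assumes n: "1 \<le> n"
  shows "n * card {E \<in> labeled_trees n. \<forall>r\<in>{1<..n}. new_edges E r = v r} =
     card {u \<in> maps n. \<forall>r\<in>{1<..n}. level_size n u r = v r}"
proof -
  \<comment> \<open>The three summands bound the edge numbers, the level sizes and the entries of \<open>v\<close>. The range extends
    to \<open>Suc n\<close> so that the maximum is over a nonempty set also for \<open>n = 1\<close>.\<close>
  define B where "B = Suc (card (Pow {1..n}) + n + Max (v ` {1<..Suc n}))"
  define digit where "digit h = (\<lambda>r. if r \<in> {1<..n} then h r else 0 :: nat)" for h :: "nat \<Rightarrow> nat"
  define code where "code h = (\<Sum>r\<in>{1<..n}. h r * B ^ r)" for h :: "nat \<Rightarrow> nat"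
  have code: "code h = code g \<longleftrightarrow> (\<forall>r\<in>{1<..n}. h r = g r)"
    if "\<And>r. r \<in> {1<..n} \<Longrightarrow> h r < B" "\<And>r. r \<in> {1<..n} \<Longrightarrow> g r < B" for h g
  proof
    assume eq: "code h = code g"
    have digits: "code h' = (\<Sum>r<Suc n. digit h' r * B ^ r)" for h'
      unfolding code_def by (rule sum.mono_neutral_cong_left) (auto simp: digit_def)
    have sums: "(\<Sum>r<Suc n. digit h r * B ^ r) = (\<Sum>r<Suc n. digit g r * B ^ r)"
      by (rule trans[OF digits[symmetric] trans[OF eq digits]])
    have "0 < B" by (simp add: B_def)
    then have less: "digit h r < B" "digit g r < B" for r using that by (simp_all add: digit_def)
    show "\<forall>r\<in>{1<..n}. h r = g r"
    proof
      fix r assume r: "r \<in> {1<..n}"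
      then have "digit h r = digit g r" by (intro digits_unique[OF less sums]) simp
      then show "h r = g r" using r by (simp add: digit_def)
    qed
  qed (simp add: code_def)
  have monom_prod: "(\<Prod>r\<in>{1<..n}. monom 1 (B ^ r) ^ h r) = monom (1::nat) (code h)" for h
  proof -
    have "(\<Prod>r\<in>A. monom 1 (B ^ r) ^ h r) = monom (1::nat) (\<Sum>r\<in>A. h r * B ^ r)" if "finite A" for A
      using that
      by induction (auto simp: monom_power mult_monom mult.commute monom_eq_1_iff)
    then show ?thesis by (simp add: code_def)
  qed
  have finT: "finite (labeled_trees n)" by (rule finite_labeled_trees)
  have finM: "finite (maps n)" by (intro finite_PiE_dflt) auto
  have bT: "new_edges E r < B" if "E \<in> labeled_trees n" for E r
  proof -
    have "new_edges E r \<le> card (Pow {1..n})"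
      unfolding new_edges_def using labeled_trees_subset[OF that] by (intro card_mono) auto
    then show ?thesis by (simp add: B_def)
  qed
  have bM: "level_size n u r < B" for u r
  proof -
    have "level_size n u r \<le> card {1<..n}" unfolding level_size_def by (intro card_mono) auto
    then show ?thesis by (simp add: B_def)
  qed
  have bv: "v r < B" if "r \<in> {1<..n}" for r
  proof -
    have "v r \<le> Max (v ` {1<..Suc n})" using that by (intro Max_ge) auto
    then show ?thesis by (simp add: B_def)
  qed
  have "of_nat n * (\<Sum>E\<in>labeled_trees n. monom (1::nat) (code (new_edges E))) =
      (\<Sum>u\<in>maps n. monom 1 (code (level_size n u)))"
    using tree_map_polynomial[OF n, of "\<lambda>r. monom (1::nat) (B ^ r)"] unfolding monom_prod .
  then have "n * coeff (\<Sum>E\<in>labeled_trees n. monom (1::nat) (code (new_edges E))) (code v) =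
      coeff (\<Sum>u\<in>maps n. monom 1 (code (level_size n u))) (code v)"
    by (metis coeff_of_nat_mult)
  then have "n * card {E \<in> labeled_trees n. code (new_edges E) = code v} =
      card {u \<in> maps n. code (level_size n u) = code v}"
    unfolding coeff_sum_monom_one[OF finT] coeff_sum_monom_one[OF finM] .
  moreover have "code (new_edges E) = code v \<longleftrightarrow> (\<forall>r\<in>{1<..n}. new_edges E r = v r)" if "E \<in> labeled_trees n" for E
    using code bT[OF that] bv by blast
  moreover have "code (level_size n u) = code v \<longleftrightarrow> (\<forall>r\<in>{1<..n}. level_size n u r = v r)" for u
    using code bM bv by blast
  ultimately show ?thesis by (simp cong: conj_cong)
qed

lemma induced_edges_eq_sum:
  assumes E: "E \<in> labeled_trees n"
  shows "induced_edges j E = (\<Sum>r\<in>{1<..j}. new_edges E r)"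
proof -
  have e: "finite e" "e \<noteq> {}" "e \<subseteq> {1..n}" "card e = 2" if "e \<in> E" for e
    using E that by (auto simp: labeled_trees_def is_tree_def card_2_iff subset_iff)
  have Max: "1 < Max e" if "e \<in> E" for e
  proof (rule ccontr)
    assume "\<not> 1 < Max e"
    have "x = 1" if x: "x \<in> e" for x
    proof -
      have "x \<le> Max e" using e(1)[OF \<open>e \<in> E\<close>] x by simp
      moreover have "1 \<le> x" using e(3)[OF \<open>e \<in> E\<close>] x by auto
      ultimately show ?thesis using \<open>\<not> 1 < Max e\<close> by linarith
    qed
    then have "e \<subseteq> {1..1}" by auto
    then show False using card_mono[of "{1..1}" e] e(4)[OF that] by simp
  qed
  have "e \<subseteq> {1..j} \<longleftrightarrow> Max e \<in> {1<..j}" if "e \<in> E" for e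
    using e[OF that] Max[OF that] by (auto simp: subset_iff)
  then have "{e \<in> E. e \<subseteq> {1..j}} = (\<Union>r\<in>{1<..j}. {e \<in> E. Max e = r})" by blast
  then show ?thesis
    unfolding induced_edges_def new_edges_def
    by (simp, subst card_UN_disjoint) (auto simp: finite_labeled_tree[OF E])
qed

lemma card_maps_below:
  assumes "j \<le> n"
  shows "card {r \<in> {1<..j}. u r \<le> j} = (\<Sum>s\<in>{1<..j}. level_size n u s)"
proof -
  have "{r \<in> {1<..j}. u r \<le> j} = (\<Union>s\<in>{1<..j}. {r \<in> {1<..n}. max r (u r) = s})" using assms by auto
  then show ?thesis unfolding level_size_def by (simp, subst card_UN_disjoint) auto
qed

text \<open>Both sides are the same function of a vector, \<open>(d\<^sub>r)\<close> for the tree and the level sizes for the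
  map, and these vectors have the same law by the preceding count. The total number of maps is \<open>n\<close>
  times the number of trees.\<close>

theorem induced_edges_law:
  assumes n: "1 \<le> n"
  shows "map_pmf (\<lambda>E. \<lambda>j\<in>{..n}. induced_edges j E) (random_labeled_tree n) =
    map_pmf (\<lambda>u. \<lambda>j\<in>{..n}. card {r \<in> {1<..j}. u r \<le> j}) (random_map n)"
proof -
  define VT where "VT E = restrict (new_edges E) {1<..n}" for E
  define VM where "VM u = restrict (level_size n u) {1<..n}" for u
  have finT: "finite (labeled_trees n)" by (rule finite_labeled_trees)
  have finM: "finite (maps n)" by (intro finite_PiE_dflt) auto
  have neM: "maps n \<noteq> {}" using n by auto
  have vec: "n * card {E \<in> labeled_trees n. VT E = v} = card {u \<in> maps n. VM u = v}" for v
  proof (cases "v \<in> extensional {1<..n}")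
    case True
    then have "restrict h {1<..n} = v \<longleftrightarrow> (\<forall>r\<in>{1<..n}. h r = v r)" for h
      by (auto simp: fun_eq_iff restrict_def extensional_def)
    then show ?thesis unfolding VT_def VM_def using card_level_vectors[OF n, of v] by simp
  next
    case False
    then have "VT E \<noteq> v" "VM u \<noteq> v" for E u by (auto simp: VT_def VM_def)
    then show ?thesis by simp
  qed
  have tot: "n * card (labeled_trees n) = card (maps n)"
    using tree_map_polynomial[OF n, of "\<lambda>_. 1::nat"] by simp
  have neT: "labeled_trees n \<noteq> {}"
    using tot neM finM by (metis card.empty card_0_eq mult_0_right)
  have "map_pmf VT (random_labeled_tree n) = map_pmf VM (random_map n)"
  proof (rule pmf_eqI)
    fix v
    have "pmf (map_pmf VT (random_labeled_tree n)) v = card {E \<in> labeled_trees n. VT E = v} / card (labeled_trees n)"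
      unfolding random_labeled_tree_def pmf_map using finT neT
      by (simp add: measure_pmf_of_set vimage_def Int_def conj_commute)
    also have "\<dots> = (n * card {E \<in> labeled_trees n. VT E = v}) / (n * card (labeled_trees n))"
      using n by simp
    also have "\<dots> = card {u \<in> maps n. VM u = v} / card (maps n)"
      unfolding vec[symmetric] tot[symmetric] by simp
    also have "\<dots> = pmf (map_pmf VM (random_map n)) v"
      unfolding random_map_eq[OF n] pmf_map using finM neM
      by (simp add: measure_pmf_of_set vimage_def Int_def conj_commute)
    finally show "pmf (map_pmf VT (random_labeled_tree n)) v = pmf (map_pmf VM (random_map n)) v" .
  qed
  then have "map_pmf (\<lambda>v. \<lambda>j\<in>{..n}. \<Sum>r\<in>{1<..j}. v r) (map_pmf VT (random_labeled_tree n)) =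
    map_pmf (\<lambda>v. \<lambda>j\<in>{..n}. \<Sum>r\<in>{1<..j}. v r) (map_pmf VM (random_map n))" by simp
  moreover have "(\<lambda>j\<in>{..n}. \<Sum>r\<in>{1<..j}. VT E r) = (\<lambda>j\<in>{..n}. induced_edges j E)"
    if "E \<in> set_pmf (random_labeled_tree n)" for E
  proof -
    have "E \<in> labeled_trees n" using that finT neT by (simp add: random_labeled_tree_def)
    then show ?thesis by (auto simp: VT_def induced_edges_eq_sum intro!: restrict_ext sum.cong)
  qed
  moreover have "(\<lambda>j\<in>{..n}. \<Sum>r\<in>{1<..j}. VM u r) = (\<lambda>j\<in>{..n}. card {r \<in> {1<..j}. u r \<le> j})" for u
  proof (rule restrict_ext)
    fix j assume "j \<in> {..n}"
    then have "j \<le> n" by simp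
    then show "(\<Sum>r\<in>{1<..j}. VM u r) = card {r \<in> {1<..j}. u r \<le> j}"
      unfolding card_maps_below[OF \<open>j \<le> n\<close>] by (intro sum.cong) (auto simp: VM_def)
  qed
  ultimately show ?thesis by (simp add: map_pmf_comp cong: map_pmf_cong)
qed

section \<open>A continuity theorem for characteristic functions of vectors\<close>

text \<open>Trigonometric polynomials in \<open>d\<close> variables, with arbitrary frequencies. The phase \<open>\<phi>\<close> covers
  sines. Products stay in the class, because a product of two cosines is a sum of two cosines.\<close>

inductive trig_sum :: "nat \<Rightarrow> ((nat \<Rightarrow> real) \<Rightarrow> real) \<Rightarrow> bool" for d where
  wave: "trig_sum d (\<lambda>v. a * cos ((\<Sum>k<d. \<theta> k * v k) + \<phi>))"
| plus: "trig_sum d f \<Longrightarrow> trig_sum d g \<Longrightarrow> trig_sum d (\<lambda>v. f v + g v)"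

lemma trig_sum_mult:
  assumes "trig_sum d f" "trig_sum d g"
  shows "trig_sum d (\<lambda>v. f v * g v)"
  using assms(1)
proof induction
  case (wave a \<theta> \<phi>)
  show ?case using assms(2)
  proof induction
    case (wave b \<psi> \<rho>)
    have "trig_sum d (\<lambda>v. (a * b / 2) * cos ((\<Sum>k<d. (\<theta> k - \<psi> k) * v k) + (\<phi> - \<rho>)) +
        (a * b / 2) * cos ((\<Sum>k<d. (\<theta> k + \<psi> k) * v k) + (\<phi> + \<rho>)))"
      by (intro trig_sum.intros)
    moreover have "(a * b / 2) * cos ((\<Sum>k<d. (\<theta> k - \<psi> k) * v k) + (\<phi> - \<rho>)) +
        (a * b / 2) * cos ((\<Sum>k<d. (\<theta> k + \<psi> k) * v k) + (\<phi> + \<rho>)) =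
      a * cos ((\<Sum>k<d. \<theta> k * v k) + \<phi>) * (b * cos ((\<Sum>k<d. \<psi> k * v k) + \<rho>))" for v :: "nat \<Rightarrow> real"
    proof -
      define x where "x = (\<Sum>k<d. \<theta> k * v k) + \<phi>"
      define y where "y = (\<Sum>k<d. \<psi> k * v k) + \<rho>"
      have xy: "(\<Sum>k<d. (\<theta> k - \<psi> k) * v k) + (\<phi> - \<rho>) = x - y"
        "(\<Sum>k<d. (\<theta> k + \<psi> k) * v k) + (\<phi> + \<rho>) = x + y"
        by (simp_all add: x_def y_def algebra_simps sum.distrib sum_subtractf)
      show ?thesis unfolding xy x_def[symmetric] y_def[symmetric]
        by (simp add: cos_add cos_diff algebra_simps)
    qed
    ultimately show ?case by simp
  next
    case (plus f g)
    then show ?case by (simp add: distrib_left trig_sum.plus)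
  qed
next
  case (plus f h)
  then show ?case by (simp add: distrib_right trig_sum.plus)
qed

lemma trig_sum_const: "trig_sum d (\<lambda>_. a)"
  using trig_sum.wave[of d a "\<lambda>_. 0" 0] by simp

lemma trig_sum_sin: "k < d \<Longrightarrow> trig_sum d (\<lambda>v. sin (c * v k))"
  using trig_sum.wave[of d 1 "\<lambda>i. if i = k then c else 0" "-(pi/2)"]
  by (simp add: if_distrib[of "\<lambda>x. x * _"] sum.delta cos_diff cong: if_cong)

lemma trig_sum_integral:
  assumes "prob_space M" "\<And>k. (\<lambda>\<omega>. V \<omega> k) \<in> borel_measurable M" "trig_sum d h"
  shows "integrable M (\<lambda>\<omega>. h (V \<omega>))"
  using assms(3)
proof induction
  case (wave a \<theta> \<phi>)
  interpret prob_space M by fact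
  note [measurable] = assms(2)
  show ?case
    by (rule integrable_const_bound[where B="\<bar>a\<bar>"]) (auto simp: abs_mult mult_left_le)
qed auto

lemma trig_sum_converges:
  fixes V :: "nat \<Rightarrow> 'a \<Rightarrow> nat \<Rightarrow> real" and X :: "'b \<Rightarrow> nat \<Rightarrow> real"
  assumes N: "\<And>n. prob_space (N n)" and M: "prob_space M"
    and V: "\<And>n k. (\<lambda>\<omega>. V n \<omega> k) \<in> borel_measurable (N n)"
    and X: "\<And>k. (\<lambda>\<omega>. X \<omega> k) \<in> borel_measurable M"
    and conv: "\<And>\<theta>. (\<lambda>n. \<integral>\<omega>. iexp (\<Sum>k<d. \<theta> k * V n \<omega> k) \<partial>N n)
       \<longlonglongrightarrow> (\<integral>\<omega>. iexp (\<Sum>k<d. \<theta> k * X \<omega> k) \<partial>M)"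
    and h: "trig_sum d h"
  shows "(\<lambda>n. \<integral>\<omega>. h (V n \<omega>) \<partial>N n) \<longlonglongrightarrow> (\<integral>\<omega>. h (X \<omega>) \<partial>M)"
  using h
proof induction
  case (wave a \<theta> \<phi>)
  have eq: "(\<integral>\<omega>. a * cos ((\<Sum>k<d. \<theta> k * v \<omega> k) + \<phi>) \<partial>P) =
      a * Re (iexp \<phi> * (\<integral>\<omega>. iexp (\<Sum>k<d. \<theta> k * v \<omega> k) \<partial>P))"
    if P: "prob_space P" and v: "\<And>k. (\<lambda>\<omega>. v \<omega> k) \<in> borel_measurable P" for P :: "'c measure" and v
  proof -
    interpret P: prob_space P by fact
    note [measurable] = v
    have int: "integrable P (\<lambda>\<omega>. iexp (\<phi> + (\<Sum>k<d. \<theta> k * v \<omega> k)))"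
      by (rule P.integrable_const_bound[where B=1]) auto
    have "iexp \<phi> * (\<integral>\<omega>. iexp (\<Sum>k<d. \<theta> k * v \<omega> k) \<partial>P) = (\<integral>\<omega>. iexp (\<phi> + (\<Sum>k<d. \<theta> k * v \<omega> k)) \<partial>P)"
      by (simp add: exp_add distrib_left)
    also have "Re \<dots> = (\<integral>\<omega>. cos ((\<Sum>k<d. \<theta> k * v \<omega> k) + \<phi>) \<partial>P)"
      using int by (simp add: integral_Re[symmetric] Re_exp add.commute)
    finally show ?thesis by simp
  qed
  show ?case
    unfolding eq[OF N V] eq[OF M X] by (intro tendsto_intros conv)
next
  case (plus f g)
  then show ?case
    using trig_sum_integral[OF N V plus.hyps(1)] trig_sum_integral[OF N V plus.hyps(2)]
      trig_sum_integral[OF M X plus.hyps(1)] trig_sum_integral[OF M X plus.hyps(2)]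
    by (simp add: tendsto_add)
qed

text \<open>For small \<open>c\<close> the point \<open>v\<close> can be recovered from \<open>s\<^sub>k = sin (c v\<^sub>k)\<close> on the cube
  \<open>\<bar>c v\<^sub>k\<bar> \<le> \<pi>/2\<close>. By the Stone-Weierstrass theorem the function \<open>G (arcsin s\<^sub>k / c)\<close> is uniformly
  close to a polynomial in the \<open>s\<^sub>k\<close>, which is a trigonometric sum in \<open>v\<close> and therefore has convergent
  expectations. Unlike a polynomial in \<open>v\<close>, this approximation is bounded on the whole space. Off the
  cube the error is thus bounded by a constant, hence by a constant times \<open>c\<close> times the sum of the
  \<open>\<bar>v\<^sub>k\<bar>\<close>, and the bound on the first moments makes this small with \<open>c\<close>.\<close>

theorem levy_continuity_vector:
  fixes V :: "nat \<Rightarrow> 'a \<Rightarrow> nat \<Rightarrow> real" and X :: "'b \<Rightarrow> nat \<Rightarrow> real"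
    and G :: "(nat \<Rightarrow> real) \<Rightarrow> real"
  assumes N: "\<And>n. prob_space (N n)" and M: "prob_space M"
    and V: "\<And>n k. (\<lambda>\<omega>. V n \<omega> k) \<in> borel_measurable (N n)"
    and X: "\<And>k. (\<lambda>\<omega>. X \<omega> k) \<in> borel_measurable M"
    and conv: "\<And>\<theta>. (\<lambda>n. \<integral>\<omega>. iexp (\<Sum>k<d. \<theta> k * V n \<omega> k) \<partial>N n)
       \<longlonglongrightarrow> (\<integral>\<omega>. iexp (\<Sum>k<d. \<theta> k * X \<omega> k) \<partial>M)"
    and V1: "\<And>n k. k < d \<Longrightarrow> integrable (N n) (\<lambda>\<omega>. V n \<omega> k)"
    and VD: "\<And>n k. k < d \<Longrightarrow> (\<integral>\<omega>. \<bar>V n \<omega> k\<bar> \<partial>N n) \<le> D"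
    and X1: "\<And>k. k < d \<Longrightarrow> integrable M (\<lambda>\<omega>. X \<omega> k)"
    and XD: "\<And>k. k < d \<Longrightarrow> (\<integral>\<omega>. \<bar>X \<omega> k\<bar> \<partial>M) \<le> D"
    and G: "continuous_on UNIV G" and B: "\<And>v. \<bar>G v\<bar> \<le> B"
    and dep: "\<And>v. G (\<lambda>k. if k < d then v k else 0) = G v"
  shows "(\<lambda>n. \<integral>\<omega>. G (V n \<omega>) \<partial>N n) \<longlonglongrightarrow> (\<integral>\<omega>. G (X \<omega>) \<partial>M)"
proof (rule LIMSEQ_I)
  fix r :: real assume "0 < r"
  define e where "e = r / 5"
  have e: "0 < e" using \<open>0 < r\<close> by (simp add: e_def)
  have B0: "0 \<le> B" using B[of "\<lambda>_. 0"] by linarith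
  define D' where "D' = \<bar>D\<bar>"
  \<comment> \<open>This choice makes the expected error off the cube at most \<open>e\<close>.\<close>
  define c where "c = e / (1 + 2 * B * (real d * D'))"
  have pos: "0 < 1 + 2 * B * (real d * D')" using B0 by (intro add_pos_nonneg) (auto simp: D'_def)
  then have c: "0 < c" using e by (simp add: c_def)
  have cB: "2 * B * (c * (real d * D')) \<le> e"
    using e pos B0 by (simp add: c_def field_simps D'_def)
  define S :: "(nat \<Rightarrow> real) set" where "S = PiE UNIV (\<lambda>k. if k < d then {-1..1} else {0})"
  define sv where "sv v = (\<lambda>k. if k < d then sin (c * v k) else 0)" for v :: "nat \<Rightarrow> real"
  define R where "R = {f. continuous_on S f \<and> trig_sum d (\<lambda>v. f (sv v))}"
  have "compactin (product_topology (\<lambda>_. euclidean) UNIV) S"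
    unfolding S_def compactin_PiE by auto
  then have compact: "compact S" by (simp add: euclidean_product_topology)
  have sv_S: "sv v \<in> S" for v by (auto simp: S_def sv_def)
  interpret function_ring_on R S
  proof
    fix x y assume xy: "x \<in> S" "y \<in> S" "x \<noteq> y"
    then obtain k where k: "x k \<noteq> y k" by blast
    then have "k < d" using xy by (auto simp: S_def PiE_iff split: if_splits) (metis singletonD)
    moreover have "continuous_on S (\<lambda>x. x k)"
      by (rule continuous_on_subset[OF continuous_on_product_coordinates]) simp
    ultimately have "(\<lambda>x. x k) \<in> R" using trig_sum_sin[of k d c] by (simp add: R_def sv_def)
    then show "\<exists>f\<in>R. f x \<noteq> f y" using k by (intro bexI[of _ "\<lambda>x. x k"])
  next
    fix f g assume fg: "f \<in> R" "g \<in> R"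
    then show "(\<lambda>x. f x + g x) \<in> R"
      unfolding R_def by (auto intro: continuous_on_add trig_sum.plus)
    show "(\<lambda>x. f x * g x) \<in> R"
      using fg unfolding R_def by (auto intro: continuous_on_mult trig_sum_mult)
  qed (auto simp: R_def compact trig_sum_const)
  define g where "g s = G (\<lambda>k. if k < d then arcsin (s k) / c else 0)" for s
  have "continuous_on S (\<lambda>s. \<lambda>k. if k < d then arcsin (s k) / c else 0)"
  proof (rule continuous_on_coordinatewise_then_product)
    fix k
    have "continuous_on S (\<lambda>x. x k)"
      by (rule continuous_on_subset[OF continuous_on_product_coordinates]) simp
    then show "continuous_on S (\<lambda>s. if k < d then arcsin (s k) / c else 0)"
      using c by (cases "k < d") (auto intro!: continuous_intros simp: S_def PiE_iff split: if_splits)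
  qed
  then have "continuous_on S g"
    unfolding g_def by (intro continuous_on_compose2[OF G]) auto
  from Stone_Weierstrass_basic[OF this e] obtain f where f: "f \<in> R" "\<And>s. s \<in> S \<Longrightarrow> \<bar>g s - f s\<bar> < e"
    by blast
  define q where "q v = f (sv v)" for v
  have q: "trig_sum d q" using f by (simp add: R_def q_def[abs_def])
  have close: "\<bar>G v - q v\<bar> \<le> e + 2 * B * (c * (\<Sum>k<d. \<bar>v k\<bar>))" for v
  proof -
    have gq: "\<bar>g (sv v) - q v\<bar> < e" unfolding q_def by (rule f(2)[OF sv_S])
    show ?thesis
    proof (cases "\<forall>k<d. \<bar>c * v k\<bar> \<le> pi / 2")
      case True
      then have "arcsin (sin (c * v k)) = c * v k" if "k < d" for k
        using that by (intro arcsin_sin) (auto simp: abs_le_iff)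
      then have "(\<lambda>k. if k < d then arcsin (sv v k) / c else 0) = (\<lambda>k. if k < d then v k else 0)"
        using c by (auto simp: sv_def)
      then have "g (sv v) = G v" unfolding g_def using dep by simp
      moreover have "0 \<le> 2 * B * (c * (\<Sum>k<d. \<bar>v k\<bar>))" using B0 c by (intro mult_nonneg_nonneg sum_nonneg) auto
      ultimately show ?thesis using gq by linarith
    next
      case False
      then obtain k where k: "k < d" "\<bar>c * v k\<bar> > pi / 2" by auto
      have "1 \<le> c * \<bar>v k\<bar>" using k(2) c pi_gt3 by (simp add: abs_mult)
      also have "\<dots> \<le> c * (\<Sum>k<d. \<bar>v k\<bar>)" using k(1) c by (intro mult_left_mono member_le_sum) auto
      finally have "2 * B * 1 \<le> 2 * B * (c * (\<Sum>k<d. \<bar>v k\<bar>))" using B0 by (intro mult_left_mono) auto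
      moreover have "\<bar>G v\<bar> \<le> B" "\<bar>g (sv v)\<bar> \<le> B" unfolding g_def by (rule B)+
      ultimately show ?thesis using gq by linarith
    qed
  qed
  have close_int: "\<bar>(\<integral>\<omega>. G (v \<omega>) \<partial>P) - (\<integral>\<omega>. q (v \<omega>) \<partial>P)\<bar> \<le> 2 * e"
    if P: "prob_space P" and v: "\<And>k. (\<lambda>\<omega>. v \<omega> k) \<in> borel_measurable P"
      and v1: "\<And>k. k < d \<Longrightarrow> integrable P (\<lambda>\<omega>. v \<omega> k)"
      and vD: "\<And>k. k < d \<Longrightarrow> (\<integral>\<omega>. \<bar>v \<omega> k\<bar> \<partial>P) \<le> D" for P :: "'c measure" and v
  proof -
    interpret P: prob_space P by fact
    have "v \<in> borel_measurable P" by (rule measurable_coordinatewise_then_product[OF v])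
    moreover have "G \<in> borel_measurable borel" by (rule borel_measurable_continuous_onI[OF G])
    ultimately have "(\<lambda>\<omega>. G (v \<omega>)) \<in> borel_measurable P" by (rule measurable_compose)
    then have iG: "integrable P (\<lambda>\<omega>. G (v \<omega>))"
      using B by (intro P.integrable_const_bound[where B=B]) auto
    have iq: "integrable P (\<lambda>\<omega>. q (v \<omega>))" by (rule trig_sum_integral[OF P v q])
    have "\<bar>(\<integral>\<omega>. G (v \<omega>) \<partial>P) - (\<integral>\<omega>. q (v \<omega>) \<partial>P)\<bar> = \<bar>\<integral>\<omega>. G (v \<omega>) - q (v \<omega>) \<partial>P\<bar>"
      using iG iq by simp
    also have "\<dots> \<le> (\<integral>\<omega>. \<bar>G (v \<omega>) - q (v \<omega>)\<bar> \<partial>P)" by (rule integral_abs_bound)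
    also have "\<dots> \<le> (\<integral>\<omega>. e + 2 * B * (c * (\<Sum>k<d. \<bar>v \<omega> k\<bar>)) \<partial>P)"
      using iG iq
      by (intro integral_mono close Bochner_Integration.integrable_add P.integrable_const integrable_mult_right
          Bochner_Integration.integrable_sum integrable_abs v1) auto
    also have "\<dots> = (\<integral>\<omega>. e \<partial>P) + (\<integral>\<omega>. 2 * B * (c * (\<Sum>k<d. \<bar>v \<omega> k\<bar>)) \<partial>P)"
      by (intro Bochner_Integration.integral_add P.integrable_const integrable_mult_right
          Bochner_Integration.integrable_sum integrable_abs v1) auto
    also have "\<dots> = e + 2 * B * (c * (\<integral>\<omega>. (\<Sum>k<d. \<bar>v \<omega> k\<bar>) \<partial>P))"
      by (simp add: P.prob_space)
    also have "(\<integral>\<omega>. (\<Sum>k<d. \<bar>v \<omega> k\<bar>) \<partial>P) = (\<Sum>k<d. \<integral>\<omega>. \<bar>v \<omega> k\<bar> \<partial>P)"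
      by (rule Bochner_Integration.integral_sum) (use v1 in auto)
    also have "(\<Sum>k<d. \<integral>\<omega>. \<bar>v \<omega> k\<bar> \<partial>P) \<le> (\<Sum>k<d. D')" 
      unfolding D'_def by (intro sum_mono order_trans[OF vD abs_ge_self]) auto
    then have "e + 2 * B * (c * (\<Sum>k<d. \<integral>\<omega>. \<bar>v \<omega> k\<bar> \<partial>P)) \<le> e + 2 * B * (c * (real d * D'))"
      using B0 c by (intro add_left_mono mult_left_mono) auto
    finally show ?thesis using cB by linarith
  qed
  have "(\<lambda>n. \<integral>\<omega>. q (V n \<omega>) \<partial>N n) \<longlonglongrightarrow> (\<integral>\<omega>. q (X \<omega>) \<partial>M)"
    by (rule trig_sum_converges[OF N M V X conv q])
  from LIMSEQ_D[OF this e] obtain n0 where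
    n0: "\<And>n. n \<ge> n0 \<Longrightarrow> \<bar>(\<integral>\<omega>. q (V n \<omega>) \<partial>N n) - (\<integral>\<omega>. q (X \<omega>) \<partial>M)\<bar> < e" by auto
  show "\<exists>n0. \<forall>n\<ge>n0. norm ((\<integral>\<omega>. G (V n \<omega>) \<partial>N n) - (\<integral>\<omega>. G (X \<omega>) \<partial>M)) < r"
  proof (intro exI[of _ n0] allI impI)
    fix n assume "n \<ge> n0"
    show "norm ((\<integral>\<omega>. G (V n \<omega>) \<partial>N n) - (\<integral>\<omega>. G (X \<omega>) \<partial>M)) < r"
      using n0[OF \<open>n \<ge> n0\<close>] close_int[of "N n" "V n", OF N V V1 VD] close_int[of M X, OF M X X1 XD]
      unfolding real_norm_def e_def by linarith
  qed
qed

section \<open>Lipschitz functions determine weak convergence\<close>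

text \<open>A bounded continuous \<open>F\<close> is the pointwise limit from below of the Lipschitz functions
  \<open>G k x = (INF y. F y + k * dist x y)\<close>.\<close>

lemma weak_liminf_of_lipschitz:
  fixes X :: "nat \<Rightarrow> 'a \<Rightarrow> 'c::metric_space" and Y :: "'b \<Rightarrow> 'c"
  assumes N: "\<And>n. prob_space (N n)" and M: "prob_space M"
    and X: "\<And>n. X n \<in> borel_measurable (N n)" and Y: "Y \<in> borel_measurable M"
    and lip: "\<And>G L B. (\<And>x y. \<bar>G x - G y\<bar> \<le> L * dist x y) \<Longrightarrow> (\<And>x. \<bar>G x\<bar> \<le> B) \<Longrightarrow>
       (\<lambda>n. \<integral>\<omega>. G (X n \<omega>) \<partial>N n) \<longlonglongrightarrow> (\<integral>\<omega>. G (Y \<omega>) \<partial>M)"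
    and F: "continuous_on UNIV F" and B: "\<And>x. \<bar>F x\<bar> \<le> B" and "0 < (e::real)"
  shows "\<forall>\<^sub>F n in sequentially. (\<integral>\<omega>. F (Y \<omega>) \<partial>M) - e < (\<integral>\<omega>. F (X n \<omega>) \<partial>N n)"
proof -
  define G where "G k x = (INF y. F y + real k * dist x y)" for k x
  have lower: "- B \<le> F y + real k * dist x y" for x y k
  proof -
    have "- B \<le> F y" using B[of y] by linarith
    moreover have "0 \<le> real k * dist x y" by simp
    ultimately show ?thesis by linarith
  qed
  then have bdd: "bdd_below (range (\<lambda>y. F y + real k * dist x y))" for k x
    by (intro bdd_belowI[of _ "-B"]) auto
  have GF: "G k x \<le> F x" for k x
    unfolding G_def by (rule cINF_lower2[OF bdd, of x]) auto
  have GB: "- B \<le> G k x" for k x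
    unfolding G_def by (rule cINF_greatest) (auto simp: lower)
  have G_abs: "\<bar>G k x\<bar> \<le> B" for k x using GF[of k x] GB[of k x] B[of x] by linarith
  have G_step: "G k x \<le> G k y + real k * dist x y" for k x y
  proof -
    have "G k x - real k * dist x y \<le> F z + real k * dist y z" for z
    proof -
      have "G k x \<le> F z + real k * dist x z" unfolding G_def by (rule cINF_lower[OF bdd]) simp
      also have "real k * dist x z \<le> real k * (dist x y + dist y z)"
        by (intro mult_left_mono dist_triangle) simp
      finally show ?thesis by (simp add: algebra_simps)
    qed
    then have "G k x - real k * dist x y \<le> G k y" unfolding G_def[of k y] by (intro cINF_greatest) auto
    then show ?thesis by linarith
  qed
  have G_lip: "\<bar>G k x - G k y\<bar> \<le> real k * dist x y" for k x y
    using G_step[of k x y] G_step[of k y x] by (simp add: dist_commute abs_le_iff)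
  have G_lim: "(\<lambda>k. G k x) \<longlonglongrightarrow> F x" for x
  proof (rule LIMSEQ_I)
    fix r :: real assume r: "0 < r"
    obtain d where d: "d > 0" "\<And>y. dist y x < d \<Longrightarrow> dist (F y) (F x) < r / 2"
      using F r unfolding continuous_on_iff by (metis UNIV_I half_gt_zero)
    obtain k0 :: nat where k0: "2 * B / d < real k0" using reals_Archimedean2 by blast
    have "norm (G k x - F x) < r" if "k \<ge> k0" for k
    proof -
      have "F x - r / 2 \<le> F y + real k * dist x y" for y
      proof (cases "dist y x < d")
        case True
        moreover have "0 \<le> real k * dist x y" by simp
        moreover have "\<bar>F y - F x\<bar> < r / 2" using d(2)[OF True] by (simp add: dist_real_def)
        ultimately show ?thesis by linarith
      next
        case False
        have "2 * B < real k0 * d" using k0 d by (simp add: field_simps)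
        also have "\<dots> \<le> real k * dist x y" using that False d by (intro mult_mono) (auto simp: dist_commute)
        finally show ?thesis using B[of x] B[of y] r by linarith
      qed
      then have "F x - r / 2 \<le> G k x" unfolding G_def by (intro cINF_greatest) auto
      then show ?thesis using GF[of k x] r by simp
    qed
    then show "\<exists>k0. \<forall>k\<ge>k0. norm (G k x - F x) < r" by blast
  qed
  have meas: "G k \<in> borel_measurable borel" for k
  proof (rule borel_measurable_continuous_onI)
    have "continuous_on UNIV (G k)"
    proof (rule continuous_on_iff[THEN iffD2], intro ballI allI impI)
      fix x and r :: real assume r: "0 < r"
      have "dist (G k y) (G k x) < r" if "dist y x < r / (real k + 1)" for y
      proof -
        have "dist (G k y) (G k x) \<le> real k * dist y x" using G_lip[of k y x] by (simp add: dist_real_def)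
        also have "\<dots> \<le> (real k + 1) * dist y x" by (intro mult_right_mono) auto
        also have "\<dots> < r" using that by (simp add: field_simps)
        finally show ?thesis .
      qed
      then show "\<exists>d>0. \<forall>y\<in>UNIV. dist y x < d \<longrightarrow> dist (G k y) (G k x) < r"
        using r by (intro exI[of _ "r / (real k + 1)"]) auto
    qed
    then show "continuous_on UNIV (G k)" .
  qed
  have measF: "F \<in> borel_measurable borel" by (rule borel_measurable_continuous_onI[OF F])
  interpret M: prob_space M by fact
  note [measurable] = X Y meas measF
  have "(\<lambda>k. \<integral>\<omega>. G k (Y \<omega>) \<partial>M) \<longlonglongrightarrow> (\<integral>\<omega>. F (Y \<omega>) \<partial>M)"
    by (rule integral_dominated_convergence[where w="\<lambda>_. B"]) (auto simp: G_lim G_abs)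
  from order_tendstoD(1)[OF this, of "(\<integral>\<omega>. F (Y \<omega>) \<partial>M) - e"] \<open>0 < e\<close>
  obtain k where k: "(\<integral>\<omega>. F (Y \<omega>) \<partial>M) - e < (\<integral>\<omega>. G k (Y \<omega>) \<partial>M)"
    by (auto simp: eventually_sequentially)
  have "\<forall>\<^sub>F n in sequentially. (\<integral>\<omega>. F (Y \<omega>) \<partial>M) - e < (\<integral>\<omega>. G k (X n \<omega>) \<partial>N n)"
    by (rule order_tendstoD(1)[OF lip[OF G_lip G_abs] k])
  moreover have "(\<integral>\<omega>. G k (X n \<omega>) \<partial>N n) \<le> (\<integral>\<omega>. F (X n \<omega>) \<partial>N n)" for n
  proof -
    interpret Nn: prob_space "N n" by (rule N)
    show ?thesis
    proof (rule integral_mono)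
      show "integrable (N n) (\<lambda>\<omega>. G k (X n \<omega>))"
        by (rule Nn.integrable_const_bound[where B=B]) (auto simp: G_abs)
      show "integrable (N n) (\<lambda>\<omega>. F (X n \<omega>))"
        by (rule Nn.integrable_const_bound[where B=B]) (auto simp: B)
    qed (rule GF)
  qed
  ultimately show ?thesis by (auto elim!: eventually_mono intro: less_le_trans)
qed

theorem weak_convergence_of_lipschitz:
  fixes X :: "nat \<Rightarrow> 'a \<Rightarrow> 'c::metric_space" and Y :: "'b \<Rightarrow> 'c"
  assumes N: "\<And>n. prob_space (N n)" and M: "prob_space M"
    and X: "\<And>n. X n \<in> borel_measurable (N n)" and Y: "Y \<in> borel_measurable M"
    and lip: "\<And>G L B. (\<And>x y. \<bar>G x - G y\<bar> \<le> L * dist x y) \<Longrightarrow> (\<And>x. \<bar>G x\<bar> \<le> B) \<Longrightarrow>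
       (\<lambda>n. \<integral>\<omega>. G (X n \<omega>) \<partial>N n) \<longlonglongrightarrow> (\<integral>\<omega>. G (Y \<omega>) \<partial>M)"
    and F: "continuous_on UNIV F" and B: "\<And>x. \<bar>F x\<bar> \<le> (B::real)"
  shows "(\<lambda>n. \<integral>\<omega>. F (X n \<omega>) \<partial>N n) \<longlonglongrightarrow> (\<integral>\<omega>. F (Y \<omega>) \<partial>M)"
proof (rule order_tendstoI)
  fix a assume a: "a < (\<integral>\<omega>. F (Y \<omega>) \<partial>M)"
  have "\<forall>\<^sub>F n in sequentially.
      (\<integral>\<omega>. F (Y \<omega>) \<partial>M) - ((\<integral>\<omega>. F (Y \<omega>) \<partial>M) - a) < (\<integral>\<omega>. F (X n \<omega>) \<partial>N n)"
    by (rule weak_liminf_of_lipschitz[OF N M X Y _ F B]) (rule lip, assumption+, use a in simp)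
  then show "\<forall>\<^sub>F n in sequentially. a < (\<integral>\<omega>. F (X n \<omega>) \<partial>N n)" by simp
next
  fix a assume a: "(\<integral>\<omega>. F (Y \<omega>) \<partial>M) < a"
  have F': "continuous_on UNIV (\<lambda>x. - F x)" using F by (rule continuous_on_minus)
  have B': "\<bar>- F x\<bar> \<le> B" for x using B[of x] by simp
  have "\<forall>\<^sub>F n in sequentially.
      (\<integral>\<omega>. - F (Y \<omega>) \<partial>M) - (a - (\<integral>\<omega>. F (Y \<omega>) \<partial>M)) < (\<integral>\<omega>. - F (X n \<omega>) \<partial>N n)"
    by (rule weak_liminf_of_lipschitz[OF N M X Y _ F' B']) (rule lip, assumption+, use a in simp)
  then show "\<forall>\<^sub>F n in sequentially. (\<integral>\<omega>. F (X n \<omega>) \<partial>N n) < a" by simp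
qed

section \<open>Polygonal paths\<close>

abbreviation clamp01 :: "real \<Rightarrow> real" where
  "clamp01 t \<equiv> max 0 (min 1 t)"

text \<open>The clamping extends paths on \<open>[0,1]\<close> to constants on both sides, so that the uniform distance of
  paths is the distance in the type of bounded continuous functions on the real line.\<close>

definition hat :: "nat \<Rightarrow> nat \<Rightarrow> real \<Rightarrow>\<^sub>C real" where
  "hat N k = Bcontfun (\<lambda>t. max 0 (1 - \<bar>real N * clamp01 t - real k\<bar>))"

lemma hat_apply: "apply_bcontfun (hat N k) t = max 0 (1 - \<bar>real N * clamp01 t - real k\<bar>)"
proof -
  have "(\<lambda>t. max 0 (1 - \<bar>real N * clamp01 t - real k\<bar>)) \<in> bcontfun"
    by (rule bcontfun_normI[where b=1]) (auto intro!: continuous_intros)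
  then show ?thesis by (simp add: hat_def Bcontfun_inverse)
qed

definition polygon :: "nat \<Rightarrow> (nat \<Rightarrow> real) \<Rightarrow> real \<Rightarrow>\<^sub>C real" where
  "polygon N x = (\<Sum>k\<le>N. x k *\<^sub>R hat N k)"

lemma polygon_apply:
  "apply_bcontfun (polygon N x) t = (\<Sum>k\<le>N. x k * max 0 (1 - \<bar>real N * clamp01 t - real k\<bar>))"
proof -
  have "apply_bcontfun (sum f A) t = (\<Sum>k\<in>A. apply_bcontfun (f k) t)"
    if "finite A" for f :: "nat \<Rightarrow> real \<Rightarrow>\<^sub>C real" and A
    using that by induction auto
  then show ?thesis by (simp add: polygon_def hat_apply)
qed

lemma polygon_clamp: "apply_bcontfun (polygon N x) (clamp01 t) = apply_bcontfun (polygon N x) t"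
  by (simp add: polygon_apply)

lemma continuous_polygon: "continuous_on UNIV (polygon N)"
  unfolding polygon_def by (intro continuous_intros continuous_on_product_coordinates)

lemma polygon_segment:
  assumes "j < N" "0 \<le> f" "f \<le> 1" "t = (real j + f) / real N"
  shows "apply_bcontfun (polygon N x) t = (1 - f) * x j + f * x (Suc j)"
proof -
  have "real j + f \<le> real N" using assms by linarith
  then have "0 \<le> t" "t \<le> 1" unfolding assms(4) using assms(1,2) by (simp_all add: divide_le_eq)
  then have "clamp01 t = t" by simp
  moreover have "real N * t = real j + f" using assms by simp
  ultimately have c: "real N * clamp01 t = real j + f" by (rule ssubst)
  have "apply_bcontfun (polygon N x) t = (\<Sum>k\<le>N. x k * max 0 (1 - \<bar>real j + f - real k\<bar>))"
    unfolding polygon_apply c ..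
  also have "\<dots> = (\<Sum>k\<in>{j, Suc j}. x k * max 0 (1 - \<bar>real j + f - real k\<bar>))"
  proof (rule sum.mono_neutral_right)
    show "\<forall>k\<in>{..N} - {j, Suc j}. x k * max 0 (1 - \<bar>real j + f - real k\<bar>) = 0"
    proof
      fix k assume k: "k \<in> {..N} - {j, Suc j}"
      then consider "Suc k \<le> j" | "j + 2 \<le> k" by force
      then have "1 \<le> \<bar>real j + f - real k\<bar>"
      proof cases
        case 1
        then have "real k + 1 \<le> real j" by linarith
        then show ?thesis using assms by linarith
      next
        case 2
        then have "real j + 2 \<le> real k" by linarith
        then show ?thesis using assms by linarith
      qed
      then show "x k * max 0 (1 - \<bar>real j + f - real k\<bar>) = 0" by simp
    qed
  qed (use assms in auto)
  also have "\<dots> = (1 - f) * x j + f * x (Suc j)" using assms by (simp add: mult.commute)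
  finally show ?thesis .
qed

lemma polygon_vertex: "k \<le> N \<Longrightarrow> 0 < N \<Longrightarrow> apply_bcontfun (polygon N x) (real k / real N) = x k"
  using polygon_segment[of k N 0 _ x] polygon_segment[of "k - 1" N 1 _ x] by (cases "k < N") auto

lemma segment_cases:
  assumes "0 < N" "0 \<le> t" "t \<le> 1"
  obtains j f where "j < N" "0 \<le> f" "f \<le> 1" "t = (real j + f) / real N"
proof (cases "t = 1")
  case True
  then show ?thesis using that[of "N - 1" 1] assms by (simp add: of_nat_diff)
next
  case False
  define j where "j = nat \<lfloor>real N * t\<rfloor>"
  have "real N * t < real N" using False assms by simp
  then have "j < N" unfolding j_def using assms by (simp add: nat_less_iff floor_less_iff)
  moreover have "real j \<le> real N * t" "real N * t \<le> real j + 1"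
    unfolding j_def using assms by simp_all
  ultimately show ?thesis using that[of j "real N * t - real j"] assms by (simp add: field_simps)
qed

section \<open>Chaining\<close>

definition dyadic_floor :: "nat \<Rightarrow> real \<Rightarrow> real" where
  "dyadic_floor k t = real (nat \<lfloor>2 ^ k * t\<rfloor>) / 2 ^ k"

lemma dyadic_floor_bounds:
  assumes "0 \<le> t"
  shows "0 \<le> dyadic_floor k t" "dyadic_floor k t \<le> t" "t < dyadic_floor k t + 1 / 2 ^ k"
proof -
  have "real (nat \<lfloor>2 ^ k * t\<rfloor>) = of_int \<lfloor>2 ^ k * t\<rfloor>" using assms by simp
  moreover have "of_int \<lfloor>2 ^ k * t\<rfloor> \<le> 2 ^ k * t" "2 ^ k * t < of_int \<lfloor>2 ^ k * t\<rfloor> + 1" by linarith+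
  ultimately show "0 \<le> dyadic_floor k t" "dyadic_floor k t \<le> t" "t < dyadic_floor k t + 1 / 2 ^ k"
    using assms by (simp_all add: dyadic_floor_def field_simps)
qed

lemma dyadic_floor_tendsto:
  assumes "0 \<le> t"
  shows "(\<lambda>k. dyadic_floor k t) \<longlonglongrightarrow> t"
proof (rule tendsto_sandwich[of "\<lambda>k. t - (1/2) ^ k" _ _ "\<lambda>_. t"])
  have "t - (1/2) ^ k \<le> dyadic_floor k t" for k
    using dyadic_floor_bounds(3)[OF assms, of k] by (simp add: power_divide)
  then show "\<forall>\<^sub>F k in sequentially. t - (1/2) ^ k \<le> dyadic_floor k t" by simp
  show "\<forall>\<^sub>F k in sequentially. dyadic_floor k t \<le> t" using dyadic_floor_bounds(2)[OF assms] by simp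
  have "(\<lambda>k. t - (1/2) ^ k) \<longlonglongrightarrow> t - 0" by (intro tendsto_intros LIMSEQ_power_zero) auto
  then show "(\<lambda>k. t - (1/2) ^ k) \<longlonglongrightarrow> t" by simp
qed simp

lemma dyadic_floor_Suc:
  assumes "0 \<le> t" "t < 1"
  obtains "dyadic_floor (Suc k) t = dyadic_floor k t"
  | i where "i < 2 ^ Suc k" "dyadic_floor k t = real i / 2 ^ Suc k" "dyadic_floor (Suc k) t = real (Suc i) / 2 ^ Suc k"
proof -
  define i where "i = nat \<lfloor>2 ^ k * t\<rfloor>"
  define j where "j = nat \<lfloor>2 ^ Suc k * t\<rfloor>"
  have i: "real i \<le> 2 ^ k * t" "2 ^ k * t < real i + 1" unfolding i_def using assms by simp_all
  have j: "real j \<le> 2 * (2 ^ k * t)" "2 * (2 ^ k * t) < real j + 1" unfolding j_def using assms by (simp_all add: mult.assoc)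
  have "j = 2 * i \<or> j = Suc (2 * i)" using i j by linarith
  moreover have "dyadic_floor k t = real (2 * i) / 2 ^ Suc k" "dyadic_floor (Suc k) t = real j / 2 ^ Suc k"
    by (simp_all add: dyadic_floor_def i_def j_def)
  moreover have "2 * i < 2 ^ Suc k"
  proof -
    have "2 ^ k * t < 2 ^ k" using assms by simp
    then have "real i < 2 ^ k" using i(1) by linarith
    then show ?thesis by (simp flip: of_nat_less_iff)
  qed
  ultimately show thesis using that by metis
qed

lemma suminf_tail_tendsto_0:
  fixes a :: "nat \<Rightarrow> real"
  assumes "summable a"
  shows "(\<lambda>m. \<Sum>k. a (k + m)) \<longlonglongrightarrow> 0"
proof -
  have "(\<lambda>m. suminf a - (\<Sum>k<m. a k)) \<longlonglongrightarrow> suminf a - suminf a"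
    by (intro tendsto_intros summable_LIMSEQ assms)
  then show ?thesis using suminf_minus_initial_segment[OF assms] by simp
qed

text \<open>The dyadic roundings of \<open>t\<close> tend to \<open>t\<close> from the left, and passing to the next finer rounding moves
  the argument by at most one step of that level. The interval is half-open because the continuity of the
  limit process at \<open>1\<close> is itself derived from this bound.\<close>

lemma chaining:
  fixes x :: "real \<Rightarrow> real"
  assumes cont: "continuous_on {0..<1} x" and a: "summable a"
    and step: "\<And>k i. i < 2 ^ k \<Longrightarrow> \<bar>x (real (Suc i) / 2 ^ k) - x (real i / 2 ^ k)\<bar> \<le> a k"
    and t: "0 \<le> t" "t < 1"
  shows "\<bar>x t - x (dyadic_floor m t)\<bar> \<le> (\<Sum>k. a (k + Suc m))"
proof -
  have a0: "0 \<le> a k" for k using step[of 0 k] by (metis abs_ge_zero order_trans zero_less_numeral zero_less_power)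
  have fl: "\<bar>x (dyadic_floor (Suc k) t) - x (dyadic_floor k t)\<bar> \<le> a (Suc k)" for k
    by (rule dyadic_floor_Suc[OF t, of k]) (use a0 step[of _ "Suc k"] in auto)
  have bound: "\<bar>x (dyadic_floor (m + K) t) - x (dyadic_floor m t)\<bar> \<le> (\<Sum>k. a (k + Suc m))" for K
  proof -
    have "\<bar>x (dyadic_floor (m + K) t) - x (dyadic_floor m t)\<bar> \<le> (\<Sum>k<K. a (k + Suc m))"
    proof (induction K)
      case (Suc K)
      have "\<bar>x (dyadic_floor (m + Suc K) t) - x (dyadic_floor m t)\<bar> \<le>
          \<bar>x (dyadic_floor (Suc (m + K)) t) - x (dyadic_floor (m + K) t)\<bar> + \<bar>x (dyadic_floor (m + K) t) - x (dyadic_floor m t)\<bar>"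
        by simp
      also have "\<dots> \<le> a (Suc (m + K)) + (\<Sum>k<K. a (k + Suc m))" by (intro add_mono fl Suc.IH)
      finally show ?case by (simp add: add.commute)
    qed simp
    also have "\<dots> \<le> (\<Sum>k. a (k + Suc m))"
      using a a0 summable_iff_shift[of a "Suc m"] by (intro sum_le_suminf) auto
    finally show ?thesis .
  qed
  have "(\<lambda>K. dyadic_floor (m + K) t) \<longlonglongrightarrow> t"
    using LIMSEQ_ignore_initial_segment[OF dyadic_floor_tendsto[OF t(1)], of m] by (simp add: add.commute)
  moreover have "dyadic_floor k t \<in> {0..<1}" for k using dyadic_floor_bounds[OF t(1), of k] t(2) by simp
  ultimately have "(\<lambda>K. x (dyadic_floor (m + K) t)) \<longlonglongrightarrow> x t"
    using t by (intro continuous_on_tendsto_compose[OF cont]) auto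
  then have "(\<lambda>K. \<bar>x (dyadic_floor (m + K) t) - x (dyadic_floor m t)\<bar>) \<longlonglongrightarrow> \<bar>x t - x (dyadic_floor m t)\<bar>"
    by (intro tendsto_intros)
  then show ?thesis by (rule LIMSEQ_le_const2) (use bound in auto)
qed

lemma dist_dyadic_polygon:
  fixes x :: "real \<Rightarrow>\<^sub>C real"
  assumes clamp: "\<And>t. apply_bcontfun x (clamp01 t) = apply_bcontfun x t" and a: "summable a"
    and step: "\<And>k i. i < 2 ^ k \<Longrightarrow> \<bar>x (real (Suc i) / 2 ^ k) - x (real i / 2 ^ k)\<bar> \<le> a k"
  shows "dist x (polygon (2 ^ m) (\<lambda>k. x (real k / 2 ^ m))) \<le> (\<Sum>k. a (k + m))"
proof (rule dist_bound)
  fix t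
  let ?p = "polygon (2 ^ m) (\<lambda>k. x (real k / 2 ^ m))"
  have a0: "0 \<le> a k" for k using step[of 0 k] by (metis abs_ge_zero order_trans zero_less_numeral zero_less_power)
  have s: "(\<Sum>k. a (k + m)) = a m + (\<Sum>k. a (k + Suc m))"
    using suminf_split_head[of "\<lambda>k. a (k + m)"] a by (simp add: summable_iff_shift)
  have "\<bar>x s - ?p s\<bar> \<le> (\<Sum>k. a (k + m))" if s01: "0 \<le> s" "s \<le> 1" for s
  proof (cases "s = 1")
    case True
    then have "?p s = x s" using polygon_vertex[of "2 ^ m" "2 ^ m" "\<lambda>k. x (real k / 2 ^ m)"] by simp
    moreover have "0 \<le> (\<Sum>k. a (k + m))" using a0 a by (intro suminf_nonneg) (auto simp: summable_iff_shift)
    ultimately show ?thesis by simp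
  next
    case False
    then have "s < 1" using s01 by simp
    define j where "j = nat \<lfloor>2 ^ m * s\<rfloor>"
    define f where "f = 2 ^ m * s - real j"
    have j: "real j \<le> 2 ^ m * s" "2 ^ m * s < real j + 1" unfolding j_def using s01 by simp_all
    have "2 ^ m * s < 2 ^ m" using \<open>s < 1\<close> by simp
    then have "real j < 2 ^ m" using j(1) by linarith
    then have jN: "j < 2 ^ m" by (simp flip: of_nat_less_iff)
    have ps: "?p s = (1 - f) * x (real j / 2 ^ m) + f * x (real (Suc j) / 2 ^ m)"
      by (rule polygon_segment[OF jN]) (use j in \<open>auto simp: f_def\<close>)
    have "x s - ?p s = (x s - x (real j / 2 ^ m)) - f * (x (real (Suc j) / 2 ^ m) - x (real j / 2 ^ m))"
      unfolding ps by (simp add: algebra_simps)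
    moreover have "\<bar>x s - x (real j / 2 ^ m)\<bar> \<le> (\<Sum>k. a (k + Suc m))"
      using chaining[OF continuous_on_apply_bcontfun a step s01(1) \<open>s < 1\<close>, of m]
      by (simp add: dyadic_floor_def j_def)
    moreover have "\<bar>f * (x (real (Suc j) / 2 ^ m) - x (real j / 2 ^ m))\<bar> \<le> 1 * a m"
      unfolding abs_mult using step[OF jN] j by (intro mult_mono) (auto simp: f_def)
    ultimately show ?thesis unfolding s by linarith
  qed
  from this[of "clamp01 t"] show "dist (x t) (?p t) \<le> (\<Sum>k. a (k + m))"
    unfolding clamp polygon_clamp dist_real_def by simp
qed

text \<open>A bound for all dyadic increments of level \<open>k\<close> whose expectation can be computed from fourth
  moments. If the fourth moments of these \<open>2 ^ k\<close> increments are of order \<open>4 ^ (- k)\<close>, then the second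
  summand has expectation of order \<open>(1 / (2 * q ^ 3)) ^ k\<close> with \<open>q = 9/10\<close>. Any \<open>q < 1\<close> with
  \<open>q ^ 4 \<ge> 1/2\<close> would make this at most of order \<open>q ^ k\<close>.\<close>

definition chain_bound :: "(real \<Rightarrow> real) \<Rightarrow> nat \<Rightarrow> real" where
  "chain_bound x k = (9/10) ^ k +
     (\<Sum>i<2 ^ k. (x (real (Suc i) / 2 ^ k) - x (real i / 2 ^ k)) ^ 4) / ((9/10) ^ k) ^ 3"

lemma chain_bound_nonneg: "0 \<le> chain_bound x k"
  unfolding chain_bound_def by (intro add_nonneg_nonneg divide_nonneg_nonneg sum_nonneg) auto

lemma abs_le_add_fourth_power:
  fixes x l :: real
  assumes l: "0 < l"
  shows "\<bar>x\<bar> \<le> l + x ^ 4 / l ^ 3"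
proof (cases "\<bar>x\<bar> \<le> l")
  case True
  moreover have "0 \<le> x ^ 4 / l ^ 3" using l by simp
  ultimately show ?thesis by linarith
next
  case False
  then have "l ^ 3 \<le> \<bar>x\<bar> ^ 3" using l by (intro power_mono) auto
  then have "\<bar>x\<bar> * l ^ 3 \<le> \<bar>x\<bar> * \<bar>x\<bar> ^ 3" by (intro mult_left_mono) auto
  also have "\<dots> = x ^ 4" by (simp add: power4_eq_xxxx power3_eq_cube flip: abs_mult)
  finally have "\<bar>x\<bar> \<le> x ^ 4 / l ^ 3" using l by (simp add: field_simps)
  then show ?thesis using l by linarith
qed

lemma chain_bound_step:
  assumes "i < 2 ^ k"
  shows "\<bar>x (real (Suc i) / 2 ^ k) - x (real i / 2 ^ k)\<bar> \<le> chain_bound x k"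
proof -
  define d where "d i = x (real (Suc i) / 2 ^ k) - x (real i / 2 ^ k)" for i
  define l :: real where "l = (9/10) ^ k"
  have l: "0 < l" by (simp add: l_def)
  have "\<bar>d i\<bar> \<le> l + d i ^ 4 / l ^ 3" by (rule abs_le_add_fourth_power[OF l])
  also have "d i ^ 4 \<le> (\<Sum>i<2 ^ k. d i ^ 4)"
    using assms by (intro member_le_sum) auto
  then have "l + d i ^ 4 / l ^ 3 \<le> chain_bound x k"
    unfolding chain_bound_def d_def l_def by (simp add: divide_right_mono)
  finally show ?thesis by (simp add: d_def)
qed

section \<open>Convergence of processes under a moment condition\<close>

text \<open>The moment condition of Kolmogorov's continuity theorem, for the exponent \<open>4\<close>.\<close>

definition kolmogorov_condition :: "'a measure \<Rightarrow> (real \<Rightarrow> 'a \<Rightarrow> real) \<Rightarrow> real \<Rightarrow> bool" where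
  "kolmogorov_condition M X C \<longleftrightarrow> (\<forall>s t. 0 \<le> s \<longrightarrow> s \<le> t \<longrightarrow> t \<le> 1 \<longrightarrow>
     integrable M (\<lambda>\<omega>. (X t \<omega> - X s \<omega>) ^ 4) \<and> (\<integral>\<omega>. (X t \<omega> - X s \<omega>) ^ 4 \<partial>M) \<le> C * (t - s)\<^sup>2)"

lemma kolmogorov_conditionD:
  assumes "kolmogorov_condition M X C" "0 \<le> s" "s \<le> t" "t \<le> 1"
  shows "integrable M (\<lambda>\<omega>. (X t \<omega> - X s \<omega>) ^ 4)"
    and "(\<integral>\<omega>. (X t \<omega> - X s \<omega>) ^ 4 \<partial>M) \<le> C * (t - s)\<^sup>2"
  using assms by (auto simp: kolmogorov_condition_def)

lemma kolmogorov_condition_nonneg: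
  assumes "kolmogorov_condition M X C"
  shows "0 \<le> C"
proof -
  have "0 \<le> (\<integral>\<omega>. (X 1 \<omega> - X 0 \<omega>) ^ 4 \<partial>M)" by (rule Bochner_Integration.integral_nonneg) simp
  also have "\<dots> \<le> C * (1 - 0)\<^sup>2" by (rule kolmogorov_conditionD(2)[OF assms]) auto
  finally show ?thesis by simp
qed

lemma chain_bound_expectation:
  fixes X :: "real \<Rightarrow> 'a \<Rightarrow> real"
  assumes M: "prob_space M"
    and K: "kolmogorov_condition M X C"
  shows "integrable M (\<lambda>\<omega>. chain_bound (\<lambda>t. X t \<omega>) k)"
    and "(\<integral>\<omega>. chain_bound (\<lambda>t. X t \<omega>) k \<partial>M) \<le> (1 + C) * (9/10) ^ k"
proof -
  interpret prob_space M by fact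
  have ends: "0 \<le> real i / 2 ^ k" "real i / 2 ^ k \<le> real (Suc i) / 2 ^ k" "real (Suc i) / 2 ^ k \<le> 1"
    if "i < 2 ^ k" for i
  proof -
    have "real (Suc i) \<le> real (2 ^ k)" unfolding of_nat_le_iff using that by (rule Suc_leI)
    then show "0 \<le> real i / 2 ^ k" "real i / 2 ^ k \<le> real (Suc i) / 2 ^ k" "real (Suc i) / 2 ^ k \<le> 1"
      by (simp_all add: divide_right_mono)
  qed
  let ?d = "\<lambda>i \<omega>. (X (real (Suc i) / 2 ^ k) \<omega> - X (real i / 2 ^ k) \<omega>) ^ 4"
  have int_d: "integrable M (?d i)" if "i < 2 ^ k" for i by (rule kolmogorov_conditionD(1)[OF K ends[OF that]])
  have int_sum: "integrable M (\<lambda>\<omega>. (\<Sum>i<2 ^ k. ?d i \<omega>) / ((9/10) ^ k) ^ 3)"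
    by (intro integrable_divide_zero Bochner_Integration.integrable_sum int_d) simp
  show "integrable M (\<lambda>\<omega>. chain_bound (\<lambda>t. X t \<omega>) k)"
    unfolding chain_bound_def by (intro Bochner_Integration.integrable_add integrable_const int_sum)
  have C0: "0 \<le> C" by (rule kolmogorov_condition_nonneg[OF K])
  have "(\<integral>\<omega>. chain_bound (\<lambda>t. X t \<omega>) k \<partial>M) =
      (9/10) ^ k + (\<integral>\<omega>. (\<Sum>i<2 ^ k. ?d i \<omega>) \<partial>M) / ((9/10) ^ k) ^ 3"
    unfolding chain_bound_def
    by (subst Bochner_Integration.integral_add[OF integrable_const int_sum]) (simp add: prob_space)
  also have "(\<integral>\<omega>. (\<Sum>i<2 ^ k. ?d i \<omega>) \<partial>M) = (\<Sum>i<2 ^ k. \<integral>\<omega>. ?d i \<omega> \<partial>M)"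
    by (intro Bochner_Integration.integral_sum int_d) simp
  also have "\<dots> \<le> (\<Sum>i<(2::nat) ^ k. C * (1 / 2 ^ k)\<^sup>2)"
  proof (rule sum_mono)
    fix i :: nat assume "i \<in> {..<2 ^ k}"
    then have "(\<integral>\<omega>. ?d i \<omega> \<partial>M) \<le> C * (real (Suc i) / 2 ^ k - real i / 2 ^ k)\<^sup>2" by (intro kolmogorov_conditionD(2)[OF K] ends) auto
    also have "real (Suc i) / 2 ^ k - real i / 2 ^ k = 1 / 2 ^ k" by (simp add: diff_divide_distrib[symmetric])
    finally show "(\<integral>\<omega>. ?d i \<omega> \<partial>M) \<le> C * (1 / 2 ^ k)\<^sup>2" .
  qed
  also have "\<dots> = C * (1 / 2) ^ k"
    by (simp add: power2_eq_square power_divide)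
  finally have "(\<integral>\<omega>. chain_bound (\<lambda>t. X t \<omega>) k \<partial>M) \<le> (9/10) ^ k + C * (1 / 2) ^ k / ((9/10) ^ k) ^ 3"
    by (simp add: divide_right_mono)
  also have "C * (1 / 2) ^ k / ((9/10) ^ k) ^ 3 = C * ((1 / 2) / (9/10) ^ 3) ^ k"
    by (simp only: power_divide times_divide_eq_right power_mult[symmetric] mult.commute[of k 3])
  also have "\<dots> \<le> C * (9/10) ^ k"
    by (intro mult_left_mono power_mono C0) (simp_all add: power3_eq_cube)
  finally show "(\<integral>\<omega>. chain_bound (\<lambda>t. X t \<omega>) k \<partial>M) \<le> (1 + C) * (9/10) ^ k"
    by (simp add: algebra_simps)
qed

lemma chain_bound_tail:
  fixes X :: "real \<Rightarrow> 'a \<Rightarrow> real"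
  assumes M: "prob_space M"
    and K: "kolmogorov_condition M X C"
  shows "AE \<omega> in M. summable (chain_bound (\<lambda>t. X t \<omega>))"
    and "integrable M (\<lambda>\<omega>. \<Sum>k. chain_bound (\<lambda>t. X t \<omega>) (k + m))"
    and "(\<integral>\<omega>. (\<Sum>k. chain_bound (\<lambda>t. X t \<omega>) (k + m)) \<partial>M) \<le> 10 * (1 + C) * (9/10) ^ m"
proof -
  interpret prob_space M by fact
  let ?f = "\<lambda>k \<omega>. chain_bound (\<lambda>t. X t \<omega>) k"
  note f1 = chain_bound_expectation(1)[OF M K] and f2 = chain_bound_expectation(2)[OF M K]
  have [measurable]: "?f k \<in> borel_measurable M" for k using f1 by (rule borel_measurable_integrable)
  have nn: "(\<integral>\<^sup>+\<omega>. ennreal (?f k \<omega>) \<partial>M) = ennreal (\<integral>\<omega>. ?f k \<omega> \<partial>M)" for k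
    by (intro nn_integral_eq_integral f1 AE_I2 chain_bound_nonneg)
  have geo: "summable (\<lambda>k. (1 + C) * (9/10 :: real) ^ (k + m))" for m
    by (intro summable_mult) (simp add: power_add summable_mult2)
  have sum_E: "summable (\<lambda>k. \<integral>\<omega>. ?f (k + m) \<omega> \<partial>M)" for m
    by (rule summable_comparison_test_ev[OF _ geo[of m]])
       (use f2 in \<open>auto simp: chain_bound_nonneg integral_nonneg\<close>)
  have "(\<integral>\<^sup>+\<omega>. (\<Sum>k. ennreal (?f k \<omega>)) \<partial>M) = (\<Sum>k. ennreal (\<integral>\<omega>. ?f k \<omega> \<partial>M))"
    by (subst nn_integral_suminf) (auto simp: nn)
  also have "\<dots> = ennreal (\<Sum>k. \<integral>\<omega>. ?f k \<omega> \<partial>M)"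
    using sum_E[of 0] by (intro suminf_ennreal2) (auto simp: chain_bound_nonneg integral_nonneg)
  finally have "(\<integral>\<^sup>+\<omega>. (\<Sum>k. ennreal (?f k \<omega>)) \<partial>M) \<noteq> \<infinity>" by simp
  then have "AE \<omega> in M. (\<Sum>k. ennreal (?f k \<omega>)) \<noteq> \<infinity>"
    by (intro nn_integral_PInf_AE) auto
  then show summ: "AE \<omega> in M. summable (chain_bound (\<lambda>t. X t \<omega>))"
    by eventually_elim (auto intro: summable_suminf_not_top simp: chain_bound_nonneg)
  have summ': "AE \<omega> in M. summable (\<lambda>k. norm (?f (k + m) \<omega>))" for m
    using summ by eventually_elim (simp add: chain_bound_nonneg summable_iff_shift)
  have sum_E': "summable (\<lambda>k. \<integral>\<omega>. norm (?f (k + m) \<omega>) \<partial>M)" for m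
    using sum_E[of m] by (simp add: chain_bound_nonneg)
  show "integrable M (\<lambda>\<omega>. \<Sum>k. ?f (k + m) \<omega>)"
    by (rule integrable_suminf[OF f1 summ' sum_E'])
  have "(\<integral>\<omega>. (\<Sum>k. ?f (k + m) \<omega>) \<partial>M) = (\<Sum>k. \<integral>\<omega>. ?f (k + m) \<omega> \<partial>M)"
    by (rule integral_suminf[OF f1 summ' sum_E'])
  also have "\<dots> \<le> (\<Sum>k. (1 + C) * (9/10) ^ (k + m))"
    by (rule suminf_le[OF f2 sum_E geo])
  also have "\<dots> = (1 + C) * (9/10) ^ m * (\<Sum>k. (9/10) ^ k)"
    by (subst suminf_mult[symmetric]) (simp_all add: power_add mult_ac)
  also have "(\<Sum>k. (9/10 :: real) ^ k) = 10" by (subst suminf_geometric) auto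
  finally show "(\<integral>\<omega>. (\<Sum>k. ?f (k + m) \<omega>) \<partial>M) \<le> 10 * (1 + C) * (9/10) ^ m" by (simp add: algebra_simps)
qed

lemma measurable_apply_bcontfun:
  fixes X :: "'a \<Rightarrow> 'b::topological_space \<Rightarrow>\<^sub>C 'c::metric_space"
  assumes "X \<in> borel_measurable M"
  shows "(\<lambda>\<omega>. apply_bcontfun (X \<omega>) t) \<in> borel_measurable M"
proof (rule measurable_compose[OF assms])
  have "continuous_on UNIV (\<lambda>x :: 'b \<Rightarrow>\<^sub>C 'c. apply_bcontfun x t)"
    unfolding continuous_on_iff using dist_fun_lt_imp_dist_val_lt by blast
  then show "(\<lambda>x :: 'b \<Rightarrow>\<^sub>C 'c. apply_bcontfun x t) \<in> borel_measurable borel"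
    by (rule borel_measurable_continuous_onI)
qed

lemma lipschitz_continuous_on:
  fixes G :: "'a::metric_space \<Rightarrow> real"
  assumes "\<And>x y. \<bar>G x - G y\<bar> \<le> L * dist x y"
  shows "continuous_on UNIV G"
proof -
  have "dist (G x) (G y) \<le> \<bar>L\<bar> * dist x y" for x y
  proof -
    have "dist (G x) (G y) \<le> L * dist x y" using assms by (simp add: dist_real_def)
    also have "\<dots> \<le> \<bar>L\<bar> * dist x y" by (intro mult_right_mono) auto
    finally show ?thesis .
  qed
  then have "\<bar>L\<bar>-lipschitz_on UNIV G" by (intro lipschitz_onI) auto
  then show ?thesis by (rule lipschitz_on_continuous_on)
qed

lemma lipschitz_integral_diff:
  fixes X Y :: "'a \<Rightarrow> 'b::metric_space" and G :: "'b \<Rightarrow> real"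
  assumes M: "prob_space M" and X: "X \<in> borel_measurable M" and Y: "Y \<in> borel_measurable M"
    and lip: "\<And>x y. \<bar>G x - G y\<bar> \<le> L * dist x y" and B: "\<And>x. \<bar>G x\<bar> \<le> B" and L: "0 \<le> L"
    and d: "AE \<omega> in M. dist (X \<omega>) (Y \<omega>) \<le> d \<omega>" "integrable M d"
  shows "\<bar>(\<integral>\<omega>. G (X \<omega>) \<partial>M) - (\<integral>\<omega>. G (Y \<omega>) \<partial>M)\<bar> \<le> L * (\<integral>\<omega>. d \<omega> \<partial>M)"
proof -
  interpret prob_space M by fact
  have G: "G \<in> borel_measurable borel"
    using lipschitz_continuous_on[OF lip] by (rule borel_measurable_continuous_onI)
  have i: "integrable M (\<lambda>\<omega>. G (X \<omega>))" "integrable M (\<lambda>\<omega>. G (Y \<omega>))"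
    by (auto intro!: integrable_const_bound[where B=B] measurable_compose[OF X G] measurable_compose[OF Y G] B)
  have "\<bar>(\<integral>\<omega>. G (X \<omega>) \<partial>M) - (\<integral>\<omega>. G (Y \<omega>) \<partial>M)\<bar> = \<bar>\<integral>\<omega>. G (X \<omega>) - G (Y \<omega>) \<partial>M\<bar>" using i by simp
  also have "\<dots> \<le> (\<integral>\<omega>. \<bar>G (X \<omega>) - G (Y \<omega>)\<bar> \<partial>M)" by (rule integral_abs_bound)
  also have "\<dots> \<le> (\<integral>\<omega>. L * d \<omega> \<partial>M)"
  proof (rule integral_mono_AE)
    show "AE \<omega> in M. \<bar>G (X \<omega>) - G (Y \<omega>)\<bar> \<le> L * d \<omega>"
      using d(1) by eventually_elim (meson L lip mult_left_mono order_trans)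
  qed (use i d in auto)
  finally show ?thesis by simp
qed

text \<open>Up to an error that is small uniformly in \<open>n\<close>, the paths may be replaced by the polygons through
  their values at the multiples of \<open>2 ^ (- m)\<close>. A Lipschitz function of such a polygon is a bounded
  continuous function of finitely many values. Together with the moment condition, the common starting
  point \<open>0\<close> bounds the first moments of these values.\<close>

theorem process_convergence:
  fixes X :: "nat \<Rightarrow> 'a \<Rightarrow> real \<Rightarrow>\<^sub>C real" and Y :: "'b \<Rightarrow> real \<Rightarrow>\<^sub>C real"
  assumes N: "\<And>n. prob_space (N n)" and M: "prob_space M"
    and X: "\<And>n. X n \<in> borel_measurable (N n)" and Y: "Y \<in> borel_measurable M"
    and clampX: "\<And>n \<omega> t. X n \<omega> (clamp01 t) = X n \<omega> t" and clampY: "\<And>\<omega> t. Y \<omega> (clamp01 t) = Y \<omega> t"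
    and startX: "\<And>n \<omega>. X n \<omega> 0 = 0" and startY: "\<And>\<omega>. Y \<omega> 0 = 0"
    and KX: "\<And>n. kolmogorov_condition (N n) (\<lambda>t \<omega>. X n \<omega> t) C"
    and KY: "kolmogorov_condition M (\<lambda>t \<omega>. Y \<omega> t) C"
    and fdd: "\<And>m \<theta>. (\<lambda>n. \<integral>\<omega>. iexp (\<Sum>k<Suc (2 ^ m). \<theta> k * X n \<omega> (real k / 2 ^ m)) \<partial>N n)
       \<longlonglongrightarrow> (\<integral>\<omega>. iexp (\<Sum>k<Suc (2 ^ m). \<theta> k * Y \<omega> (real k / 2 ^ m)) \<partial>M)"
    and lip: "\<And>x y. \<bar>G x - G y\<bar> \<le> L * dist x y" and B: "\<And>x. \<bar>G x\<bar> \<le> (B::real)"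
  shows "(\<lambda>n. \<integral>\<omega>. G (X n \<omega>) \<partial>N n) \<longlonglongrightarrow> (\<integral>\<omega>. G (Y \<omega>) \<partial>M)"
proof (rule LIMSEQ_I)
  fix r :: real assume r: "0 < r"
  define L' where "L' = \<bar>L\<bar>"
  have L': "0 \<le> L'" by (simp add: L'_def)
  have lip': "\<bar>G x - G y\<bar> \<le> L' * dist x y" for x y
    by (rule order_trans[OF lip]) (auto simp: L'_def intro: mult_right_mono)
  have C0: "0 \<le> C" by (rule kolmogorov_condition_nonneg[OF KY])
  have "(\<lambda>m. L' * (10 * (1 + C) * (9/10) ^ m)) \<longlonglongrightarrow> L' * (10 * (1 + C) * 0)"
    by (intro tendsto_intros LIMSEQ_power_zero) auto
  then have "(\<lambda>m. L' * (10 * (1 + C) * (9/10) ^ m)) \<longlonglongrightarrow> 0" by simp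
  from LIMSEQ_D[OF this, of "r / 3"] r obtain m where "norm (L' * (10 * (1 + C) * (9/10) ^ m) - 0) < r / 3" by auto
  then have m: "L' * (10 * (1 + C) * (9/10) ^ m) < r / 3" by simp
  define P where "P x = polygon (2 ^ m) (\<lambda>k. apply_bcontfun x (real k / 2 ^ m))" for x
  have gap: "\<bar>(\<integral>\<omega>. G (x \<omega>) \<partial>Q) - (\<integral>\<omega>. G (P (x \<omega>)) \<partial>Q)\<bar> < r / 3"
    if Q: "prob_space Q" and x: "x \<in> borel_measurable Q"
      and clamp: "\<And>\<omega> t. x \<omega> (clamp01 t) = x \<omega> t"
      and K: "kolmogorov_condition Q (\<lambda>t \<omega>. x \<omega> t) C"
    for Q :: "'c measure" and x :: "'c \<Rightarrow> real \<Rightarrow>\<^sub>C real"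
  proof -
    note xt = measurable_apply_bcontfun[OF x]
    have tail: "AE \<omega> in Q. summable (chain_bound (x \<omega>))"
        "integrable Q (\<lambda>\<omega>. \<Sum>k. chain_bound (x \<omega>) (k + m))"
        "(\<integral>\<omega>. (\<Sum>k. chain_bound (x \<omega>) (k + m)) \<partial>Q) \<le> 10 * (1 + C) * (9/10) ^ m"
      using chain_bound_tail[OF Q K] by simp_all
    have "(\<lambda>\<omega>. \<lambda>k. x \<omega> (real k / 2 ^ m)) \<in> borel_measurable Q"
      by (rule measurable_coordinatewise_then_product[OF xt])
    then have Px: "(\<lambda>\<omega>. P (x \<omega>)) \<in> borel_measurable Q"
      unfolding P_def by (rule measurable_compose[OF _ borel_measurable_continuous_onI[OF continuous_polygon]])
    have "AE \<omega> in Q. dist (x \<omega>) (P (x \<omega>)) \<le> (\<Sum>k. chain_bound (x \<omega>) (k + m))"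
      using tail(1) unfolding P_def
      by eventually_elim (intro dist_dyadic_polygon clamp chain_bound_step)
    from lipschitz_integral_diff[OF Q x Px lip' B L' this tail(2)]
    have "\<bar>(\<integral>\<omega>. G (x \<omega>) \<partial>Q) - (\<integral>\<omega>. G (P (x \<omega>)) \<partial>Q)\<bar> \<le> L' * (10 * (1 + C) * (9/10) ^ m)"
      using mult_left_mono[OF tail(3) L'] by linarith
    then show ?thesis using m by linarith
  qed
  have first: "integrable Q (\<lambda>\<omega>. x \<omega> t)" "(\<integral>\<omega>. \<bar>x \<omega> t\<bar> \<partial>Q) \<le> 1 + C"
    if Q: "prob_space Q" and x: "x \<in> borel_measurable Q" and start: "\<And>\<omega>. x \<omega> 0 = 0"
      and K: "kolmogorov_condition Q (\<lambda>t \<omega>. x \<omega> t) C"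
      and t: "0 \<le> t" "t \<le> 1"
    for Q :: "'c measure" and x :: "'c \<Rightarrow> real \<Rightarrow>\<^sub>C real" and t
  proof -
    interpret Q: prob_space Q by fact
    have i4: "integrable Q (\<lambda>\<omega>. x \<omega> t ^ 4)" using kolmogorov_conditionD(1)[OF K, of 0 t] t start by simp
    have le: "\<bar>y\<bar> \<le> 1 + y ^ 4" for y :: real using abs_le_add_fourth_power[of 1 y] by simp
    show i: "integrable Q (\<lambda>\<omega>. x \<omega> t)"
    proof (rule Bochner_Integration.integrable_bound)
      show "integrable Q (\<lambda>\<omega>. 1 + x \<omega> t ^ 4)" using i4 by simp
      show "AE \<omega> in Q. norm (x \<omega> t) \<le> norm (1 + x \<omega> t ^ 4)"
      proof (rule AE_I2)
        show "norm (x \<omega> t) \<le> norm (1 + x \<omega> t ^ 4)" for \<omega>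
          using le[of "x \<omega> t"] by simp
      qed
    qed (rule measurable_apply_bcontfun[OF x])
    have "(\<integral>\<omega>. \<bar>x \<omega> t\<bar> \<partial>Q) \<le> (\<integral>\<omega>. 1 + x \<omega> t ^ 4 \<partial>Q)"
      using i i4 by (intro integral_mono le) simp_all
    also have "\<dots> = 1 + (\<integral>\<omega>. x \<omega> t ^ 4 \<partial>Q)" using i4 by (simp add: Q.prob_space)
    also have "(\<integral>\<omega>. x \<omega> t ^ 4 \<partial>Q) \<le> C * t\<^sup>2" using kolmogorov_conditionD(2)[OF K, of 0 t] t start by simp
    also have "\<dots> \<le> C * 1" using t C0 by (intro mult_left_mono) (auto simp: power_le_one)
    finally show "(\<integral>\<omega>. \<bar>x \<omega> t\<bar> \<partial>Q) \<le> 1 + C" by simp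
  qed
  define d where "d = Suc (2 ^ m)"
  have k01: "0 \<le> real k / 2 ^ m" "real k / 2 ^ m \<le> 1" if "k < d" for k
  proof -
    have "k \<le> 2 ^ m" using that by (simp add: d_def)
    then have "real k \<le> 2 ^ m" by (simp flip: of_nat_le_iff)
    then show "0 \<le> real k / 2 ^ m" "real k / 2 ^ m \<le> 1" by simp_all
  qed
  have "(\<lambda>n. \<integral>\<omega>. G (polygon (2 ^ m) (\<lambda>k. X n \<omega> (real k / 2 ^ m))) \<partial>N n) \<longlonglongrightarrow>
      (\<integral>\<omega>. G (polygon (2 ^ m) (\<lambda>k. Y \<omega> (real k / 2 ^ m))) \<partial>M)"
  proof (rule levy_continuity_vector[where d=d and D="1 + C" and B=B and G="\<lambda>v. G (polygon (2 ^ m) v)"])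
    show "(\<lambda>n. \<integral>\<omega>. iexp (\<Sum>k<d. \<theta> k * X n \<omega> (real k / 2 ^ m)) \<partial>N n)
       \<longlonglongrightarrow> (\<integral>\<omega>. iexp (\<Sum>k<d. \<theta> k * Y \<omega> (real k / 2 ^ m)) \<partial>M)" for \<theta>
      unfolding d_def by (rule fdd)
    show "continuous_on UNIV (\<lambda>v. G (polygon (2 ^ m) v))"
      by (rule continuous_on_compose2[OF lipschitz_continuous_on[OF lip] continuous_polygon]) auto
    show "G (polygon (2 ^ m) (\<lambda>k. if k < d then v k else 0)) = G (polygon (2 ^ m) v)" for v
      unfolding polygon_def d_def by (auto intro!: arg_cong[of _ _ G] sum.cong)
    show "integrable (N n) (\<lambda>\<omega>. X n \<omega> (real k / 2 ^ m))" "(\<integral>\<omega>. \<bar>X n \<omega> (real k / 2 ^ m)\<bar> \<partial>N n) \<le> 1 + C"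
      if "k < d" for n k
      by (rule first[OF N X startX KX k01[OF that]]; assumption)+
    show "integrable M (\<lambda>\<omega>. Y \<omega> (real k / 2 ^ m))" "(\<integral>\<omega>. \<bar>Y \<omega> (real k / 2 ^ m)\<bar> \<partial>M) \<le> 1 + C"
      if "k < d" for k
      by (rule first[OF M Y startY KY k01[OF that]]; assumption)+
  qed (rule N M B measurable_apply_bcontfun X Y)+
  from LIMSEQ_D[OF this, of "r / 3"] r obtain n0 where
    n0: "\<And>n. n \<ge> n0 \<Longrightarrow> \<bar>(\<integral>\<omega>. G (P (X n \<omega>)) \<partial>N n) - (\<integral>\<omega>. G (P (Y \<omega>)) \<partial>M)\<bar> < r / 3"
    unfolding P_def by auto
  show "\<exists>n0. \<forall>n\<ge>n0. norm ((\<integral>\<omega>. G (X n \<omega>) \<partial>N n) - (\<integral>\<omega>. G (Y \<omega>) \<partial>M)) < r"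
  proof (intro exI[of _ n0] allI impI)
    fix n assume "n \<ge> n0"
    show "norm ((\<integral>\<omega>. G (X n \<omega>) \<partial>N n) - (\<integral>\<omega>. G (Y \<omega>) \<partial>M)) < r"
      using n0[OF \<open>n \<ge> n0\<close>] gap[of "N n" "X n", OF N X clampX KX] gap[of M Y, OF M Y clampY KY]
      unfolding real_norm_def by linarith
  qed
qed

section \<open>Sums of bounded independent variables\<close>

lemma abs_exp_minus_taylor:
  fixes x :: real
  assumes "0 \<le> x"
  shows "\<bar>exp (- x) - (1 - x)\<bar> \<le> x\<^sup>2 / 2"
proof -
  have "1 - x \<le> exp (- x)" using exp_ge_add_one_self[of "- x"] by simp
  moreover have "exp (- x) \<le> 1 - x + x\<^sup>2 / 2"
  proof -
    have "0 \<le> 1 - x + x\<^sup>2 / 2"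
    proof -
      have "0 \<le> (1 - x)\<^sup>2" by simp
      then have "0 \<le> 1 - 2 * x + x\<^sup>2" by (simp add: power2_diff)
      then show ?thesis using assms by simp
    qed
    then have "(1 - x + x\<^sup>2 / 2) * exp x \<ge> (1 - x + x\<^sup>2 / 2) * (1 + x + x\<^sup>2 / 2)"
      using exp_lower_Taylor_quadratic[OF assms] by (intro mult_left_mono) auto
    moreover have "(1 - x + x\<^sup>2 / 2) * (1 + x + x\<^sup>2 / 2) = 1 + (x\<^sup>2)\<^sup>2 / 4"
      by (simp add: power2_eq_square algebra_simps)
    ultimately have "1 \<le> (1 - x + x\<^sup>2 / 2) * exp x"
      by (smt (verit) zero_le_power2 divide_nonneg_pos)
    then show ?thesis by (simp add: exp_minus field_simps)
  qed
  ultimately show ?thesis by linarith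
qed

context prob_space
begin

text \<open>A quantitative central limit theorem: for each summand with variance \<open>v\<close>, both its characteristic
  function at \<open>1\<close> and \<open>exp (- v / 2)\<close> are close to \<open>1 - v / 2\<close>, and products of numbers in the unit
  disc differ by at most the sum of the differences of the factors.\<close>

lemma char_sum_bounded_centered:
  assumes fin: "finite I" and indep: "indep_vars (\<lambda>_. borel) X I"
    and b: "\<And>i \<omega>. i \<in> I \<Longrightarrow> \<bar>X i \<omega>\<bar> \<le> b" and EX: "\<And>i. i \<in> I \<Longrightarrow> expectation (X i) = 0"
  shows "cmod ((\<integral>\<omega>. iexp (\<Sum>i\<in>I. X i \<omega>) \<partial>M) - exp (- ((\<Sum>i\<in>I. expectation (\<lambda>\<omega>. (X i \<omega>)\<^sup>2)) / 2)))
    \<le> (b / 6 + b\<^sup>2 / 8) * (\<Sum>i\<in>I. expectation (\<lambda>\<omega>. (X i \<omega>)\<^sup>2))"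
proof -
  have X: "X i \<in> borel_measurable M" if "i \<in> I" for i using indep that by (auto simp: indep_vars_def2)
  define v where "v i = expectation (\<lambda>\<omega>. (X i \<omega>)\<^sup>2)" for i
  have X2: "(X i \<omega>)\<^sup>2 \<le> b\<^sup>2" if "i \<in> I" for i \<omega>
    using b[OF that, of \<omega>] by (simp add: abs_le_square_iff[symmetric])
  have int2: "integrable M (\<lambda>\<omega>. (X i \<omega>)\<^sup>2)" if "i \<in> I" for i
    using X[OF that] X2[OF that] by (intro integrable_const_bound[where B="b\<^sup>2"]) auto
  have int1: "integrable M (X i)" if "i \<in> I" for i
    using X[OF that] b[OF that] by (intro integrable_const_bound[where B=b]) auto
  have v0: "0 \<le> v i" for i by (simp add: v_def)
  have vb: "v i \<le> b\<^sup>2" if "i \<in> I" for i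
    unfolding v_def using integral_mono[OF int2[OF that] integrable_const X2[OF that]] by (simp add: prob_space)
  let ?phi = "\<lambda>i. char (distr M borel (X i)) 1"
  have "(\<integral>\<omega>. iexp (\<Sum>i\<in>I. X i \<omega>) \<partial>M) = char (distr M borel (\<lambda>\<omega>. \<Sum>i\<in>I. X i \<omega>)) 1"
    using X by (simp add: char_def integral_distr)
  also have "\<dots> = (\<Prod>i\<in>I. ?phi i)" by (rule char_distr_sum[OF indep])
  finally have prod: "(\<integral>\<omega>. iexp (\<Sum>i\<in>I. X i \<omega>) \<partial>M) = (\<Prod>i\<in>I. ?phi i)" .
  have "exp (- ((\<Sum>i\<in>I. v i) / 2)) = (\<Prod>i\<in>I. exp (- (v i / 2)))"
    using fin by (simp add: exp_sum[symmetric] sum_negf sum_divide_distrib)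
  then have prod': "complex_of_real (exp (- ((\<Sum>i\<in>I. v i) / 2))) = (\<Prod>i\<in>I. complex_of_real (exp (- (v i / 2))))"
    by simp
  have "cmod (?phi i - complex_of_real (exp (- (v i / 2)))) \<le> (b / 6 + b\<^sup>2 / 8) * v i" if i: "i \<in> I" for i
  proof -
    have b0: "0 \<le> b" using b[OF i] by (meson abs_ge_zero order_trans)
    have var: "variance (X i) = v i" using EX[OF i] by (simp add: v_def)
    have "cmod (?phi i - (1 - 1\<^sup>2 * v i / 2)) \<le> 1\<^sup>2 / 6 * expectation (\<lambda>x. min (6 * (X i x)\<^sup>2) (\<bar>1\<bar> * \<bar>X i x\<bar> ^ 3))"
      by (rule char_approx3'[OF X[OF i] int1[OF i] int2[OF i] EX[OF i] var refl, of 1])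
    also have "expectation (\<lambda>x. min (6 * (X i x)\<^sup>2) (\<bar>1\<bar> * \<bar>X i x\<bar> ^ 3)) \<le> expectation (\<lambda>x. b * (X i x)\<^sup>2)"
    proof (rule integral_mono)
      show "integrable M (\<lambda>x. min (6 * (X i x)\<^sup>2) (\<bar>1\<bar> * \<bar>X i x\<bar> ^ 3))"
        using X[OF i] int2[OF i] by (intro Bochner_Integration.integrable_bound[OF integrable_mult_right[OF int2[OF i], of 6]]) auto
      show "integrable M (\<lambda>x. b * (X i x)\<^sup>2)" using int2[OF i] by simp
      fix x
      have "\<bar>X i x\<bar> ^ 3 = \<bar>X i x\<bar> * (X i x)\<^sup>2" by (simp add: power3_eq_cube power2_eq_square)
      also have "\<dots> \<le> b * (X i x)\<^sup>2" by (intro mult_right_mono b i) simp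
      finally show "min (6 * (X i x)\<^sup>2) (\<bar>1\<bar> * \<bar>X i x\<bar> ^ 3) \<le> b * (X i x)\<^sup>2" by simp
    qed
    finally have 1: "cmod (?phi i - (1 - v i / 2)) \<le> b / 6 * v i" by (simp add: v_def)
    have "\<bar>exp (- (v i / 2)) - (1 - v i / 2)\<bar> \<le> (v i / 2)\<^sup>2 / 2" by (intro abs_exp_minus_taylor) (simp add: v0)
    also have "\<dots> = v i * v i / 8" by (simp add: power2_eq_square)
    also have "\<dots> \<le> b\<^sup>2 * v i / 8" by (intro divide_right_mono mult_right_mono vb i v0) simp
    finally have "\<bar>exp (- (v i / 2)) - (1 - v i / 2)\<bar> \<le> b\<^sup>2 / 8 * v i" by simp
    moreover have "complex_of_real (exp (- (v i / 2))) - (1 - v i / 2) =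
        complex_of_real (exp (- (v i / 2)) - (1 - v i / 2))"
      unfolding of_real_diff of_real_divide of_real_1 of_real_numeral ..
    ultimately have 2: "cmod (complex_of_real (exp (- (v i / 2))) - (1 - v i / 2)) \<le> b\<^sup>2 / 8 * v i"
      by (simp only: norm_of_real)
    have "cmod (?phi i - complex_of_real (exp (- (v i / 2)))) \<le>
       cmod (?phi i - (1 - v i / 2)) + cmod (complex_of_real (exp (- (v i / 2))) - (1 - v i / 2))"
      using norm_triangle_ineq4[of "?phi i - (1 - v i / 2)" "complex_of_real (exp (- (v i / 2))) - (1 - v i / 2)"]
      by (simp only: diff_diff_eq2 diff_add_cancel)
    then show ?thesis using 1 2 by (simp add: distrib_right)
  qed
  moreover have "cmod ((\<Prod>i\<in>I. ?phi i) - (\<Prod>i\<in>I. complex_of_real (exp (- (v i / 2))))) \<le>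
      (\<Sum>i\<in>I. cmod (?phi i - complex_of_real (exp (- (v i / 2)))))"
  proof (rule norm_prod_diff)
    show "cmod (?phi i) \<le> 1" if "i \<in> I" for i
      by (rule real_distribution.cmod_char_le_1[OF real_distribution_distr[OF X[OF that]]])
    show "cmod (complex_of_real (exp (- (v i / 2)))) \<le> 1" for i using v0[of i] by (simp only: norm_of_real) simp
  qed
  ultimately have "cmod ((\<Prod>i\<in>I. ?phi i) - (\<Prod>i\<in>I. complex_of_real (exp (- (v i / 2))))) \<le>
      (\<Sum>i\<in>I. (b / 6 + b\<^sup>2 / 8) * v i)"
    by (meson order_trans sum_mono)
  then show ?thesis
    unfolding prod v_def[symmetric] prod'[symmetric] by (simp add: sum_distrib_left)
qed

text \<open>In the expansion of the fourth power, the terms that contain a variable only once have mean zero.\<close>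

lemma moments_sum_bounded_centered:
  fixes X :: "'i \<Rightarrow> 'a \<Rightarrow> real"
  assumes "finite I" and "indep_vars (\<lambda>_. borel) X I"
    and "\<And>i \<omega>. i \<in> I \<Longrightarrow> \<bar>X i \<omega>\<bar> \<le> 1" and "\<And>i. i \<in> I \<Longrightarrow> expectation (X i) = 0"
  defines "V \<equiv> \<lambda>I. \<Sum>i\<in>I. expectation (\<lambda>\<omega>. (X i \<omega>)\<^sup>2)"
  shows "expectation (\<lambda>\<omega>. \<Sum>i\<in>I. X i \<omega>) = 0 \<and> expectation (\<lambda>\<omega>. (\<Sum>i\<in>I. X i \<omega>)\<^sup>2) = V I \<and>
    expectation (\<lambda>\<omega>. (\<Sum>i\<in>I. X i \<omega>) ^ 4) \<le> V I + 3 * (V I)\<^sup>2"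
  using assms(1-4)
proof (induction I rule: finite_induct)
  case empty
  then show ?case by (simp add: V_def)
next
  case (insert i I)
  define S where "S \<omega> = (\<Sum>i\<in>I. X i \<omega>)" for \<omega>
  have indepI: "indep_vars (\<lambda>_. borel) X I" using insert.prems(1) by (rule indep_vars_subset) auto
  have IH: "expectation S = 0" "expectation (\<lambda>\<omega>. (S \<omega>)\<^sup>2) = V I" "expectation (\<lambda>\<omega>. S \<omega> ^ 4) \<le> V I + 3 * (V I)\<^sup>2"
    using insert.IH[OF indepI] insert.prems unfolding S_def[abs_def] by auto
  have meas: "X j \<in> borel_measurable M" if "j \<in> insert i I" for j
    using insert.prems(1) that unfolding indep_vars_def2 by auto
  have Si: "S \<in> borel_measurable M" unfolding S_def[abs_def] using meas by (intro borel_measurable_sum) auto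
  have Sb: "\<bar>S \<omega>\<bar> \<le> real (card I)" for \<omega>
  proof -
    have "\<bar>S \<omega>\<bar> \<le> (\<Sum>i\<in>I. \<bar>X i \<omega>\<bar>)" unfolding S_def by (rule sum_abs)
    also have "\<dots> \<le> (\<Sum>i\<in>I. 1)" by (intro sum_mono insert.prems) auto
    finally show ?thesis by simp
  qed
  have intX: "integrable M (\<lambda>\<omega>. X i \<omega> ^ a)" for a
    using meas insert.prems(2)[of i] by (intro integrable_const_bound[where B=1]) (auto simp: power_abs intro!: AE_I2 power_le_one)
  have intS: "integrable M (\<lambda>\<omega>. S \<omega> ^ a)" for a
    using Si Sb by (intro integrable_const_bound[where B="real (card I) ^ a"]) (auto simp: power_abs intro!: AE_I2 power_mono)
  have "indep_var borel (X i) borel S"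
    unfolding S_def[abs_def] by (rule indep_vars_sum[OF insert.hyps insert.prems(1)])
  then have ind: "indep_var borel ((\<lambda>x. x ^ a) \<circ> X i) borel ((\<lambda>x. x ^ c) \<circ> S)" for a c
    by (rule indep_var_compose) auto
  have prodE: "expectation (\<lambda>\<omega>. X i \<omega> ^ a * S \<omega> ^ c) = expectation (\<lambda>\<omega>. X i \<omega> ^ a) * expectation (\<lambda>\<omega>. S \<omega> ^ c)"
    and prodI: "integrable M (\<lambda>\<omega>. X i \<omega> ^ a * S \<omega> ^ c)" for a c
    using indep_var_lebesgue_integral[OF ind, of a c] indep_var_integrable[OF ind, of a c] intX[of a] intS[of c]
    by (simp_all add: o_def)
  define v where "v = expectation (\<lambda>\<omega>. (X i \<omega>)\<^sup>2)"
  have EXi: "expectation (X i) = 0" using insert.prems(3) by simp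
  have Vins: "V (insert i I) = v + V I" using insert.hyps by (simp add: V_def v_def)
  have sum_ins: "(\<Sum>i\<in>insert i I. X i \<omega>) = X i \<omega> + S \<omega>" for \<omega> using insert.hyps by (simp add: S_def)
  have V0: "0 \<le> v" "0 \<le> V I" by (auto simp: v_def V_def intro: sum_nonneg)
  have "expectation (\<lambda>\<omega>. X i \<omega> + S \<omega>) = 0"
    using intX[of 1] intS[of 1] EXi IH(1) by simp
  moreover have "expectation (\<lambda>\<omega>. (X i \<omega> + S \<omega>)\<^sup>2) = v + V I"
  proof -
    have eq: "(X i \<omega> + S \<omega>)\<^sup>2 = X i \<omega> ^ 2 + (2 * (X i \<omega> ^ 1 * S \<omega> ^ 1) + S \<omega> ^ 2)" for \<omega>
      by (simp add: power2_sum algebra_simps)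
    have "expectation (\<lambda>\<omega>. (X i \<omega> + S \<omega>)\<^sup>2) =
       expectation (\<lambda>\<omega>. X i \<omega> ^ 2) + (2 * expectation (\<lambda>\<omega>. X i \<omega> ^ 1 * S \<omega> ^ 1) + expectation (\<lambda>\<omega>. S \<omega> ^ 2))"
      unfolding eq using intX[of 2] intS[of 2] prodI[of 1 1] by simp
    then show ?thesis unfolding prodE using EXi IH by (simp add: v_def)
  qed
  moreover have "expectation (\<lambda>\<omega>. (X i \<omega> + S \<omega>) ^ 4) \<le> (v + V I) + 3 * (v + V I)\<^sup>2"
  proof -
    have eq: "(X i \<omega> + S \<omega>) ^ 4 = X i \<omega> ^ 4 + (4 * (X i \<omega> ^ 3 * S \<omega> ^ 1) + (6 * (X i \<omega> ^ 2 * S \<omega> ^ 2) +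
       (4 * (X i \<omega> ^ 1 * S \<omega> ^ 3) + S \<omega> ^ 4)))" for \<omega>
      by (simp add: power4_eq_xxxx power3_eq_cube power2_eq_square algebra_simps)
    have "expectation (\<lambda>\<omega>. (X i \<omega> + S \<omega>) ^ 4) =
       expectation (\<lambda>\<omega>. X i \<omega> ^ 4) + (4 * expectation (\<lambda>\<omega>. X i \<omega> ^ 3 * S \<omega> ^ 1) + (6 * expectation (\<lambda>\<omega>. X i \<omega> ^ 2 * S \<omega> ^ 2) +
       (4 * expectation (\<lambda>\<omega>. X i \<omega> ^ 1 * S \<omega> ^ 3) + expectation (\<lambda>\<omega>. S \<omega> ^ 4))))"
      unfolding eq using intX[of 4] intS[of 4] prodI[of 3 1] prodI[of 2 2] prodI[of 1 3] by simp
    also have "\<dots> = expectation (\<lambda>\<omega>. X i \<omega> ^ 4) + 6 * (v * V I) + expectation (\<lambda>\<omega>. S \<omega> ^ 4)"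
      unfolding prodE using EXi IH by (simp add: v_def)
    also have "expectation (\<lambda>\<omega>. X i \<omega> ^ 4) \<le> v"
      unfolding v_def
    proof (intro integral_mono intX)
      fix \<omega>
      have "\<bar>X i \<omega>\<bar> ^ 4 \<le> \<bar>X i \<omega>\<bar> ^ 2" using insert.prems(2)[of i \<omega>] by (intro power_decreasing) auto
      then show "X i \<omega> ^ 4 \<le> (X i \<omega>)\<^sup>2" by simp
    qed
    also have "v + 6 * (v * V I) + expectation (\<lambda>\<omega>. S \<omega> ^ 4) \<le> v + 6 * (v * V I) + (V I + 3 * (V I)\<^sup>2)"
      using IH(3) by simp
    also have "\<dots> \<le> (v + V I) + 3 * (v + V I)\<^sup>2"
      by (simp add: power2_sum)
    finally show ?thesis by simp
  qed
  ultimately show ?case unfolding sum_ins Vins by simp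
qed

end

section \<open>Fluctuations of the counts for a random map\<close>

lemma finite_random_map: "finite (set_pmf (random_map n))"
proof (cases "n = 0")
  case False
  then have "random_map n = pmf_of_set (maps n)" by (intro random_map_eq) simp
  moreover have "finite (maps n)" "maps n \<noteq> {}" using False by (auto intro!: finite_PiE_dflt)
  ultimately show ?thesis by simp
qed (simp add: random_map_def)

lemma integrable_random_map: "integrable (measure_pmf (random_map n)) (f :: _ \<Rightarrow> real)"
  using finite_random_map by (rule integrable_measure_pmf_finite)

lemma random_map_indep:
  "prob_space.indep_vars (measure_pmf (random_map n)) (\<lambda>_. borel) (\<lambda>r u. g r (u r) :: real) {1<..n}"
  unfolding random_map_def
  by (rule prob_space.indep_vars_compose2[OF measure_pmf.prob_space_axioms indep_vars_Pi_pmf]) simp_all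

lemma random_map_expectation:
  assumes "r \<in> {1<..n}"
  shows "measure_pmf.expectation (random_map n) (\<lambda>u. f (u r)) = (\<Sum>v\<in>{1..n}. f v) / real n"
proof -
  have "measure_pmf.expectation (random_map n) (\<lambda>u. f (u r)) =
      measure_pmf.expectation (map_pmf (\<lambda>u. u r) (random_map n)) f" by simp
  also have "map_pmf (\<lambda>u. u r) (random_map n) = pmf_of_set {1..n}"
    unfolding random_map_def using assms by (subst Pi_pmf_component) auto
  also have "measure_pmf.expectation (pmf_of_set {1..n}) f = (\<Sum>v\<in>{1..n}. f v) / real n"
    using assms by (subst integral_pmf_of_set) auto
  finally show ?thesis .
qed

text \<open>The centred indicator of \<open>v \<le> j\<close>, for those \<open>r\<close> that take part at time \<open>j\<close>. A sum over a range that
  does not depend on \<open>j\<close> allows linear combinations over several \<open>j\<close> to be taken inside.\<close>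

definition below :: "nat \<Rightarrow> nat \<Rightarrow> nat \<Rightarrow> nat \<Rightarrow> real" where
  "below n j r v = (if r \<le> j then of_bool (v \<le> j) - real j / real n else 0)"

definition fluct :: "nat \<Rightarrow> nat \<Rightarrow> (nat \<Rightarrow> nat) \<Rightarrow> real" where
  "fluct n j u = (\<Sum>r\<in>{1<..n}. below n j r (u r))"

lemma card_eq_fluct:
  assumes "j \<le> n"
  shows "real (card {r \<in> {1<..j}. u r \<le> j}) = fluct n j u + (real j - 1) * real j / real n"
proof -
  have "fluct n j u = (\<Sum>r\<in>{1<..j}. of_bool (u r \<le> j) - real j / real n)"
    unfolding fluct_def below_def using assms by (intro sum.mono_neutral_cong_right) auto
  also have "\<dots> = real (card {r \<in> {1<..j}. u r \<le> j}) - real (j - 1) * (real j / real n)"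
    by (simp add: sum_subtractf Int_def)
  finally show ?thesis by (cases j) (auto simp: algebra_simps)
qed

lemma sum_of_bool_le: "a \<le> n \<Longrightarrow> (\<Sum>v\<in>{1..n}. of_bool (v \<le> a)) = real a" for a n :: nat
proof -
  assume "a \<le> n"
  then have "{1..n} \<inter> {v. v \<le> a} = {1..a}" by auto
  then show ?thesis by (simp add: of_bool_def sum.If_cases)
qed

lemma random_map_below:
  assumes r: "r \<in> {1<..n}" and j: "j \<le> n"
  shows "measure_pmf.expectation (random_map n) (\<lambda>u. below n j r (u r)) = 0"
proof (cases "r \<le> j")
  case True
  then have "(\<Sum>v\<in>{1..n}. below n j r v) = 0"
    using r sum_of_bool_le[OF j] by (simp add: below_def sum_subtractf)
  then show ?thesis by (subst random_map_expectation[OF r]) simp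
qed (simp add: below_def)

lemma random_map_below_prod:
  assumes r: "r \<in> {1<..n}" and i: "i \<le> n" and j: "j \<le> n"
  shows "measure_pmf.expectation (random_map n) (\<lambda>u. below n i r (u r) * below n j r (u r)) =
    of_bool (r \<le> min i j) * (real (min i j) / real n - real i * real j / (real n)\<^sup>2)"
proof (cases "r \<le> min i j")
  case True
  have n: "0 < real n" using r by auto
  have "(\<Sum>v\<in>{1..n}. below n i r v * below n j r v) = (\<Sum>v\<in>{1..n}. of_bool (v \<le> min i j)
     - real j / real n * of_bool (v \<le> i) - real i / real n * of_bool (v \<le> j) + real i / real n * (real j / real n))"
    using True by (intro sum.cong refl) (auto simp: below_def algebra_simps)
  also have "\<dots> = real (min i j) - real j / real n * real i - real i / real n * real j + real n * (real i / real n * (real j / real n))"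
    unfolding sum.distrib sum_subtractf sum_distrib_left[symmetric]
    using sum_of_bool_le[OF i] sum_of_bool_le[OF j] sum_of_bool_le[of "min i j" n] i by simp
  also have "\<dots> = real n * (real (min i j) / real n - real i * real j / (real n)\<^sup>2)"
    using n by (simp add: field_simps power2_eq_square)
  finally show ?thesis using True n by (subst random_map_expectation[OF r]) simp
qed (auto simp: below_def)

lemma fluct_start: "fluct n 0 u = 0"
  by (simp add: fluct_def below_def)

text \<open>The increment is a sum of centred indicators. Their variances are at most the means of the
  indicators, which add up to \<open>(j (j - 1) - i (i - 1)) / n \<le> 2 (j - i)\<close>.\<close>

lemma fluct_fourth_moment:
  assumes ij: "i \<le> j" "j \<le> n"
  shows "measure_pmf.expectation (random_map n) (\<lambda>u. (fluct n j u - fluct n i u) ^ 4) \<le> 14 * (real (j - i))\<^sup>2"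
proof (cases "i = j \<or> n = 0")
  case False
  then have d: "1 \<le> real (j - i)" and n: "0 < real n" using ij by auto
  let ?E = "measure_pmf.expectation (random_map n)"
  let ?X = "\<lambda>r u. below n j r (u r) - below n i r (u r)"
  define p where "p r = of_bool (r \<le> j) * (real j / real n) - of_bool (r \<le> i) * (real i / real n)" for r
  define V where "V = (\<Sum>r\<in>{1<..n}. ?E (\<lambda>u. (?X r u)\<^sup>2))"
  have eq: "fluct n j u - fluct n i u = (\<Sum>r\<in>{1<..n}. ?X r u)" for u
    by (simp add: fluct_def sum_subtractf)
  \<comment> \<open>Each summand is a centred indicator.\<close>
  have X: "?X r u = of_bool (r \<le> j \<and> u r \<le> j \<and> \<not> (r \<le> i \<and> u r \<le> i)) - p r" for r u
    using ij by (auto simp: below_def p_def)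
  have p01: "0 \<le> p r" "p r \<le> 1" for r
  proof -
    have "real i / real n \<le> real j / real n" "real j / real n \<le> 1" "0 \<le> real i / real n"
      using ij n by (auto intro: divide_right_mono)
    then have "real j / real n - real i / real n \<le> 1" by linarith
    then show "0 \<le> p r" "p r \<le> 1"
      using ij \<open>real i / real n \<le> real j / real n\<close> \<open>real j / real n \<le> 1\<close> by (auto simp: p_def)
  qed
  have Xb: "\<bar>?X r u\<bar> \<le> 1" for r u unfolding X using p01[of r] by auto
  have EX: "?E (?X r) = 0" if "r \<in> {1<..n}" for r
    using random_map_below[OF that] ij by (simp add: integrable_random_map)
  have mom: "?E (\<lambda>u. (\<Sum>r\<in>{1<..n}. ?X r u) ^ 4) \<le> V + 3 * V\<^sup>2"
    using prob_space.moments_sum_bounded_centered[OF measure_pmf.prob_space_axioms _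
        random_map_indep[of n "\<lambda>r v. below n j r v - below n i r v"]] Xb EX
    unfolding V_def by simp
  have "?E (\<lambda>u. (?X r u)\<^sup>2) \<le> p r" if r: "r \<in> {1<..n}" for r
  proof -
    have "(?X r u)\<^sup>2 \<le> p r + (1 - 2 * p r) * ?X r u + (p r)\<^sup>2 - (p r)\<^sup>2" for u
      unfolding X using p01[of r] by (cases "r \<le> j \<and> u r \<le> j \<and> \<not> (r \<le> i \<and> u r \<le> i)")
        (auto simp: power2_eq_square algebra_simps)
    then have "?E (\<lambda>u. (?X r u)\<^sup>2) \<le> ?E (\<lambda>u. p r + (1 - 2 * p r) * ?X r u)"
      by (intro integral_mono integrable_random_map) simp
    also have "\<dots> = p r + (1 - 2 * p r) * ?E (?X r)"
      by (simp add: integrable_random_map)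
    finally show ?thesis using EX[OF r] by simp
  qed
  then have "V \<le> (\<Sum>r\<in>{1<..n}. p r)" unfolding V_def by (rule sum_mono)
  also have "(\<Sum>r\<in>{1<..n}. p r) = real (j - 1) * (real j / real n) - real (i - 1) * (real i / real n)"
  proof -
    have "(\<Sum>r\<in>{1<..n}. of_bool (r \<le> k) * c) = real (k - 1) * c" if "k \<le> n" for k and c :: real
    proof -
      have "(\<Sum>r\<in>{1<..n}. of_bool (r \<le> k) * c) = (\<Sum>r\<in>{1<..k}. c)"
        using that by (intro sum.mono_neutral_cong_right) auto
      then show ?thesis by simp
    qed
    from this[of j "real j / real n"] this[of i "real i / real n"] show ?thesis
      unfolding p_def sum_subtractf using ij by simp
  qed
  also have "\<dots> \<le> 2 * real (j - i)"
  proof -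
    have "real (k - 1) * real k = real k * real k - real k" for k :: nat by (cases k) (auto simp: algebra_simps)
    then have "real (j - 1) * (real j / real n) - real (i - 1) * (real i / real n) =
       (real j * real j - real j - (real i * real i - real i)) / real n"
      by (simp add: diff_divide_distrib)
    also have "real j * real j - real j - (real i * real i - real i) = real (j - i) * (real j + real i - 1)"
      using ij by (simp add: of_nat_diff algebra_simps)
    also have "\<dots> \<le> real (j - i) * (2 * real n)" using ij by (intro mult_left_mono) auto
    finally show ?thesis using n by (simp add: divide_right_mono pos_divide_le_eq mult_ac)
  qed
  finally have V: "V \<le> 2 * real (j - i)" .
  have "0 \<le> V" unfolding V_def by (intro sum_nonneg Bochner_Integration.integral_nonneg) simp
  then have "V\<^sup>2 \<le> (2 * real (j - i))\<^sup>2" using V by (intro power_mono)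
  then have "V\<^sup>2 \<le> 4 * (real (j - i))\<^sup>2" by (simp add: power_mult_distrib)
  moreover have "real (j - i) \<le> (real (j - i))\<^sup>2" using self_le_power[OF d, of 2] by simp
  ultimately show ?thesis unfolding eq using mom V by linarith
qed (use ij in auto)

lemma sum3_fourth_power_le: "(a + b + c) ^ 4 \<le> 27 * (a ^ 4 + b ^ 4 + c ^ 4)" for a b c :: real
proof -
  have sq: "(x + y + z)\<^sup>2 \<le> 3 * (x\<^sup>2 + y\<^sup>2 + z\<^sup>2)" for x y z :: real
  proof -
    have "0 \<le> (x - y)\<^sup>2 + (y - z)\<^sup>2 + (x - z)\<^sup>2" by simp
    then show ?thesis by (simp add: power2_eq_square algebra_simps)
  qed
  have "(a + b + c) ^ 4 = ((a + b + c)\<^sup>2)\<^sup>2" by simp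
  also have "\<dots> \<le> (3 * (a\<^sup>2 + b\<^sup>2 + c\<^sup>2))\<^sup>2" by (intro power_mono sq) simp
  also have "\<dots> = 9 * (a\<^sup>2 + b\<^sup>2 + c\<^sup>2)\<^sup>2" by (subst power_mult_distrib) simp
  also have "\<dots> \<le> 9 * (3 * ((a\<^sup>2)\<^sup>2 + (b\<^sup>2)\<^sup>2 + (c\<^sup>2)\<^sup>2))" by (intro mult_left_mono sq) simp
  finally show ?thesis by simp
qed

text \<open>Cut the interval from \<open>s\<close> to \<open>t\<close> at the first vertex after \<open>s\<close> and the last one before \<open>t\<close>. On a
  part of length \<open>h / N\<close> of a single segment, the increment is \<open>h\<close> times that of the segment, and
  \<open>h ^ 4 \<le> h\<^sup>2\<close>.\<close>

lemma polygon_fourth_moment: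
  fixes x :: "nat \<Rightarrow> 'a \<Rightarrow> real"
  assumes fin: "finite (set_pmf p)" and N: "0 < N" and c: "0 \<le> c"
    and mom: "\<And>i j. i \<le> j \<Longrightarrow> j \<le> N \<Longrightarrow>
       measure_pmf.expectation p (\<lambda>\<omega>. (x j \<omega> - x i \<omega>) ^ 4) \<le> c * (real (j - i) / real N)\<^sup>2"
    and st: "0 \<le> s" "s \<le> t" "t \<le> 1"
  shows "measure_pmf.expectation p
    (\<lambda>\<omega>. (polygon N (\<lambda>k. x k \<omega>) t - polygon N (\<lambda>k. x k \<omega>) s) ^ 4) \<le> 27 * c * (t - s)\<^sup>2"
proof (cases "s = t")
  case False
  let ?E = "measure_pmf.expectation p"
  have int [simp]: "integrable (measure_pmf p) f" for f :: "'a \<Rightarrow> real"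
    using fin by (rule integrable_measure_pmf_finite)
  obtain i f where s: "i < N" "0 \<le> f" "f \<le> 1" "s = (real i + f) / real N"
    using segment_cases[OF N, of s] st by auto
  obtain j g where t: "j < N" "0 \<le> g" "g \<le> 1" "t = (real j + g) / real N"
    using segment_cases[OF N, of t] st by auto
  have ts: "(t - s)\<^sup>2 = ((real j + g) - (real i + f))\<^sup>2 / (real N)\<^sup>2"
    unfolding s(4) t(4) by (simp add: power_divide diff_divide_distrib[symmetric])
  have lt: "real i + f < real j + g"
  proof -
    have "s < t" using st False by simp
    then have "(real i + f) / real N < (real j + g) / real N" using s(4) t(4) by metis
    then show ?thesis using N by (auto simp: divide_less_cancel)
  qed
  have step: "?E (\<lambda>\<omega>. (x (Suc k) \<omega> - x k \<omega>) ^ 4) \<le> c / (real N)\<^sup>2" if "k < N" for k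
    using mom[of k "Suc k"] that by (simp add: power_divide)
  have pow4: "h ^ 4 \<le> h\<^sup>2" if "0 \<le> h" "h \<le> 1" for h :: real
    using that by (intro power_decreasing) auto
  note poly_s = polygon_segment[OF s] and poly_t = polygon_segment[OF t]
  show ?thesis
  proof (cases "i = j")
    case True
    have "?E (\<lambda>\<omega>. (polygon N (\<lambda>k. x k \<omega>) t - polygon N (\<lambda>k. x k \<omega>) s) ^ 4)
        = ?E (\<lambda>\<omega>. (g - f) ^ 4 * (x (Suc j) \<omega> - x j \<omega>) ^ 4)"
      unfolding poly_s poly_t True power_mult_distrib[symmetric] by (simp add: algebra_simps)
    also have "\<dots> = (g - f) ^ 4 * ?E (\<lambda>\<omega>. (x (Suc j) \<omega> - x j \<omega>) ^ 4)" by simp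
    also have "\<dots> \<le> (g - f)\<^sup>2 * (c / (real N)\<^sup>2)"
      using lt s(2) t(3) True by (intro mult_mono pow4 step t) auto
    also have "\<dots> = c * (t - s)\<^sup>2" unfolding ts True by simp
    also have "\<dots> \<le> 27 * c * (t - s)\<^sup>2" using c by (intro mult_right_mono) auto
    finally show ?thesis .
  next
    case False
    then have ij: "Suc i \<le> j" using lt s t by linarith
    have "?E (\<lambda>\<omega>. (polygon N (\<lambda>k. x k \<omega>) t - polygon N (\<lambda>k. x k \<omega>) s) ^ 4)
       \<le> ?E (\<lambda>\<omega>. 27 * (g ^ 4 * (x (Suc j) \<omega> - x j \<omega>) ^ 4 + (x j \<omega> - x (Suc i) \<omega>) ^ 4
           + (1 - f) ^ 4 * (x (Suc i) \<omega> - x i \<omega>) ^ 4))"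
    proof (intro integral_mono int)
      fix \<omega>
      have "polygon N (\<lambda>k. x k \<omega>) t - polygon N (\<lambda>k. x k \<omega>) s =
        g * (x (Suc j) \<omega> - x j \<omega>) + (x j \<omega> - x (Suc i) \<omega>) + (1 - f) * (x (Suc i) \<omega> - x i \<omega>)"
        unfolding poly_s poly_t by (simp add: algebra_simps)
      then show "(polygon N (\<lambda>k. x k \<omega>) t - polygon N (\<lambda>k. x k \<omega>) s) ^ 4 \<le>
         27 * (g ^ 4 * (x (Suc j) \<omega> - x j \<omega>) ^ 4 + (x j \<omega> - x (Suc i) \<omega>) ^ 4 + (1 - f) ^ 4 * (x (Suc i) \<omega> - x i \<omega>) ^ 4)"
        unfolding power_mult_distrib[symmetric] by (simp only: sum3_fourth_power_le)
    qed
    also have "\<dots> = 27 * (g ^ 4 * ?E (\<lambda>\<omega>. (x (Suc j) \<omega> - x j \<omega>) ^ 4) + ?E (\<lambda>\<omega>. (x j \<omega> - x (Suc i) \<omega>) ^ 4)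
           + (1 - f) ^ 4 * ?E (\<lambda>\<omega>. (x (Suc i) \<omega> - x i \<omega>) ^ 4))"
      by simp
    also have "\<dots> \<le> 27 * (g\<^sup>2 * (c / (real N)\<^sup>2) + c * (real (j - Suc i) / real N)\<^sup>2 + (1 - f)\<^sup>2 * (c / (real N)\<^sup>2))"
      using s t ij by (intro mult_left_mono add_mono mult_mono pow4 step mom) auto
    also have "\<dots> = 27 * c / (real N)\<^sup>2 * (g\<^sup>2 + (real (j - Suc i))\<^sup>2 + (1 - f)\<^sup>2)"
      by (simp add: power_divide distrib_left add_divide_distrib mult_ac)
    also have "\<dots> \<le> 27 * c / (real N)\<^sup>2 * ((real j + g) - (real i + f))\<^sup>2"
    proof (intro mult_left_mono)
      have sq: "a\<^sup>2 + b\<^sup>2 + h\<^sup>2 \<le> (a + b + h)\<^sup>2" if "0 \<le> a" "0 \<le> b" "0 \<le> h" for a b h :: real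
        using that by (simp add: power2_eq_square algebra_simps)
      have gap: "(real j + g) - (real i + f) = g + real (j - Suc i) + (1 - f)" using ij by (simp add: of_nat_diff)
      show "g\<^sup>2 + (real (j - Suc i))\<^sup>2 + (1 - f)\<^sup>2 \<le> ((real j + g) - (real i + f))\<^sup>2"
        unfolding gap by (rule sq) (use s t in auto)
    qed (use c in simp)
    also have "\<dots> = 27 * c * (t - s)\<^sup>2" unfolding ts by simp
    finally show ?thesis .
  qed
qed (use c in simp)

definition fluct_path :: "nat \<Rightarrow> (nat \<Rightarrow> nat) \<Rightarrow> real \<Rightarrow>\<^sub>C real" where
  "fluct_path n u = polygon n (\<lambda>j. fluct n j u / sqrt (real n))"

lemma fluct_path_fourth_moment:
  assumes "0 \<le> s" "s \<le> t" "t \<le> 1"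
  shows "measure_pmf.expectation (random_map n) (\<lambda>u. (fluct_path n u t - fluct_path n u s) ^ 4) \<le> 378 * (t - s)\<^sup>2"
proof (cases "n = 0")
  case False
  have "measure_pmf.expectation (random_map n) (\<lambda>u. (fluct_path n u t - fluct_path n u s) ^ 4) \<le> 27 * 14 * (t - s)\<^sup>2"
    unfolding fluct_path_def
  proof (rule polygon_fourth_moment[OF finite_random_map])
    fix i j assume ij: "i \<le> j" "j \<le> n"
    have "sqrt (real n) ^ 4 = (real n)\<^sup>2" by (simp add: power4_eq_xxxx power2_eq_square)
    then have "measure_pmf.expectation (random_map n) (\<lambda>u. (fluct n j u / sqrt (real n) - fluct n i u / sqrt (real n)) ^ 4)
       = measure_pmf.expectation (random_map n) (\<lambda>u. (fluct n j u - fluct n i u) ^ 4) / (real n)\<^sup>2"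
      by (simp add: diff_divide_distrib[symmetric] power_divide)
    also have "\<dots> \<le> 14 * (real (j - i))\<^sup>2 / (real n)\<^sup>2"
      by (intro divide_right_mono fluct_fourth_moment ij) simp
    finally show "measure_pmf.expectation (random_map n) (\<lambda>u. (fluct n j u / sqrt (real n) - fluct n i u / sqrt (real n)) ^ 4)
       \<le> 14 * (real (j - i) / real n)\<^sup>2" by (simp add: power_divide)
  qed (use False assms in auto)
  then show ?thesis by simp
qed (use assms in \<open>simp add: fluct_path_def polygon_apply fluct_start\<close>)

text \<open>For \<open>s \<le> t\<close> this is \<open>s\<^sup>2 (1 - t)\<close>. The first factor is the proportion of those \<open>r\<close> that take part at
  both times, the second one the covariance of the indicators of \<open>U \<le> s\<close> and \<open>U \<le> t\<close> for \<open>U\<close> uniform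
  on \<open>[0,1]\<close>.\<close>

definition limit_cov :: "real \<Rightarrow> real \<Rightarrow> real" where
  "limit_cov s t = min s t * (min s t - s * t)"

text \<open>The linear combination is a sum over \<open>r\<close> of independent centred variables bounded by a constant
  times \<open>1 / sqrt n\<close>, whose total variance \<open>\<sigma> n\<close> converges.\<close>

lemma fluct_char_limit:
  assumes t: "\<And>k. k < d \<Longrightarrow> 0 \<le> t k" "\<And>k. k < d \<Longrightarrow> t k \<le> 1"
  defines "j \<equiv> \<lambda>n k. nat \<lfloor>real n * t k\<rfloor>"
  shows "(\<lambda>n. \<integral>u. iexp (\<Sum>k<d. \<theta> k * (fluct n (j n k) u / sqrt (real n))) \<partial>random_map n)
    \<longlonglongrightarrow> exp (- ((\<Sum>k<d. \<Sum>l<d. \<theta> k * \<theta> l * limit_cov (t k) (t l)) / 2))"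
proof -
  \<comment> \<open>The summands for the individual \<open>r\<close> are bounded by \<open>b n\<close>, and \<open>\<sigma> n\<close> is the sum of their variances.\<close>
  define \<Theta> where "\<Theta> = (\<Sum>k<d. \<bar>\<theta> k\<bar>)"
  define b where "b n = \<Theta> / sqrt (real n)" for n
  define m where "m n k l = min (j n k) (j n l)" for n k l
  define \<sigma> where "\<sigma> n = (\<Sum>k<d. \<Sum>l<d. \<theta> k * \<theta> l * ((real (m n k l - 1) / real n) *
     (real (m n k l) / real n - (real (j n k) / real n) * (real (j n l) / real n))))" for n
  define \<sigma>' where "\<sigma>' = (\<Sum>k<d. \<Sum>l<d. \<theta> k * \<theta> l * limit_cov (t k) (t l))"
  have jn: "j n k \<le> n" if "k < d" for n k
  proof -
    have "real n * t k \<le> real n" using mult_left_mono[OF t(2)[OF that], of "real n"] by simp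
    then have "\<lfloor>real n * t k\<rfloor> \<le> int n" by (simp add: floor_le_iff)
    then show ?thesis by (simp add: j_def)
  qed
  have bound: "cmod ((\<integral>u. iexp (\<Sum>k<d. \<theta> k * (fluct n (j n k) u / sqrt (real n))) \<partial>random_map n)
      - exp (- (\<sigma> n / 2))) \<le> (b n / 6 + (b n)\<^sup>2 / 8) * \<sigma> n" if n: "0 < n" for n
  proof -
    let ?E = "measure_pmf.expectation (random_map n)"
    define X where "X r v = (\<Sum>k<d. \<theta> k * (below n (j n k) r v / sqrt (real n)))" for r v
    have Xb: "\<bar>X r v\<bar> \<le> b n" for r v
    proof -
      have "\<bar>\<theta> k * (below n (j n k) r v / sqrt (real n))\<bar> \<le> \<bar>\<theta> k\<bar> / sqrt (real n)" if "k < d" for k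
      proof -
        have "real (j n k) / real n \<le> 1" "0 \<le> real (j n k) / real n" using jn[OF that, of n] n by auto
        then have "\<bar>below n (j n k) r v\<bar> \<le> 1" by (auto simp: below_def)
        then have "\<bar>\<theta> k\<bar> * \<bar>below n (j n k) r v\<bar> / sqrt (real n) \<le> \<bar>\<theta> k\<bar> * 1 / sqrt (real n)"
          by (intro divide_right_mono mult_left_mono) auto
        then show ?thesis by (simp add: abs_mult)
      qed
      then have "(\<Sum>k<d. \<bar>\<theta> k * (below n (j n k) r v / sqrt (real n))\<bar>) \<le> (\<Sum>k<d. \<bar>\<theta> k\<bar> / sqrt (real n))"
        by (intro sum_mono) auto
      moreover have "\<bar>X r v\<bar> \<le> (\<Sum>k<d. \<bar>\<theta> k * (below n (j n k) r v / sqrt (real n))\<bar>)" unfolding X_def by (rule sum_abs)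
      ultimately show ?thesis unfolding b_def \<Theta>_def by (simp add: sum_divide_distrib)
    qed
    have EX: "?E (\<lambda>u. X r (u r)) = 0" if r: "r \<in> {1<..n}" for r
    proof -
      have "?E (\<lambda>u. X r (u r)) = (\<Sum>k<d. ?E (\<lambda>u. \<theta> k * (below n (j n k) r (u r) / sqrt (real n))))"
        unfolding X_def by (rule Bochner_Integration.integral_sum) (rule integrable_random_map)
      also have "\<dots> = (\<Sum>k<d. 0)"
        using random_map_below[OF r] jn by (intro sum.cong refl) simp
      finally show ?thesis by simp
    qed
    have sum_X: "(\<Sum>r\<in>{1<..n}. X r (u r)) = (\<Sum>k<d. \<theta> k * (fluct n (j n k) u / sqrt (real n)))" for u
      unfolding X_def fluct_def sum_divide_distrib sum_distrib_left by (rule sum.swap)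
    have EX2: "?E (\<lambda>u. (X r (u r))\<^sup>2) = (\<Sum>k<d. \<Sum>l<d. \<theta> k * \<theta> l / real n * (of_bool (r \<le> m n k l) *
       (real (m n k l) / real n - real (j n k) * real (j n l) / (real n)\<^sup>2)))" if r: "r \<in> {1<..n}" for r
    proof -
      have "(X r v)\<^sup>2 = (\<Sum>k<d. \<Sum>l<d. \<theta> k * \<theta> l / real n * (below n (j n k) r v * below n (j n l) r v))" for v
        unfolding X_def power2_eq_square sum_product
        by (intro sum.cong refl) (simp add: mult_ac)
      then have "?E (\<lambda>u. (X r (u r))\<^sup>2) =
          ?E (\<lambda>u. \<Sum>k<d. \<Sum>l<d. \<theta> k * \<theta> l / real n * (below n (j n k) r (u r) * below n (j n l) r (u r)))" by simp
      also have "\<dots> = (\<Sum>k<d. \<Sum>l<d. ?E (\<lambda>u. \<theta> k * \<theta> l / real n * (below n (j n k) r (u r) * below n (j n l) r (u r))))"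
        by (subst Bochner_Integration.integral_sum[OF integrable_random_map])
           (intro sum.cong refl Bochner_Integration.integral_sum integrable_random_map)
      also have "\<dots> = (\<Sum>k<d. \<Sum>l<d. \<theta> k * \<theta> l / real n * ?E (\<lambda>u. below n (j n k) r (u r) * below n (j n l) r (u r)))"
        by simp
      also have "\<dots> = (\<Sum>k<d. \<Sum>l<d. \<theta> k * \<theta> l / real n * (of_bool (r \<le> m n k l) *
         (real (m n k l) / real n - real (j n k) * real (j n l) / (real n)\<^sup>2)))"
        using random_map_below_prod[OF r] jn unfolding m_def by (intro sum.cong refl) simp
      finally show ?thesis .
    qed
    have "(\<Sum>r\<in>{1<..n}. ?E (\<lambda>u. (X r (u r))\<^sup>2)) = (\<Sum>r\<in>{1<..n}. \<Sum>k<d. \<Sum>l<d. \<theta> k * \<theta> l / real n * (of_bool (r \<le> m n k l) *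
       (real (m n k l) / real n - real (j n k) * real (j n l) / (real n)\<^sup>2)))"
      by (intro sum.cong refl EX2)
    also have "\<dots> = (\<Sum>k<d. \<Sum>l<d. \<Sum>r\<in>{1<..n}. \<theta> k * \<theta> l / real n * (of_bool (r \<le> m n k l) *
       (real (m n k l) / real n - real (j n k) * real (j n l) / (real n)\<^sup>2)))"
      by (subst sum.swap, intro sum.cong refl sum.swap)
    also have "\<dots> = \<sigma> n"
      unfolding \<sigma>_def
    proof (intro sum.cong refl)
      fix k l assume "k \<in> {..<d}" "l \<in> {..<d}"
      then have "m n k l \<le> n" using jn[of k n] by (auto simp: m_def)
      then have "(\<Sum>r\<in>{1<..n}. of_bool (r \<le> m n k l) * c) = (\<Sum>r\<in>{1<..m n k l}. c)" for c :: real
        by (intro sum.mono_neutral_cong_right) auto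
      then have count: "(\<Sum>r\<in>{1<..n}. of_bool (r \<le> m n k l) * c) = real (m n k l - 1) * c" for c :: real
        by simp
      show "(\<Sum>r\<in>{1<..n}. \<theta> k * \<theta> l / real n * (of_bool (r \<le> m n k l) *
       (real (m n k l) / real n - real (j n k) * real (j n l) / (real n)\<^sup>2))) =
       \<theta> k * \<theta> l * ((real (m n k l - 1) / real n) *
         (real (m n k l) / real n - (real (j n k) / real n) * (real (j n l) / real n)))"
        unfolding sum_distrib_left[symmetric] count by (simp add: power2_eq_square)
    qed
    finally have EX2_sum: "(\<Sum>r\<in>{1<..n}. ?E (\<lambda>u. (X r (u r))\<^sup>2)) = \<sigma> n" .
    show ?thesis
      using prob_space.char_sum_bounded_centered[OF measure_pmf.prob_space_axioms _ random_map_indep[of n X], of "b n"] Xb EX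
      unfolding EX2_sum sum_X by simp
  qed
  have j_lim: "(\<lambda>n. real (j n k) / real n) \<longlonglongrightarrow> t k" if k: "k < d" for k
  proof (rule tendsto_sandwich[of "\<lambda>n. t k - 1 / real n" _ _ "\<lambda>_. t k"])
    have fl: "real (j n k) = of_int \<lfloor>real n * t k\<rfloor>" for n using t(1)[OF k] by (simp add: j_def)
    have "t k - 1 / real n \<le> real (j n k) / real n \<and> real (j n k) / real n \<le> t k" if "0 < n" for n
    proof -
      have "real n * t k - 1 \<le> real (j n k)" "real (j n k) \<le> real n * t k" unfolding fl by linarith+
      moreover have "t k - 1 / real n = (real n * t k - 1) / real n" using that by (simp add: diff_divide_distrib)
      ultimately show ?thesis using that by (simp add: divide_right_mono pos_divide_le_eq mult.commute)
    qed
    then have "\<forall>\<^sub>F n in sequentially. t k - 1 / real n \<le> real (j n k) / real n \<and> real (j n k) / real n \<le> t k"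
      by (intro eventually_sequentiallyI[of 1]) auto
    then show "\<forall>\<^sub>F n in sequentially. t k - 1 / real n \<le> real (j n k) / real n"
        "\<forall>\<^sub>F n in sequentially. real (j n k) / real n \<le> t k"
      by (auto elim: eventually_mono)
    have "(\<lambda>n. t k - 1 / real n) \<longlonglongrightarrow> t k - 0" by (intro tendsto_intros lim_1_over_n)
    then show "(\<lambda>n. t k - 1 / real n) \<longlonglongrightarrow> t k" by simp
  qed simp
  have m_lim: "(\<lambda>n. real (m n k l) / real n) \<longlonglongrightarrow> min (t k) (t l)" if "k < d" "l < d" for k l
  proof -
    have "real (m n k l) / real n = min (real (j n k) / real n) (real (j n l) / real n)" for n
      unfolding m_def by (simp add: min_def divide_le_cancel)
    then show ?thesis using that by (simp add: tendsto_min j_lim)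
  qed
  have m1_lim: "(\<lambda>n. real (m n k l - 1) / real n) \<longlonglongrightarrow> min (t k) (t l)" if "k < d" "l < d" for k l
  proof (rule tendsto_sandwich[OF _ _ _ m_lim[OF that]])
    show "\<forall>\<^sub>F n in sequentially. real (m n k l) / real n - 1 / real n \<le> real (m n k l - 1) / real n"
      by (intro always_eventually allI) (simp add: diff_divide_distrib[symmetric] divide_right_mono)
    show "\<forall>\<^sub>F n in sequentially. real (m n k l - 1) / real n \<le> real (m n k l) / real n"
      by (intro always_eventually allI divide_right_mono) auto
    have "(\<lambda>n. real (m n k l) / real n - 1 / real n) \<longlonglongrightarrow> min (t k) (t l) - 0"
      by (intro tendsto_intros m_lim that lim_1_over_n)
    then show "(\<lambda>n. real (m n k l) / real n - 1 / real n) \<longlonglongrightarrow> min (t k) (t l)" by simp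
  qed
  have s_lim: "\<sigma> \<longlonglongrightarrow> \<sigma>'"
    unfolding \<sigma>_def[abs_def] \<sigma>'_def limit_cov_def
    by (intro tendsto_sum tendsto_mult tendsto_diff tendsto_const m1_lim m_lim j_lim) auto
  have "(\<lambda>n. sqrt (1 / real n)) \<longlonglongrightarrow> sqrt 0" by (intro tendsto_intros lim_1_over_n)
  then have "(\<lambda>n. \<Theta> * sqrt (1 / real n)) \<longlonglongrightarrow> \<Theta> * 0" by (intro tendsto_intros) simp
  then have b_lim: "b \<longlonglongrightarrow> 0" by (simp add: b_def[abs_def] real_sqrt_divide)
  have "(\<lambda>n. (b n / 6 + (b n)\<^sup>2 / 8) * \<sigma> n) \<longlonglongrightarrow> (0 / 6 + 0\<^sup>2 / 8) * \<sigma>'"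
    by (intro tendsto_intros b_lim s_lim) auto
  then have err: "(\<lambda>n. (b n / 6 + (b n)\<^sup>2 / 8) * \<sigma> n) \<longlonglongrightarrow> 0" by simp
  have "(\<lambda>n. (\<integral>u. iexp (\<Sum>k<d. \<theta> k * (fluct n (j n k) u / sqrt (real n))) \<partial>random_map n)
      - complex_of_real (exp (- (\<sigma> n / 2)))) \<longlonglongrightarrow> 0"
    by (rule tendsto_norm_zero_cancel, rule tendsto_sandwich[OF _ _ tendsto_const err])
       (use bound in \<open>auto intro!: eventually_sequentiallyI[of 1]\<close>)
  moreover have "(\<lambda>n. complex_of_real (exp (- (\<sigma> n / 2)))) \<longlonglongrightarrow> complex_of_real (exp (- (\<sigma>' / 2)))"
    by (intro tendsto_intros s_lim) auto
  ultimately have "(\<lambda>n. (\<integral>u. iexp (\<Sum>k<d. \<theta> k * (fluct n (j n k) u / sqrt (real n))) \<partial>random_map n)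
      - complex_of_real (exp (- (\<sigma> n / 2))) + complex_of_real (exp (- (\<sigma> n / 2)))) \<longlonglongrightarrow> 0 + complex_of_real (exp (- (\<sigma>' / 2)))"
    by (rule tendsto_add)
  then show ?thesis unfolding \<sigma>'_def by simp
qed

text \<open>By the moment bound, interpolation changes the value at a fixed time by \<open>O(1 / sqrt n)\<close> in mean.\<close>

lemma fluct_path_char_limit:
  assumes t: "\<And>k. k < d \<Longrightarrow> 0 \<le> t k" "\<And>k. k < d \<Longrightarrow> t k \<le> 1"
  shows "(\<lambda>n. \<integral>u. iexp (\<Sum>k<d. \<theta> k * fluct_path n u (t k)) \<partial>random_map n)
    \<longlonglongrightarrow> exp (- ((\<Sum>k<d. \<Sum>l<d. \<theta> k * \<theta> l * limit_cov (t k) (t l)) / 2))"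
proof -
  define j where "j n k = nat \<lfloor>real n * t k\<rfloor>" for n k
  define A where "A n u = (\<Sum>k<d. \<theta> k * fluct_path n u (t k))" for n u
  define B where "B n u = (\<Sum>k<d. \<theta> k * (fluct n (j n k) u / sqrt (real n)))" for n u
  define \<Theta> where "\<Theta> = (\<Sum>k<d. \<bar>\<theta> k\<bar>)"
  have bound: "cmod ((\<integral>u. iexp (A n u) \<partial>random_map n) - (\<integral>u. iexp (B n u) \<partial>random_map n)) \<le> \<Theta> * (379 * sqrt (1 / real n))"
    if n: "0 < n" for n
  proof -
    let ?E = "measure_pmf.expectation (random_map n)"
    have intc: "integrable (measure_pmf (random_map n)) f" for f :: "(nat \<Rightarrow> nat) \<Rightarrow> complex"
      using finite_random_map by (rule integrable_measure_pmf_finite)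
    have lip: "cmod (iexp x - iexp y) \<le> \<bar>x - y\<bar>" for x y :: real
    proof -
      have "iexp x - iexp y = iexp y * (iexp (x - y) - 1)"
        by (simp add: algebra_simps exp_add[symmetric])
      then have "cmod (iexp x - iexp y) = cmod (iexp (x - y) - 1)" by (simp add: norm_mult)
      also have "\<dots> \<le> \<bar>x - y\<bar>" using iexp_approx1[of "x - y" 0] by simp
      finally show ?thesis .
    qed
    have near: "?E (\<lambda>u. \<bar>fluct_path n u (t k) - fluct n (j n k) u / sqrt (real n)\<bar>) \<le> 379 * sqrt (1 / real n)" if k: "k < d" for k
    proof -
      define e where "e = sqrt (1 / real n)"
      have e: "0 < e" "e\<^sup>2 = 1 / real n" using n by (auto simp: e_def)
      define s where "s = real (j n k) / real n"
      have "real n * t k \<le> real n" using mult_left_mono[OF t(2)[OF k], of "real n"] by simp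
      then have jn: "j n k \<le> n" by (simp add: j_def floor_le_iff nat_le_iff)
      have "real (j n k) = of_int \<lfloor>real n * t k\<rfloor>" using t(1)[OF k] by (simp add: j_def)
      then have "real (j n k) \<le> real n * t k" "real n * t k \<le> real (j n k) + 1" by linarith+
      moreover have "t k - s = (real n * t k - real (j n k)) / real n" using n by (simp add: s_def diff_divide_distrib)
      ultimately have s: "0 \<le> s" "s \<le> t k" "t k - s \<le> 1 / real n"
        using n by (simp_all add: s_def divide_right_mono pos_divide_le_eq mult.commute)
      have ps: "fluct_path n u s = fluct n (j n k) u / sqrt (real n)" for u
        unfolding fluct_path_def s_def using n jn by (intro polygon_vertex) auto
      let ?D = "\<lambda>u. fluct_path n u (t k) - fluct_path n u s"
      have "?E (\<lambda>u. \<bar>?D u\<bar>) \<le> ?E (\<lambda>u. e + ?D u ^ 4 / e ^ 3)"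
        by (intro integral_mono integrable_random_map abs_le_add_fourth_power e)
      also have "\<dots> = e + ?E (\<lambda>u. ?D u ^ 4) / e ^ 3"
        by (simp add: integrable_random_map)
      also have "?E (\<lambda>u. ?D u ^ 4) \<le> 378 * (t k - s)\<^sup>2" by (rule fluct_path_fourth_moment) (use s t[OF k] in auto)
      also have "\<dots> \<le> 378 * (1 / real n)\<^sup>2" using s by (intro mult_left_mono power_mono) auto
      also have "(1 / real n)\<^sup>2 = e ^ 4" unfolding e(2)[symmetric] by simp
      finally have "?E (\<lambda>u. \<bar>?D u\<bar>) \<le> e + 378 * e ^ 4 / e ^ 3" using e by (simp add: divide_right_mono)
      also have "378 * e ^ 4 / e ^ 3 = 378 * e" using e by (simp add: power4_eq_xxxx power3_eq_cube)
      finally show ?thesis unfolding ps e_def by simp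
    qed
    have "(\<integral>u. iexp (A n u) \<partial>random_map n) - (\<integral>u. iexp (B n u) \<partial>random_map n) = (\<integral>u. iexp (A n u) - iexp (B n u) \<partial>random_map n)"
      using intc by (subst Bochner_Integration.integral_diff) auto
    then have "cmod ((\<integral>u. iexp (A n u) \<partial>random_map n) - (\<integral>u. iexp (B n u) \<partial>random_map n)) \<le> ?E (\<lambda>u. cmod (iexp (A n u) - iexp (B n u)))"
      by (simp add: integral_norm_bound)
    also have "\<dots> \<le> ?E (\<lambda>u. \<Sum>k<d. \<bar>\<theta> k\<bar> * \<bar>fluct_path n u (t k) - fluct n (j n k) u / sqrt (real n)\<bar>)"
    proof (intro integral_mono integrable_random_map)
      fix u
      have "cmod (iexp (A n u) - iexp (B n u)) \<le> \<bar>A n u - B n u\<bar>" by (rule lip)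
      also have "A n u - B n u = (\<Sum>k<d. \<theta> k * (fluct_path n u (t k) - fluct n (j n k) u / sqrt (real n)))"
        unfolding A_def B_def by (simp add: sum_subtractf right_diff_distrib)
      also have "\<bar>\<dots>\<bar> \<le> (\<Sum>k<d. \<bar>\<theta> k * (fluct_path n u (t k) - fluct n (j n k) u / sqrt (real n))\<bar>)" by (rule sum_abs)
      finally show "cmod (iexp (A n u) - iexp (B n u)) \<le> (\<Sum>k<d. \<bar>\<theta> k\<bar> * \<bar>fluct_path n u (t k) - fluct n (j n k) u / sqrt (real n)\<bar>)"
        by (simp only: abs_mult)
    qed
    also have "\<dots> = (\<Sum>k<d. ?E (\<lambda>u. \<bar>\<theta> k\<bar> * \<bar>fluct_path n u (t k) - fluct n (j n k) u / sqrt (real n)\<bar>))"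
      by (rule Bochner_Integration.integral_sum[OF integrable_random_map])
    also have "\<dots> = (\<Sum>k<d. \<bar>\<theta> k\<bar> * ?E (\<lambda>u. \<bar>fluct_path n u (t k) - fluct n (j n k) u / sqrt (real n)\<bar>))"
      by simp
    also have "\<dots> \<le> (\<Sum>k<d. \<bar>\<theta> k\<bar> * (379 * sqrt (1 / real n)))"
      by (intro sum_mono mult_left_mono near) auto
    finally show ?thesis unfolding \<Theta>_def sum_distrib_right .
  qed
  have "(\<lambda>n. \<Theta> * (379 * sqrt (1 / real n))) \<longlonglongrightarrow> \<Theta> * (379 * sqrt 0)" by (intro tendsto_intros lim_1_over_n)
  then have err: "(\<lambda>n. \<Theta> * (379 * sqrt (1 / real n))) \<longlonglongrightarrow> 0" by simp
  have "(\<lambda>n. (\<integral>u. iexp (A n u) \<partial>random_map n) - (\<integral>u. iexp (B n u) \<partial>random_map n)) \<longlonglongrightarrow> 0"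
    by (rule tendsto_norm_zero_cancel, rule tendsto_sandwich[OF _ _ tendsto_const err])
       (use bound in \<open>auto intro!: eventually_sequentiallyI[of 1]\<close>)
  from tendsto_add[OF this fluct_char_limit[OF t, of d "\<lambda>k. k" \<theta>]]
  have "(\<lambda>n. (\<integral>u. iexp (A n u) \<partial>random_map n) - (\<integral>u. iexp (B n u) \<partial>random_map n) + (\<integral>u. iexp (B n u) \<partial>random_map n))
     \<longlonglongrightarrow> 0 + exp (- ((\<Sum>k<d. \<Sum>l<d. \<theta> k * \<theta> l * limit_cov (t k) (t l)) / 2))"
    unfolding B_def j_def by simp
  then show ?thesis unfolding A_def by simp
qed

section \<open>The limit process\<close>

text \<open>If \<open>t < 1\<close> is within \<open>2 ^ (- m)\<close> of \<open>1\<close>, then its dyadic rounding of level \<open>m\<close> is the dyadic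
  neighbour of \<open>1\<close>, so that chaining compares \<open>x t\<close> with \<open>x 1\<close>.\<close>

lemma continuous_at_endpoint_of_chaining:
  fixes x :: "real \<Rightarrow> real"
  assumes cont: "continuous_on {0..<1} x" and a: "summable a"
    and step: "\<And>k i. i < 2 ^ k \<Longrightarrow> \<bar>x (real (Suc i) / 2 ^ k) - x (real i / 2 ^ k)\<bar> \<le> a k"
  shows "continuous_on {0..1} x"
proof -
  define T where "T m = (\<Sum>k. a (k + m))" for m
  have T: "T \<longlonglongrightarrow> 0" unfolding T_def by (rule suminf_tail_tendsto_0[OF a])
  have near: "\<bar>x t - x 1\<bar> \<le> T m" if t: "1 - 1 / 2 ^ m \<le> t" "t < 1" for m t
  proof -
    have "(1::real) / 2 ^ m \<le> 1" by (simp add: divide_le_eq)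
    then have t0: "0 \<le> t" using t by linarith
    have "2 ^ m - 1 \<le> 2 ^ m * t" "2 ^ m * t < 2 ^ m"
      using t mult_left_mono[OF t(1), of "2 ^ m"] by (simp_all add: right_diff_distrib)
    then have "\<lfloor>2 ^ m * t\<rfloor> = 2 ^ m - 1" by (intro floor_unique) auto
    then have fl: "dyadic_floor m t = real (2 ^ m - 1) / 2 ^ m"
      by (simp add: dyadic_floor_def nat_diff_distrib nat_power_eq)
    have "\<bar>x t - x (dyadic_floor m t)\<bar> \<le> (\<Sum>k. a (k + Suc m))"
      by (rule chaining[OF cont a step t0 t(2)])
    moreover have "\<bar>x 1 - x (dyadic_floor m t)\<bar> \<le> a m"
      using step[of "2 ^ m - 1" m] unfolding fl by simp
    moreover have "T m = a m + (\<Sum>k. a (k + Suc m))"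
      unfolding T_def using suminf_split_head[of "\<lambda>k. a (k + m)"] a by (simp add: summable_iff_shift)
    ultimately show ?thesis by linarith
  qed
  have "(x \<longlongrightarrow> x 1) (at 1 within {0..1})"
  proof (rule tendstoI)
    fix e :: real assume "0 < e"
    from LIMSEQ_D[OF T this] obtain m where m: "norm (T m - 0) < e" by blast
    have "dist (x t) (x 1) < e" if "t \<in> {0..1}" "t \<noteq> 1" "dist t 1 < 1 / 2 ^ m" for t
    proof -
      have "\<bar>x t - x 1\<bar> \<le> T m" using that by (intro near) (auto simp: dist_real_def)
      then show ?thesis using m by (simp add: dist_real_def)
    qed
    then show "\<forall>\<^sub>F t in at 1 within {0..1}. dist (x t) (x 1) < e"
      unfolding eventually_at by (intro exI[of _ "1 / 2 ^ m"]) auto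
  qed
  moreover have "(x \<longlongrightarrow> x t) (at t within {0..1})" if t: "t \<in> {0..<1}" for t
  proof -
    have "(x \<longlongrightarrow> x t) (at t within {0..<1})" using cont t by (auto simp: continuous_on_def)
    moreover have "at t within {0..<1} = at t within {0..1}"
      using t by (intro at_within_nhd[of t "{..<1}"]) auto
    ultimately show ?thesis by simp
  qed
  ultimately show ?thesis
    unfolding continuous_on_def by (metis atLeastAtMost_iff atLeastLessThan_iff less_le)
qed

lemma char_normal:
  assumes M: "prob_space M" and D: "distributed M lborel X (normal_density 0 \<sigma>)" and \<sigma>: "0 < \<sigma>"
  shows "char (distr M borel (\<lambda>\<omega>. \<beta> * X \<omega>)) 1 = exp (- ((\<beta>\<^sup>2 * \<sigma>\<^sup>2) / 2))"
proof -
  interpret prob_space M by fact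
  have [measurable]: "X \<in> borel_measurable M" using distributed_measurable[OF D] by simp
  have "distributed M lborel (\<lambda>x. (X x - 0) / \<sigma>) std_normal_density"
    by (rule normal_standard_normal_convert[OF \<sigma>, THEN iffD1, OF D])
  then have "distr M lborel (\<lambda>x. X x / \<sigma>) = std_normal_distribution"
    by (simp add: distributed_distr_eq_density)
  then have std: "distr M borel (\<lambda>x. X x / \<sigma>) = std_normal_distribution"
    by (metis distr_cong sets_lborel)
  have "char (distr M borel (\<lambda>\<omega>. \<beta> * X \<omega>)) 1 = (\<integral>\<omega>. iexp (\<beta> * X \<omega>) \<partial>M)"
    by (simp add: char_def integral_distr)
  also have "\<dots> = (\<integral>\<omega>. iexp ((\<beta> * \<sigma>) * (X \<omega> / \<sigma>)) \<partial>M)" using \<sigma> by simp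
  also have "\<dots> = char (distr M borel (\<lambda>x. X x / \<sigma>)) (\<beta> * \<sigma>)"
    unfolding char_def by (subst integral_distr) auto
  also have "\<dots> = exp (- ((\<beta>\<^sup>2 * \<sigma>\<^sup>2) / 2))"
    unfolding std char_std_normal_distribution by (simp add: power_mult_distrib)
  finally show ?thesis .
qed

lemma Z_limit_1: "Z_limit W 1 \<omega> = 0"
  by (simp add: Z_limit_def)

context std_wiener_process
begin

lemma increment_measurable [measurable]: "0 \<le> t \<Longrightarrow> W t \<in> borel_measurable M"
  using W_measurable by simp

lemma increment_power_integrable:
  assumes "0 \<le> s" "s \<le> t"
  shows "integrable M (\<lambda>\<omega>. (W t \<omega> - W s \<omega>) ^ k)"
proof (cases "s = t")
  case False
  then have st: "s < t" using assms by simp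
  then show ?thesis
    using distributed_integrable[OF W_increment[OF assms(1) st], of "\<lambda>x. x ^ k"]
      integrable_normal_moment[of "sqrt (t - s)" 0 k] by simp
qed simp

lemma increment_moments:
  assumes "0 \<le> s" "s \<le> t"
  shows "expectation (\<lambda>\<omega>. W t \<omega> - W s \<omega>) = 0"
    and "expectation (\<lambda>\<omega>. (W t \<omega> - W s \<omega>)\<^sup>2) = t - s"
    and "expectation (\<lambda>\<omega>. (W t \<omega> - W s \<omega>) ^ 4) = 3 * (t - s)\<^sup>2"
proof -
  have "expectation (\<lambda>\<omega>. W t \<omega> - W s \<omega>) = 0 \<and> expectation (\<lambda>\<omega>. (W t \<omega> - W s \<omega>)\<^sup>2) = t - s \<and>
      expectation (\<lambda>\<omega>. (W t \<omega> - W s \<omega>) ^ 4) = 3 * (t - s)\<^sup>2"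
  proof (cases "s = t")
    case False
    then have st: "s < t" using assms by simp
    have E: "expectation (\<lambda>\<omega>. (W t \<omega> - W s \<omega>) ^ k) = (\<integral>x. normal_density 0 (sqrt (t - s)) x * x ^ k \<partial>lborel)" for k
      using distributed_integral[OF W_increment[OF assms(1) st], of "\<lambda>x. x ^ k"] by simp
    have "expectation (\<lambda>\<omega>. (W t \<omega> - W s \<omega>) ^ 1) = 0"
      unfolding E using integral_normal_moment_odd[of "sqrt (t - s)" 0 0] st by simp
    moreover have "expectation (\<lambda>\<omega>. (W t \<omega> - W s \<omega>) ^ 2) = t - s"
      unfolding E using integral_normal_moment_even[of "sqrt (t - s)" 0 1] st by simp
    moreover have "expectation (\<lambda>\<omega>. (W t \<omega> - W s \<omega>) ^ 4) = 3 * (t - s)\<^sup>2"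
      unfolding E using integral_normal_moment_even[of "sqrt (t - s)" 0 2] st
      by (simp add: fact_numeral power_divide)
    ultimately show ?thesis by simp
  qed simp
  then show "expectation (\<lambda>\<omega>. W t \<omega> - W s \<omega>) = 0"
    and "expectation (\<lambda>\<omega>. (W t \<omega> - W s \<omega>)\<^sup>2) = t - s"
    and "expectation (\<lambda>\<omega>. (W t \<omega> - W s \<omega>) ^ 4) = 3 * (t - s)\<^sup>2"
    by blast+
qed

lemma W_moments:
  assumes a: "0 \<le> a"
  shows "integrable M (\<lambda>\<omega>. W a \<omega> ^ k)" and "expectation (W a) = 0"
    and "expectation (\<lambda>\<omega>. (W a \<omega>)\<^sup>2) = a" and "expectation (\<lambda>\<omega>. W a \<omega> ^ 4) = 3 * a\<^sup>2"
proof -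
  have eq: "AE \<omega> in M. W a \<omega> ^ k = (W a \<omega> - W 0 \<omega>) ^ k" for k using W_start by eventually_elim simp
  have [measurable]: "W a \<in> borel_measurable M" "W 0 \<in> borel_measurable M" using a by auto
  have E: "expectation (\<lambda>\<omega>. W a \<omega> ^ k) = expectation (\<lambda>\<omega>. (W a \<omega> - W 0 \<omega>) ^ k)" for k
    by (rule integral_cong_AE) (use eq in auto)
  have "integrable M (\<lambda>\<omega>. W a \<omega> ^ k) \<longleftrightarrow> integrable M (\<lambda>\<omega>. (W a \<omega> - W 0 \<omega>) ^ k)"
    by (rule integrable_cong_AE) (use eq in auto)
  then show "integrable M (\<lambda>\<omega>. W a \<omega> ^ k)" using increment_power_integrable[of 0 a k] a by simp
  show "expectation (W a) = 0" using E[of 1] increment_moments[of 0 a] a by simp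
  show "expectation (\<lambda>\<omega>. (W a \<omega>)\<^sup>2) = a" "expectation (\<lambda>\<omega>. W a \<omega> ^ 4) = 3 * a\<^sup>2"
    using E[of 2] E[of 4] increment_moments[of 0 a] a by simp_all
qed

text \<open>Write the values of \<open>W\<close> as sums of increments: the coefficient of the \<open>i\<close>-th increment is
  \<open>\<beta> i = (\<Sum>k>i. \<alpha> k)\<close>, and the increments are independent and Gaussian.\<close>

lemma char_combination:
  assumes \<tau>0: "\<tau> 0 = 0" and \<tau>: "\<And>i. Suc i < N \<Longrightarrow> \<tau> i < \<tau> (Suc i)"
  shows "(\<integral>\<omega>. iexp (\<Sum>k<N. \<alpha> k * W (\<tau> k) \<omega>) \<partial>M) =
    exp (- ((\<Sum>k<N. \<Sum>l<N. \<alpha> k * \<alpha> l * \<tau> (min k l)) / 2))"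
proof -
  define D where "D i \<omega> = W (\<tau> (Suc i)) \<omega> - W (\<tau> i) \<omega>" for i \<omega>
  define \<delta> where "\<delta> i = \<tau> (Suc i) - \<tau> i" for i
  define \<beta> where "\<beta> i = (\<Sum>k<N. of_bool (i < k) * \<alpha> k)" for i
  have \<tau>_nonneg: "0 \<le> \<tau> i" if "i < N" for i
    using that
  proof (induction i)
    case (Suc i)
    then show ?case using \<tau>[of i] by simp
  qed (simp add: \<tau>0)
  have telescope: "f k - f 0 = (\<Sum>i<N - 1. of_bool (i < k) * (f (Suc i) - f i))" if "k < N" for k and f :: "nat \<Rightarrow> real"
  proof -
    have "(\<Sum>i<N - 1. of_bool (i < k) * (f (Suc i) - f i)) = (\<Sum>i<k. f (Suc i) - f i)"
      using that by (intro sum.mono_neutral_cong_right) auto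
    then show ?thesis by (simp add: sum_lessThan_telescope)
  qed
  have comb: "(\<Sum>k<N. \<alpha> k * (W (\<tau> k) \<omega> - W (\<tau> 0) \<omega>)) = (\<Sum>i<N - 1. \<beta> i * D i \<omega>)" for \<omega>
  proof -
    have "(\<Sum>k<N. \<alpha> k * (W (\<tau> k) \<omega> - W (\<tau> 0) \<omega>)) = (\<Sum>k<N. \<Sum>i<N - 1. \<alpha> k * (of_bool (i < k) * D i \<omega>))"
    proof (intro sum.cong refl)
      fix k assume "k \<in> {..<N}"
      then have "W (\<tau> k) \<omega> - W (\<tau> 0) \<omega> = (\<Sum>i<N - 1. of_bool (i < k) * D i \<omega>)"
        unfolding D_def using telescope[of k "\<lambda>i. W (\<tau> i) \<omega>"] by simp
      then show "\<alpha> k * (W (\<tau> k) \<omega> - W (\<tau> 0) \<omega>) = (\<Sum>i<N - 1. \<alpha> k * (of_bool (i < k) * D i \<omega>))"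
        by (simp only: sum_distrib_left)
    qed
    also have "\<dots> = (\<Sum>i<N - 1. \<Sum>k<N. \<alpha> k * (of_bool (i < k) * D i \<omega>))" by (rule sum.swap)
    also have "\<dots> = (\<Sum>i<N - 1. \<beta> i * D i \<omega>)"
      unfolding \<beta>_def sum_distrib_right by (intro sum.cong refl) simp
    finally show ?thesis .
  qed
  have indep: "indep_vars (\<lambda>_. borel) D {..<N - 1}"
    unfolding D_def[abs_def] by (rule W_indep) (use \<tau>0 \<tau> in auto)
  have indep': "indep_vars (\<lambda>_. borel) (\<lambda>i \<omega>. \<beta> i * D i \<omega>) {..<N - 1}"
    by (rule indep_vars_compose2[OF indep, where Y="\<lambda>i x. \<beta> i * x"]) auto
  have D_meas: "D i \<in> borel_measurable M" if "i < N - 1" for i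
    using indep that by (auto simp: indep_vars_def2)
  have "(\<integral>\<omega>. iexp (\<Sum>k<N. \<alpha> k * W (\<tau> k) \<omega>) \<partial>M) = (\<integral>\<omega>. iexp (\<Sum>i<N - 1. \<beta> i * D i \<omega>) \<partial>M)"
  proof (rule integral_cong_AE)
    show "AE \<omega> in M. iexp (\<Sum>k<N. \<alpha> k * W (\<tau> k) \<omega>) = iexp (\<Sum>i<N - 1. \<beta> i * D i \<omega>)"
      using W_start
    proof eventually_elim
      case (elim \<omega>)
      then have "(\<Sum>k<N. \<alpha> k * W (\<tau> k) \<omega>) = (\<Sum>i<N - 1. \<beta> i * D i \<omega>)"
        using comb[of \<omega>] by (simp add: \<tau>0)
      then show ?case by (simp only:)
    qed
    have "(\<lambda>\<omega>. \<Sum>k<N. \<alpha> k * W (\<tau> k) \<omega>) \<in> borel_measurable M"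
      using \<tau>_nonneg by (intro borel_measurable_sum borel_measurable_times borel_measurable_const increment_measurable) auto
    then show "(\<lambda>\<omega>. iexp (\<Sum>k<N. \<alpha> k * W (\<tau> k) \<omega>)) \<in> borel_measurable M" by measurable
    have "(\<lambda>\<omega>. \<Sum>i<N - 1. \<beta> i * D i \<omega>) \<in> borel_measurable M"
      using D_meas by (intro borel_measurable_sum borel_measurable_times borel_measurable_const) auto
    then show "(\<lambda>\<omega>. iexp (\<Sum>i<N - 1. \<beta> i * D i \<omega>)) \<in> borel_measurable M" by measurable
  qed
  also have "\<dots> = char (distr M borel (\<lambda>\<omega>. \<Sum>i<N - 1. \<beta> i * D i \<omega>)) 1"
    using D_meas by (simp add: char_def integral_distr)
  also have "\<dots> = (\<Prod>i<N - 1. char (distr M borel (\<lambda>\<omega>. \<beta> i * D i \<omega>)) 1)"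
    by (rule char_distr_sum[OF indep'])
  also have "\<dots> = (\<Prod>i<N - 1. complex_of_real (exp (- (((\<beta> i)\<^sup>2 * \<delta> i) / 2))))"
  proof (intro prod.cong refl)
    fix i assume "i \<in> {..<N - 1}"
    then have i: "Suc i < N" by auto
    have "distributed M lborel (D i) (normal_density 0 (sqrt (\<tau> (Suc i) - \<tau> i)))"
      unfolding D_def[abs_def] using \<tau>_nonneg[of i] \<tau>[OF i] i by (intro W_increment) auto
    then show "char (distr M borel (\<lambda>\<omega>. \<beta> i * D i \<omega>)) 1 = complex_of_real (exp (- (((\<beta> i)\<^sup>2 * \<delta> i) / 2)))"
      using char_normal[OF prob_space_axioms, of "D i" "sqrt (\<tau> (Suc i) - \<tau> i)" "\<beta> i"] \<tau>[OF i] by (simp add: \<delta>_def)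
  qed
  also have "\<dots> = complex_of_real (exp (- ((\<Sum>i<N - 1. (\<beta> i)\<^sup>2 * \<delta> i) / 2)))"
    by (simp only: of_real_prod[symmetric] exp_sum[OF finite_lessThan, symmetric] sum_negf sum_divide_distrib)
  also have "(\<Sum>i<N - 1. (\<beta> i)\<^sup>2 * \<delta> i) = (\<Sum>k<N. \<Sum>l<N. \<alpha> k * \<alpha> l * \<tau> (min k l))"
  proof -
    have "(\<Sum>i<N - 1. (\<beta> i)\<^sup>2 * \<delta> i) = (\<Sum>i<N - 1. \<Sum>k<N. \<Sum>l<N. \<alpha> k * \<alpha> l * (of_bool (i < min k l) * \<delta> i))"
      unfolding \<beta>_def power2_eq_square sum_product
      unfolding sum_distrib_right by (intro sum.cong refl) simp
    also have "\<dots> = (\<Sum>k<N. \<Sum>l<N. \<Sum>i<N - 1. \<alpha> k * \<alpha> l * (of_bool (i < min k l) * \<delta> i))"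
      by (rule trans[OF sum.swap], rule sum.cong[OF refl], rule sum.swap)
    also have "\<dots> = (\<Sum>k<N. \<Sum>l<N. \<alpha> k * \<alpha> l * \<tau> (min k l))"
    proof (intro sum.cong refl)
      fix k l assume "k \<in> {..<N}" "l \<in> {..<N}"
      then have "\<tau> (min k l) = (\<Sum>i<N - 1. of_bool (i < min k l) * \<delta> i)"
        using telescope[of "min k l" \<tau>] \<tau>0 by (simp add: \<delta>_def)
      then show "(\<Sum>i<N - 1. \<alpha> k * \<alpha> l * (of_bool (i < min k l) * \<delta> i)) = \<alpha> k * \<alpha> l * \<tau> (min k l)"
        by (simp only: sum_distrib_left)
    qed
    finally show ?thesis .
  qed
  finally show ?thesis .
qed

end

lemma time_change_mono:
  assumes "0 \<le> s" "s < t" "t < (1::real)"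
  shows "s\<^sup>2 / (1 - s) < t\<^sup>2 / (1 - t)"
  using assms by (intro frac_less power_strict_mono) (auto intro: zero_le_power)

lemma sum2_fourth_power_le: "(a + b) ^ 4 \<le> 8 * (a ^ 4 + b ^ 4)" for a b :: real
proof -
  have sq: "(x + y)\<^sup>2 \<le> 2 * (x\<^sup>2 + y\<^sup>2)" for x y :: real
    using zero_le_power2[of "x - y"] by (simp add: power2_eq_square algebra_simps)
  have "(a + b) ^ 4 = ((a + b)\<^sup>2)\<^sup>2" by simp
  also have "\<dots> \<le> (2 * (a\<^sup>2 + b\<^sup>2))\<^sup>2" by (intro power_mono sq) simp
  also have "\<dots> = 4 * (a\<^sup>2 + b\<^sup>2)\<^sup>2" by (subst power_mult_distrib) simp
  also have "\<dots> \<le> 4 * (2 * ((a\<^sup>2)\<^sup>2 + (b\<^sup>2)\<^sup>2))" by (intro mult_left_mono sq) simp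
  finally show ?thesis by simp
qed

context std_wiener_process
begin

lemma Z_limit_eq: "t < 1 \<Longrightarrow> Z_limit W t \<omega> = (1 - t) * W (t\<^sup>2 / (1 - t)) \<omega>"
  by (simp add: Z_limit_def)

lemma Z_limit_measurable:
  assumes "0 \<le> t" "t \<le> 1"
  shows "Z_limit W t \<in> borel_measurable M"
proof (cases "t = 1")
  case False
  then have "t < 1" using assms by simp
  then have "Z_limit W t = (\<lambda>\<omega>. (1 - t) * W (t\<^sup>2 / (1 - t)) \<omega>)" by (simp add: Z_limit_def fun_eq_iff)
  moreover have "W (t\<^sup>2 / (1 - t)) \<in> borel_measurable M" using \<open>t < 1\<close> by simp
  ultimately show ?thesis by simp
next
  case True
  then have "Z_limit W t = (\<lambda>\<omega>. 0)" by (simp add: Z_limit_def fun_eq_iff)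
  then show ?thesis by simp
qed

lemma Z_limit_moments:
  assumes t: "0 \<le> t" "t \<le> 1"
  shows "integrable M (\<lambda>\<omega>. Z_limit W t \<omega> ^ k)" and "expectation (Z_limit W t) = 0"
    and "expectation (\<lambda>\<omega>. (Z_limit W t \<omega>)\<^sup>2) = t\<^sup>2 * (1 - t)"
proof -
  have "integrable M (\<lambda>\<omega>. Z_limit W t \<omega> ^ k) \<and> expectation (Z_limit W t) = 0 \<and>
      expectation (\<lambda>\<omega>. (Z_limit W t \<omega>)\<^sup>2) = t\<^sup>2 * (1 - t)"
  proof (cases "t = 1")
    case False
    then have t1: "t < 1" using t by simp
    have a: "0 \<le> t\<^sup>2 / (1 - t)" using t1 by simp
    have "(1 - t)\<^sup>2 * (t\<^sup>2 / (1 - t)) = t\<^sup>2 * (1 - t)" using t1 by (simp add: power2_eq_square)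
    moreover have "Z_limit W t = (\<lambda>\<omega>. (1 - t) * W (t\<^sup>2 / (1 - t)) \<omega>)"
      using t1 by (simp add: fun_eq_iff Z_limit_eq)
    ultimately show ?thesis
      using W_moments[OF a] by (simp add: power_mult_distrib)
  next
    case True
    then have "Z_limit W t = (\<lambda>\<omega>. 0)" by (simp add: fun_eq_iff Z_limit_1)
    then show ?thesis using True by (cases k) simp_all
  qed
  then show "integrable M (\<lambda>\<omega>. Z_limit W t \<omega> ^ k)" "expectation (Z_limit W t) = 0"
    "expectation (\<lambda>\<omega>. (Z_limit W t \<omega>)\<^sup>2) = t\<^sup>2 * (1 - t)" by blast+
qed

text \<open>By polarization, \<open>2 W\<^sub>a W\<^sub>b = W\<^sub>a\<^sup>2 + W\<^sub>b\<^sup>2 - (W\<^sub>b - W\<^sub>a)\<^sup>2\<close>, the variances of increments suffice.\<close>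

lemma Z_limit_covariance:
  assumes st: "0 \<le> s" "s < t" "t \<le> 1"
  shows "covariance M (Z_limit W s) (Z_limit W t) = s\<^sup>2 * (1 - t)"
proof -
  have "expectation (Z_limit W s) = 0" "expectation (Z_limit W t) = 0"
    using Z_limit_moments(2) st by auto
  then have cov: "covariance M (Z_limit W s) (Z_limit W t) = expectation (\<lambda>\<omega>. Z_limit W s \<omega> * Z_limit W t \<omega>)"
    by (simp add: covariance_def)
  show ?thesis
  proof (cases "t = 1")
    case True
    then show ?thesis unfolding cov by (simp add: Z_limit_def)
  next
    case False
    then have t1: "t < 1" "s < 1" using st by auto
    define a where "a = s\<^sup>2 / (1 - s)"
    define b where "b = t\<^sup>2 / (1 - t)"
    have ab: "0 \<le> a" "a \<le> b" "0 \<le> b" using time_change_mono[OF st(1,2) t1(1)] t1 by (auto simp: a_def b_def)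
    have i: "integrable M (\<lambda>\<omega>. (W a \<omega>)\<^sup>2)" "integrable M (\<lambda>\<omega>. (W b \<omega>)\<^sup>2)" "integrable M (\<lambda>\<omega>. (W b \<omega> - W a \<omega>)\<^sup>2)"
      using W_moments(1) increment_power_integrable ab by auto
    have "Z_limit W s \<omega> * Z_limit W t \<omega> =
      (1 - s) * (1 - t) / 2 * ((W a \<omega>)\<^sup>2 + (W b \<omega>)\<^sup>2 - (W b \<omega> - W a \<omega>)\<^sup>2)" for \<omega>
      using t1 by (simp add: Z_limit_def a_def b_def power2_eq_square algebra_simps)
    then have "expectation (\<lambda>\<omega>. Z_limit W s \<omega> * Z_limit W t \<omega>) =
      expectation (\<lambda>\<omega>. (1 - s) * (1 - t) / 2 * ((W a \<omega>)\<^sup>2 + (W b \<omega>)\<^sup>2 - (W b \<omega> - W a \<omega>)\<^sup>2))"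
      by (simp only:)
    also have "\<dots> =
      (1 - s) * (1 - t) / 2 * (expectation (\<lambda>\<omega>. (W a \<omega>)\<^sup>2) + expectation (\<lambda>\<omega>. (W b \<omega>)\<^sup>2) - expectation (\<lambda>\<omega>. (W b \<omega> - W a \<omega>)\<^sup>2))"
      using i by simp
    also have "\<dots> = (1 - s) * (1 - t) / 2 * (a + b - (b - a))"
      using W_moments(3)[OF ab(1)] W_moments(3)[OF ab(3)] increment_moments(2)[OF ab(1,2)] by simp
    also have "\<dots> = s\<^sup>2 * (1 - t)" using t1 by (simp add: a_def)
    finally show ?thesis unfolding cov .
  qed
qed

text \<open>For \<open>a = s\<^sup>2 / (1 - s)\<close> and \<open>b = t\<^sup>2 / (1 - t)\<close> the increment is
  \<open>(1 - t) (W\<^sub>b - W\<^sub>a) + (s - t) W\<^sub>a\<close>. The variances \<open>(1 - t)\<^sup>2 (b - a)\<close> and \<open>(t - s)\<^sup>2 a\<close> of the two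
  Gaussian summands are at most \<open>2 (t - s)\<close> and \<open>t - s\<close>, and the fourth moment of a centred Gaussian
  variable is three times the square of its variance.\<close>

lemma Z_limit_fourth_moment:
  assumes st: "0 \<le> s" "s \<le> t" "t \<le> 1"
  shows "integrable M (\<lambda>\<omega>. (Z_limit W t \<omega> - Z_limit W s \<omega>) ^ 4)"
    and "expectation (\<lambda>\<omega>. (Z_limit W t \<omega> - Z_limit W s \<omega>) ^ 4) \<le> 120 * (t - s)\<^sup>2"
proof -
  have meas: "(\<lambda>\<omega>. (Z_limit W t \<omega> - Z_limit W s \<omega>) ^ 4) \<in> borel_measurable M"
    using Z_limit_measurable[of s] Z_limit_measurable[of t] st by simp
  have "integrable M (\<lambda>\<omega>. (Z_limit W t \<omega> - Z_limit W s \<omega>) ^ 4) \<and>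
    expectation (\<lambda>\<omega>. (Z_limit W t \<omega> - Z_limit W s \<omega>) ^ 4) \<le> 120 * (t - s)\<^sup>2"
  proof (cases "s = 1")
    case True
    then have "t = 1" using st by simp
    then show ?thesis using True by simp
  next
    case s1: False
    then have s1: "s < 1" using st by simp
    define a where "a = s\<^sup>2 / (1 - s)"
    have a: "0 \<le> a" using s1 by (simp add: a_def)
    show ?thesis
    proof (cases "t = 1")
      case True
      have "(Z_limit W t \<omega> - Z_limit W s \<omega>) ^ 4 = (1 - s) ^ 4 * W a \<omega> ^ 4" for \<omega>
        using True s1 by (simp add: Z_limit_def a_def power_mult_distrib)
      moreover have "(1 - s) ^ 4 * (3 * a\<^sup>2) \<le> 120 * (1 - s)\<^sup>2"
      proof -
        have "(1 - s)\<^sup>2 * a = (1 - s) * s\<^sup>2" using s1 by (simp add: a_def power2_eq_square)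
        then have "((1 - s)\<^sup>2 * a)\<^sup>2 = ((1 - s) * s\<^sup>2)\<^sup>2" by simp
        moreover have "((1 - s)\<^sup>2 * a)\<^sup>2 = (1 - s) ^ 4 * a\<^sup>2" by (simp add: power_mult_distrib)
        moreover have "((1 - s) * s\<^sup>2)\<^sup>2 \<le> ((1 - s) * 1)\<^sup>2"
          using st s1 by (intro power_mono mult_left_mono power_le_one) auto
        ultimately have "(1 - s) ^ 4 * a\<^sup>2 \<le> (1 - s)\<^sup>2" by simp
        moreover have "(1 - s) ^ 4 * (3 * a\<^sup>2) = 3 * ((1 - s) ^ 4 * a\<^sup>2)" by simp
        ultimately show ?thesis using zero_le_power2[of "1 - s"] by linarith
      qed
      ultimately show ?thesis using W_moments[OF a] True by simp
    next
      case False
      then have t1: "t < 1" using st by simp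
      define b where "b = t\<^sup>2 / (1 - t)"
      have ab: "a \<le> b"
        using time_change_mono[of s t] st t1 by (cases "s = t") (auto simp: a_def b_def)
      define p where "p \<omega> = (1 - t) * (W b \<omega> - W a \<omega>)" for \<omega>
      define q where "q \<omega> = (s - t) * W a \<omega>" for \<omega>
      have eq: "Z_limit W t \<omega> - Z_limit W s \<omega> = p \<omega> + q \<omega>" for \<omega>
        using t1 s1 by (simp add: Z_limit_def a_def b_def p_def q_def algebra_simps)
      have le: "(Z_limit W t \<omega> - Z_limit W s \<omega>) ^ 4 \<le> 8 * (p \<omega> ^ 4 + q \<omega> ^ 4)" for \<omega>
        unfolding eq by (rule sum2_fourth_power_le)
      have ip: "integrable M (\<lambda>\<omega>. p \<omega> ^ 4)" and iq: "integrable M (\<lambda>\<omega>. q \<omega> ^ 4)"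
        using increment_power_integrable[OF a ab, of 4] W_moments(1)[OF a, of 4]
        by (simp_all add: p_def q_def power_mult_distrib)
      have Ep: "expectation (\<lambda>\<omega>. p \<omega> ^ 4) = 3 * ((1 - t)\<^sup>2 * (b - a))\<^sup>2"
        using increment_moments(3)[OF a ab] by (simp add: p_def power_mult_distrib)
      have Eq: "expectation (\<lambda>\<omega>. q \<omega> ^ 4) = 3 * ((t - s)\<^sup>2 * a)\<^sup>2"
      proof -
        have "(s - t) ^ 4 = ((t - s)\<^sup>2)\<^sup>2" by (simp add: power2_commute[of s t] flip: power_mult) (simp add: power4_eq_xxxx algebra_simps)
        then show ?thesis using W_moments(4)[OF a] by (simp add: q_def power_mult_distrib)
      qed
      have "b - a = (t - s) * (t + s - t * s) / ((1 - t) * (1 - s))"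
        using t1 s1 by (simp add: a_def b_def diff_frac_eq power2_eq_square algebra_simps)
      then have "(1 - t)\<^sup>2 * (b - a) = (t - s) * (t + s - t * s) * ((1 - t) / (1 - s))"
        using t1 s1 by (simp add: power2_eq_square)
      also have "\<dots> \<le> (t - s) * 2 * 1"
      proof -
        have "0 \<le> t * s" using st by simp
        then have "t + s - t * s \<le> 2" using st by linarith
        moreover have "t * s \<le> t * 1" using st by (intro mult_left_mono) auto
        then have "0 \<le> t + s - t * s" using st by linarith
        ultimately show ?thesis using st t1 s1 by (intro mult_mono) (auto simp: divide_le_eq)
      qed
      finally have "((1 - t)\<^sup>2 * (b - a))\<^sup>2 \<le> ((t - s) * 2)\<^sup>2"
        using ab by (intro power_mono) auto
      moreover have "((t - s) * 2)\<^sup>2 = 4 * (t - s)\<^sup>2" by (subst power_mult_distrib) simp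
      ultimately have 1: "((1 - t)\<^sup>2 * (b - a))\<^sup>2 \<le> 4 * (t - s)\<^sup>2" by (simp only:)
      have "(t - s)\<^sup>2 * a = (t - s) * (((t - s) / (1 - s)) * s\<^sup>2)" by (simp add: a_def power2_eq_square)
      also have "\<dots> \<le> (t - s) * (1 * 1)"
        using st s1 by (intro mult_left_mono mult_mono power_le_one) (auto simp: divide_le_eq)
      finally have 2: "((t - s)\<^sup>2 * a)\<^sup>2 \<le> (t - s)\<^sup>2"
        using a by (intro power_mono) auto
      have "integrable M (\<lambda>\<omega>. (Z_limit W t \<omega> - Z_limit W s \<omega>) ^ 4)"
      proof (rule Bochner_Integration.integrable_bound[OF _ meas])
        show "integrable M (\<lambda>\<omega>. 8 * (p \<omega> ^ 4 + q \<omega> ^ 4))" using ip iq by simp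
        show "AE \<omega> in M. norm ((Z_limit W t \<omega> - Z_limit W s \<omega>) ^ 4) \<le> norm (8 * (p \<omega> ^ 4 + q \<omega> ^ 4))"
          using le by (intro AE_I2) simp
      qed
      moreover have "expectation (\<lambda>\<omega>. (Z_limit W t \<omega> - Z_limit W s \<omega>) ^ 4) \<le> expectation (\<lambda>\<omega>. 8 * (p \<omega> ^ 4 + q \<omega> ^ 4))"
        using ip iq calculation by (intro integral_mono le) auto
      then have "expectation (\<lambda>\<omega>. (Z_limit W t \<omega> - Z_limit W s \<omega>) ^ 4) \<le>
          24 * ((1 - t)\<^sup>2 * (b - a))\<^sup>2 + 24 * ((t - s)\<^sup>2 * a)\<^sup>2"
        using ip iq Ep Eq by simp
      then have "expectation (\<lambda>\<omega>. (Z_limit W t \<omega> - Z_limit W s \<omega>) ^ 4) \<le> 120 * (t - s)\<^sup>2"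
        using 1 2 by linarith
      ultimately show ?thesis by simp
    qed
  qed
  then show "integrable M (\<lambda>\<omega>. (Z_limit W t \<omega> - Z_limit W s \<omega>) ^ 4)"
    "expectation (\<lambda>\<omega>. (Z_limit W t \<omega> - Z_limit W s \<omega>) ^ 4) \<le> 120 * (t - s)\<^sup>2" by blast+
qed

lemma Z_limit_kolmogorov: "kolmogorov_condition M (Z_limit W) 120"
  unfolding kolmogorov_condition_def using Z_limit_fourth_moment by blast

text \<open>The factors \<open>1 - t\<close> turn the covariance \<open>min a b\<close> of \<open>W\<close> at the changed times into the limit
  covariance. The last grid point is \<open>t = 1\<close>, where the process and the covariance vanish.\<close>

lemma Z_limit_char:
  "(\<integral>\<omega>. iexp (\<Sum>k<Suc (2 ^ m). \<theta> k * Z_limit W (real k / 2 ^ m) \<omega>) \<partial>M) =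
    exp (- ((\<Sum>k<Suc (2 ^ m). \<Sum>l<Suc (2 ^ m). \<theta> k * \<theta> l * limit_cov (real k / 2 ^ m) (real l / 2 ^ m)) / 2))"
proof -
  define N :: nat where "N = 2 ^ m"
  define t where "t k = real k / 2 ^ m" for k
  define \<tau> where "\<tau> k = (t k)\<^sup>2 / (1 - t k)" for k
  define \<alpha> where "\<alpha> k = \<theta> k * (1 - t k)" for k
  have t01: "0 \<le> t k" "t k < 1" if "k < N" for k
  proof -
    have "real k < real N" using that by simp
    then show "0 \<le> t k" "t k < 1" by (simp_all add: t_def N_def)
  qed
  have tN: "t N = 1" by (simp add: t_def N_def)
  have t_mono: "t k \<le> t l" if "k \<le> l" for k l using that by (simp add: t_def divide_right_mono)
  have t_le: "t k \<le> 1" if "k \<le> N" for k using t_mono[OF that] tN by simp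
  have tau: "\<tau> i < \<tau> (Suc i)" if "Suc i < N" for i
    unfolding \<tau>_def using t01[of i] t01[OF that] that
    by (intro time_change_mono) (auto simp: t_def divide_strict_right_mono)
  have "(\<Sum>k<Suc N. \<theta> k * Z_limit W (t k) \<omega>) = (\<Sum>k<N. \<alpha> k * W (\<tau> k) \<omega>)" for \<omega>
  proof -
    have "(\<Sum>k<N. \<theta> k * Z_limit W (t k) \<omega>) = (\<Sum>k<N. \<alpha> k * W (\<tau> k) \<omega>)"
      using t01 by (intro sum.cong refl) (simp add: Z_limit_eq \<alpha>_def \<tau>_def)
    then show ?thesis by (simp add: tN Z_limit_1)
  qed
  then have "(\<integral>\<omega>. iexp (\<Sum>k<Suc N. \<theta> k * Z_limit W (t k) \<omega>) \<partial>M) = (\<integral>\<omega>. iexp (\<Sum>k<N. \<alpha> k * W (\<tau> k) \<omega>) \<partial>M)"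
    by (simp only:)
  also have "\<dots> = exp (- ((\<Sum>k<N. \<Sum>l<N. \<alpha> k * \<alpha> l * \<tau> (min k l)) / 2))"
    using tau by (intro char_combination) (auto simp: \<tau>_def t_def)
  also have "(\<Sum>k<N. \<Sum>l<N. \<alpha> k * \<alpha> l * \<tau> (min k l)) = (\<Sum>k<N. \<Sum>l<N. \<theta> k * \<theta> l * limit_cov (t k) (t l))"
  proof -
    have *: "(1 - t k) * (1 - t l) * \<tau> (min k l) = limit_cov (t k) (t l)" if "k < N" "l < N" "k \<le> l" for k l
    proof -
      have "(1 - t k) * (1 - t l) * \<tau> k = (1 - t l) * (t k)\<^sup>2"
        using t01[OF that(1)] by (simp add: \<tau>_def)
      then show ?thesis
        using that t_mono[OF that(3)] by (simp add: limit_cov_def power2_eq_square algebra_simps)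
    qed
    have "(1 - t k) * (1 - t l) * \<tau> (min k l) = limit_cov (t k) (t l)" if "k < N" "l < N" for k l
      using *[of k l] *[of l k] that by (cases "k \<le> l") (auto simp: limit_cov_def min.commute mult.commute)
    then have "\<alpha> k * \<alpha> l * \<tau> (min k l) = \<theta> k * \<theta> l * limit_cov (t k) (t l)" if "k < N" "l < N" for k l
      using that by (simp add: \<alpha>_def) (metis (no_types, lifting) mult.assoc mult.left_commute)
    then show ?thesis by (intro sum.cong refl) auto
  qed
  also have "\<dots> = (\<Sum>k<Suc N. \<Sum>l<Suc N. \<theta> k * \<theta> l * limit_cov (t k) (t l))"
  proof -
    have "limit_cov (t k) 1 = 0" "limit_cov 1 (t k) = 0" if "k \<le> N" for k
      using t_le[OF that] by (simp_all add: limit_cov_def)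
    then show ?thesis by (simp add: tN)
  qed
  finally show ?thesis unfolding N_def t_def .
qed

text \<open>Outside a null set the path of the limit process is continuous on \<open>[0,1)\<close> because \<open>W\<close> is, and at \<open>1\<close>
  by chaining; on the null set the version is \<open>0\<close>. It is measurable as a limit of polygons, which are
  continuous functions of finitely many random variables.\<close>

lemma Z_limit_version:
  obtains Y :: "'a \<Rightarrow> real \<Rightarrow>\<^sub>C real" where "Y \<in> borel_measurable M"
    "\<And>\<omega> t. Y \<omega> (clamp01 t) = Y \<omega> t" "\<And>\<omega>. Y \<omega> 0 = 0"
    "AE \<omega> in M. \<forall>t\<in>{0..1}. Y \<omega> t = Z_limit W t \<omega>"
proof -
  let ?c = "\<lambda>\<omega>. chain_bound (\<lambda>t. Z_limit W t \<omega>)"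
  have "AE \<omega> in M. summable (?c \<omega>)"
    by (rule chain_bound_tail(1)[OF prob_space_axioms Z_limit_kolmogorov])
  with W_start W_continuous have "AE \<omega> in M. W 0 \<omega> = 0 \<and> continuous_on {0..} (\<lambda>t. W t \<omega>) \<and> summable (?c \<omega>)"
    by eventually_elim simp
  then obtain B where good: "\<And>\<omega>. \<omega> \<in> space M - B \<Longrightarrow>
      W 0 \<omega> = 0 \<and> continuous_on {0..} (\<lambda>t. W t \<omega>) \<and> summable (?c \<omega>)" and B: "B \<in> null_sets M"
    by (rule AE_E3) blast
  define G where "G = space M - B"
  have G: "G \<in> sets M" using B by (auto simp: G_def)
  define Zv where "Zv \<omega> t = (if \<omega> \<in> G then Z_limit W t \<omega> else 0)" for \<omega> t
  define Y where "Y \<omega> = Bcontfun (\<lambda>t. Zv \<omega> (clamp01 t))" for \<omega>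
  have contZ: "continuous_on {0..<1} (Zv \<omega>)" for \<omega>
  proof (cases "\<omega> \<in> G")
    case True
    then have W: "continuous_on {0..} (\<lambda>t. W t \<omega>)" using good by (simp add: G_def)
    have "continuous_on {0..<1} (\<lambda>t. (1 - t) * W (t\<^sup>2 / (1 - t)) \<omega>)"
      by (intro continuous_intros continuous_on_compose2[OF W]) auto
    then show ?thesis
      using True by (subst continuous_on_cong[OF refl, of _ _ "\<lambda>t. (1 - t) * W (t\<^sup>2 / (1 - t)) \<omega>"])
        (auto simp: Zv_def Z_limit_eq)
  qed (simp add: Zv_def)
  \<comment> \<open>The bound on the dyadic increments is adapted to the path that is set to \<open>0\<close> on the null set.\<close>
  define c where "c \<omega> = (if \<omega> \<in> G then ?c \<omega> else (\<lambda>_. 0))" for \<omega>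
  have c: "summable (c \<omega>)" for \<omega> using good by (simp add: c_def G_def)
  have step: "\<bar>Zv \<omega> (real (Suc i) / 2 ^ k) - Zv \<omega> (real i / 2 ^ k)\<bar> \<le> c \<omega> k" if "i < 2 ^ k" for \<omega> i k
    using chain_bound_step[OF that, of "\<lambda>t. Z_limit W t \<omega>"] by (simp add: Zv_def c_def)
  have cont: "continuous_on {0..1} (Zv \<omega>)" for \<omega>
    by (rule continuous_at_endpoint_of_chaining[OF contZ c step])
  have Y_apply: "apply_bcontfun (Y \<omega>) t = Zv \<omega> (clamp01 t)" for \<omega> t
  proof -
    have "continuous_on UNIV (\<lambda>t. Zv \<omega> (clamp01 t))"
      by (rule continuous_on_compose2[OF cont]) (auto intro!: continuous_intros)
    moreover have "bounded (range (\<lambda>t. Zv \<omega> (clamp01 t)))"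
    proof (rule bounded_subset)
      show "bounded (Zv \<omega> ` {0..1})" by (intro compact_imp_bounded compact_continuous_image cont) simp
    qed auto
    ultimately show ?thesis unfolding Y_def by (subst Bcontfun_inverse) (auto simp: bcontfun_def)
  qed
  have Y_clamp: "Y \<omega> (clamp01 t) = Y \<omega> t" for \<omega> t by (simp add: Y_apply)
  have Y_01: "Y \<omega> t = Zv \<omega> t" if "t \<in> {0..1}" for \<omega> t
  proof -
    have "clamp01 t = t" using that by auto
    then show ?thesis unfolding Y_apply by (rule arg_cong)
  qed
  have dyadic01: "real i / 2 ^ k \<in> {0..1}" if "i \<le> 2 ^ k" for i k
  proof -
    have "real i \<le> real (2 ^ k)" using that by (simp only: of_nat_le_iff)
    then show ?thesis by simp
  qed
  have Y_step: "\<bar>Y \<omega> (real (Suc i) / 2 ^ k) - Y \<omega> (real i / 2 ^ k)\<bar> \<le> c \<omega> k" if "i < 2 ^ k" for \<omega> i k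
    using step[OF that, of \<omega>] Y_01[OF dyadic01, of i k \<omega>] Y_01[OF dyadic01, of "Suc i" k \<omega>] that by simp
  have "Y \<in> borel_measurable M"
  proof (rule borel_measurable_LIMSEQ_metric)
    let ?P = "\<lambda>m \<omega>. polygon (2 ^ m) (\<lambda>k. if k \<le> 2 ^ m then Zv \<omega> (real k / 2 ^ m) else 0)"
    show "?P m \<in> borel_measurable M" for m
    proof (rule measurable_compose[OF _ borel_measurable_continuous_onI[OF continuous_polygon]],
           rule measurable_coordinatewise_then_product)
      fix k
      show "(\<lambda>\<omega>. if k \<le> 2 ^ m then Zv \<omega> (real k / 2 ^ m) else 0) \<in> borel_measurable M"
      proof (cases "k \<le> 2 ^ m")
        case True
        have [measurable]: "Z_limit W (real k / 2 ^ m) \<in> borel_measurable M"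
          using dyadic01[OF True] by (intro Z_limit_measurable) auto
        show ?thesis unfolding Zv_def using G True by simp
      qed simp
    qed
    fix \<omega> assume "\<omega> \<in> space M"
    have P: "?P m \<omega> = polygon (2 ^ m) (\<lambda>k. Y \<omega> (real k / 2 ^ m))" for m
      unfolding polygon_def by (intro sum.cong refl) (simp add: Y_01[OF dyadic01])
    have dist_le: "dist (?P m \<omega>) (Y \<omega>) \<le> (\<Sum>k. c \<omega> (k + m))" for m
      unfolding P using dist_dyadic_polygon[OF Y_clamp c Y_step, of \<omega> m] by (simp add: dist_commute)
    have tail: "(\<lambda>m. \<Sum>k. c \<omega> (k + m)) \<longlonglongrightarrow> 0"
      by (rule suminf_tail_tendsto_0[OF c])
    have "(\<lambda>m. dist (?P m \<omega>) (Y \<omega>)) \<longlonglongrightarrow> 0"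
    proof (rule tendsto_sandwich[OF _ _ tendsto_const tail])
      show "\<forall>\<^sub>F m in sequentially. 0 \<le> dist (?P m \<omega>) (Y \<omega>)"
        by (intro always_eventually allI zero_le_dist)
      show "\<forall>\<^sub>F m in sequentially. dist (?P m \<omega>) (Y \<omega>) \<le> (\<Sum>k. c \<omega> (k + m))"
        by (intro always_eventually allI dist_le)
    qed
    then show "(\<lambda>m. ?P m \<omega>) \<longlonglongrightarrow> Y \<omega>" by (rule tendsto_dist_iff[THEN iffD2])
  qed
  moreover have "Y \<omega> 0 = 0" for \<omega>
    using good[of \<omega>] Y_01[of 0 \<omega>] by (auto simp: Zv_def G_def Z_limit_def)
  moreover have "AE \<omega> in M. \<omega> \<in> G"
    using AE_not_in[OF B] AE_space by eventually_elim (simp add: G_def)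
  then have "AE \<omega> in M. \<forall>t\<in>{0..1}. Y \<omega> t = Z_limit W t \<omega>"
    by eventually_elim (simp add: Y_01 Zv_def)
  ultimately show thesis using that Y_clamp by blast
qed

end

section \<open>Weak convergence in the space of paths\<close>

definition to_C01 :: "(real \<Rightarrow>\<^sub>C real) \<Rightarrow> real \<Rightarrow> real" where
  "to_C01 f = restrict (apply_bcontfun f) {0..1}"

lemma to_C01_mspace: "to_C01 f \<in> mspace C01"
proof -
  have "continuous_on {0..1} (restrict (apply_bcontfun f) {0..1})"
    using continuous_on_cong[of "{0..1}" "{0..1}" "restrict (apply_bcontfun f) {0..1}" "apply_bcontfun f"] by simp
  then show ?thesis unfolding mspace_C01 to_C01_def by simp
qed

lemma to_C01_continuous: "continuous_map euclidean (mtopology_of C01) to_C01"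
proof -
  have "mdist C01 (to_C01 f) (to_C01 g) \<le> 1 * dist f g" for f g
  proof -
    have "mdist C01 (to_C01 f) (to_C01 g) = (SUP t\<in>{0..1}. \<bar>to_C01 f t - to_C01 g t\<bar>)"
      by (rule mdist_C01[OF to_C01_mspace to_C01_mspace])
    also have "\<dots> \<le> dist f g"
    proof (rule cSUP_least)
      fix t :: real assume "t \<in> {0..1}"
      then show "\<bar>to_C01 f t - to_C01 g t\<bar> \<le> dist f g"
        using dist_bounded[of f t g] by (simp add: to_C01_def dist_real_def)
    qed simp
    finally show ?thesis by simp
  qed
  then have "Lipschitz_continuous_map euclidean_metric C01 to_C01"
    unfolding Lipschitz_continuous_map_def by (auto intro!: exI[of _ 1] simp: to_C01_mspace)
  then show ?thesis
    using Lipschitz_continuous_imp_continuous_map by fastforce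
qed

lemma C01_open_subset: "{U. openin (mtopology_of C01) U} \<subseteq> Pow (mspace C01)"
proof
  fix U assume "U \<in> {U. openin (mtopology_of C01) U}"
  then have "U \<subseteq> topspace (mtopology_of C01)" by (intro openin_subset) simp
  then show "U \<in> Pow (mspace C01)" by simp
qed

lemma space_borel_C01: "space borel_C01 = mspace C01"
  unfolding borel_C01_def by (rule space_measure_of[OF C01_open_subset])

lemma to_C01_measurable: "to_C01 \<in> borel \<rightarrow>\<^sub>M borel_C01"
  unfolding borel_C01_def
proof (rule measurable_measure_of)
  show "{U. openin (mtopology_of C01) U} \<subseteq> Pow (mspace C01)"
    by (rule C01_open_subset)
  show "to_C01 \<in> space borel \<rightarrow> mspace C01" by (simp add: to_C01_mspace)
  fix U assume "U \<in> {U. openin (mtopology_of C01) U}"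
  then have "openin euclidean {f \<in> topspace euclidean. to_C01 f \<in> U}"
    using to_C01_continuous unfolding continuous_map_def by blast
  then show "to_C01 -` U \<inter> space borel \<in> sets borel" by (simp add: vimage_def)
qed

lemma continuous_map_measurable_C01:
  assumes "continuous_map (mtopology_of C01) euclidean F"
  shows "F \<in> borel_measurable borel_C01"
proof (rule borel_measurableI)
  fix S :: "'a set" assume "open S"
  then have "openin (mtopology_of C01) {f \<in> topspace (mtopology_of C01). F f \<in> S}"
    using assms by (simp add: continuous_map_def)
  moreover have "{f \<in> topspace (mtopology_of C01). F f \<in> S} = F -` S \<inter> space borel_C01"
    by (auto simp: space_borel_C01)
  ultimately have "F -` S \<inter> space borel_C01 \<in> {U. openin (mtopology_of C01) U}" by simp
  then show "F -` S \<inter> space borel_C01 \<in> sets borel_C01"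
    unfolding borel_C01_def sets_measure_of[OF C01_open_subset] by (rule sigma_sets.Basic)
qed

definition parabola :: "real \<Rightarrow> real \<Rightarrow>\<^sub>C real" where
  "parabola c = Bcontfun (\<lambda>t. (clamp01 t)\<^sup>2 * c)"

lemma parabola_apply: "apply_bcontfun (parabola c) t = (clamp01 t)\<^sup>2 * c"
proof -
  have "\<bar>(clamp01 t)\<^sup>2 * c\<bar> \<le> \<bar>c\<bar>" for t
  proof -
    have "(clamp01 t)\<^sup>2 \<le> 1" by (intro power_le_one) auto
    then have "(clamp01 t)\<^sup>2 * \<bar>c\<bar> \<le> 1 * \<bar>c\<bar>" by (intro mult_right_mono) auto
    then show ?thesis by (simp add: abs_mult)
  qed
  then have "(\<lambda>t. (clamp01 t)\<^sup>2 * c) \<in> bcontfun"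
    by (intro bcontfun_normI[where b="\<bar>c\<bar>"]) (auto intro!: continuous_intros)
  then show ?thesis by (simp add: parabola_def Bcontfun_inverse)
qed

text \<open>If \<open>K\<close> lists the induced edge numbers of a tree, then this is the path of the rescaled process.\<close>

definition scaled_path :: "nat \<Rightarrow> (nat \<Rightarrow> nat) \<Rightarrow> real \<Rightarrow>\<^sub>C real" where
  "scaled_path n K = polygon n (\<lambda>j. real (K j) / sqrt (real n)) - parabola (sqrt (real n))"

lemma scaled_path_cong: "(\<And>j. j \<le> n \<Longrightarrow> K j = K' j) \<Longrightarrow> scaled_path n K = scaled_path n K'"
  unfolding scaled_path_def polygon_def by (auto intro!: sum.cong)

lemma polygon_eq_K_interp:
  assumes n: "0 < n" and t: "0 \<le> t" "t \<le> 1"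
  shows "polygon n (\<lambda>j. real (induced_edges j E)) t = K_interp n t E"
proof -
  let ?x = "\<lambda>j. real (induced_edges j E)"
  define j where "j = nat \<lfloor>t * real n\<rfloor>"
  have j: "of_int \<lfloor>t * real n\<rfloor> = real j" using t by (simp add: j_def)
  have tn: "t * real n \<le> real n" using t by (simp add: mult_left_le_one_le)
  show ?thesis
  proof (cases "t * real n = real j")
    case True
    then have "\<lceil>t * real n\<rceil> = int j" "\<lfloor>t * real n\<rfloor> = int j" by simp_all
    then have "K_interp n t E = ?x j" by (simp add: K_interp_def True)
    moreover have "t = real j / real n" using True n by (simp add: field_simps)
    moreover have "j \<le> n" using True tn by simp
    ultimately show ?thesis using polygon_vertex[of j n ?x] n by simp
  next
    case False
    have lo: "real j \<le> t * real n" "t * real n < real j + 1" unfolding j[symmetric] by linarith+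
    then have "\<lceil>t * real n\<rceil> = int j + 1" using False by (intro ceiling_unique) auto
    then have ceil: "nat \<lceil>t * real n\<rceil> = Suc j" by simp
    have "j < n" using lo(1) tn False by linarith
    then have "polygon n ?x t = (1 - (t * real n - real j)) * ?x j + (t * real n - real j) * ?x (Suc j)"
      by (rule polygon_segment) (use lo n in auto)
    then show ?thesis
      unfolding K_interp_def j ceil j_def[symmetric] by simp
  qed
qed

lemma polygon_scale: "apply_bcontfun (polygon N (\<lambda>j. x j / c)) t = apply_bcontfun (polygon N x) t / c"
  by (simp add: polygon_apply sum_divide_distrib)

lemma scaled_path_eq_Z_proc:
  assumes t: "t \<in> {0..1}"
  shows "scaled_path n (\<lambda>j. induced_edges j E) t = Z_proc n t E"
proof (cases "n = 0")
  case True
  then show ?thesis by (simp add: scaled_path_def Z_proc_def polygon_apply parabola_apply)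
next
  case False
  have "clamp01 t = t" using t by simp
  then have p: "parabola (sqrt (real n)) t = t\<^sup>2 * sqrt (real n)" unfolding parabola_apply by (rule arg_cong)
  have "scaled_path n (\<lambda>j. induced_edges j E) t = K_interp n t E / sqrt (real n) - t\<^sup>2 * sqrt (real n)"
    using polygon_eq_K_interp[of n t E] t False by (simp add: scaled_path_def p polygon_scale)
  also have "t\<^sup>2 * sqrt (real n) = t\<^sup>2 * real n / sqrt (real n)"
    by (simp only: times_divide_eq_right[symmetric] real_div_sqrt of_nat_0_le_iff)
  finally show ?thesis by (simp only: Z_proc_def diff_divide_distrib)
qed

abbreviation map_path :: "nat \<Rightarrow> (nat \<Rightarrow> nat) \<Rightarrow> real \<Rightarrow>\<^sub>C real" where
  "map_path n u \<equiv> scaled_path n (\<lambda>j. card {r \<in> {1<..j}. u r \<le> j})"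

text \<open>At \<open>s = (j + f) / n\<close> the difference is \<open>- (j + f\<^sup>2) / (n * sqrt n)\<close>. It arises because the mean of the
  count at \<open>j\<close> is \<open>j (j - 1) / n\<close> instead of \<open>j\<^sup>2 / n\<close>, and because the parabola is not linear between
  lattice points.\<close>

lemma scaled_path_near_fluct_path:
  assumes n: "0 < n"
  shows "dist (map_path n u) (fluct_path n u) \<le> 1 / sqrt (real n)"
proof (rule dist_bound)
  fix t
  let ?K = "\<lambda>j. card {r \<in> {1<..j}. u r \<le> j}"
  define s where "s = clamp01 t"
  have s: "0 \<le> s" "s \<le> 1" by (auto simp: s_def)
  obtain j f where jf: "j < n" "0 \<le> f" "f \<le> 1" "s = (real j + f) / real n"
    using segment_cases[OF n s] .
  have K: "real (?K i) = fluct n i u + (real i - 1) * real i / real n" if "i \<le> n" for i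
    by (rule card_eq_fluct[OF that])
  have s2: "s\<^sup>2 * sqrt (real n) = (real j + f)\<^sup>2 / real n / sqrt (real n)"
  proof -
    have "s\<^sup>2 * sqrt (real n) = s\<^sup>2 * real n / sqrt (real n)"
      by (simp only: times_divide_eq_right[symmetric] real_div_sqrt of_nat_0_le_iff)
    also have "s\<^sup>2 * real n = (real j + f)\<^sup>2 / real n"
      using n unfolding jf(4) by (simp add: power_divide power2_eq_square)
    finally show ?thesis .
  qed
  have "clamp01 s = s" using s by simp
  then have "parabola (sqrt (real n)) s = s\<^sup>2 * sqrt (real n)" unfolding parabola_apply by (rule arg_cong)
  then have "scaled_path n ?K s - fluct_path n u s =
     (polygon n (\<lambda>j. real (?K j)) s - polygon n (\<lambda>j. fluct n j u) s - (real j + f)\<^sup>2 / real n) / sqrt (real n)"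
    unfolding scaled_path_def fluct_path_def by (simp add: polygon_scale s2 diff_divide_distrib)
  also have "polygon n (\<lambda>j. real (?K j)) s - polygon n (\<lambda>j. fluct n j u) s - (real j + f)\<^sup>2 / real n =
     ((1 - f) * ((real j - 1) * real j) + f * (real j * (real j + 1)) - (real j + f)\<^sup>2) / real n"
  proof -
    have "polygon n (\<lambda>j. real (?K j)) s - polygon n (\<lambda>j. fluct n j u) s =
      (1 - f) * ((real j - 1) * real j / real n) + f * ((real (Suc j) - 1) * real (Suc j) / real n)"
      unfolding polygon_segment[OF jf] K[OF less_imp_le[OF jf(1)]] K[OF Suc_leI[OF jf(1)]] by (simp only: ring_distribs)
    then show ?thesis by (simp add: add_divide_distrib diff_divide_distrib mult_ac)
  qed
  also have "(1 - f) * ((real j - 1) * real j) + f * (real j * (real j + 1)) - (real j + f)\<^sup>2 = - (real j + f\<^sup>2)"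
    by (simp add: power2_eq_square algebra_simps)
  finally have eq: "scaled_path n ?K s - fluct_path n u s = - ((real j + f\<^sup>2) / real n) / sqrt (real n)"
    by (simp only: minus_divide_left)
  have "f\<^sup>2 \<le> 1" using jf by (intro power_le_one)
  moreover have "real j + 1 \<le> real n" using jf(1) by linarith
  ultimately have "(real j + f\<^sup>2) / real n \<le> 1" using n by (simp add: divide_le_eq)
  moreover have "0 \<le> (real j + f\<^sup>2) / real n" by simp
  ultimately have "\<bar>(real j + f\<^sup>2) / real n\<bar> / sqrt (real n) \<le> 1 / sqrt (real n)"
    by (intro divide_right_mono) auto
  then have "dist (scaled_path n ?K s) (fluct_path n u s) \<le> 1 / sqrt (real n)"
    unfolding dist_real_def eq by (simp add: abs_divide)
  moreover have "scaled_path n ?K s = scaled_path n ?K t"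
    by (simp add: scaled_path_def parabola_apply polygon_apply s_def)
  moreover have "fluct_path n u s = fluct_path n u t"
    by (simp add: fluct_path_def polygon_apply s_def)
  ultimately show "dist (scaled_path n ?K t) (fluct_path n u t) \<le> 1 / sqrt (real n)" by simp
qed

lemma measurable_pmf_metric: "f \<in> borel_measurable (measure_pmf p)"
  by (simp add: measurable_pmf_measure1)

lemma (in std_wiener_process) fluct_path_converges:
  fixes Y :: "'a \<Rightarrow> real \<Rightarrow>\<^sub>C real" and G :: "(real \<Rightarrow>\<^sub>C real) \<Rightarrow> real"
  assumes Y: "Y \<in> borel_measurable M" "\<And>\<omega> t. Y \<omega> (clamp01 t) = Y \<omega> t" "\<And>\<omega>. Y \<omega> 0 = 0"
    and YZ: "AE \<omega> in M. \<forall>t\<in>{0..1}. Y \<omega> t = Z_limit W t \<omega>"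
    and lip: "\<And>x y. \<bar>G x - G y\<bar> \<le> L * dist x y" and B: "\<And>x. \<bar>G x\<bar> \<le> (B::real)"
  shows "(\<lambda>n. \<integral>u. G (fluct_path n u) \<partial>random_map n) \<longlonglongrightarrow> (\<integral>\<omega>. G (Y \<omega>) \<partial>M)"
proof (rule process_convergence[where C=378])
  note [measurable] = measurable_apply_bcontfun[OF Y(1)]
  show "fluct_path n u (clamp01 t) = fluct_path n u t" for n u t
    by (simp add: fluct_path_def polygon_clamp)
  show "fluct_path n u 0 = 0" for n u
    using polygon_vertex[of 0 n "\<lambda>j. fluct n j u / sqrt (real n)"]
    by (cases "n = 0") (auto simp: fluct_path_def fluct_start polygon_apply)
  show "kolmogorov_condition (measure_pmf (random_map n)) (\<lambda>t u. fluct_path n u t) 378" for n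
    unfolding kolmogorov_condition_def using integrable_random_map fluct_path_fourth_moment by blast
  show "kolmogorov_condition M (\<lambda>t \<omega>. Y \<omega> t) 378"
    unfolding kolmogorov_condition_def
  proof (intro allI impI)
    fix s t :: real assume st: "0 \<le> s" "s \<le> t" "t \<le> 1"
    then have s: "s \<in> {0..1}" and t: "t \<in> {0..1}" by auto
    have [measurable]: "Z_limit W s \<in> borel_measurable M" "Z_limit W t \<in> borel_measurable M"
      using Z_limit_measurable st by auto
    have eq: "AE \<omega> in M. (Y \<omega> t - Y \<omega> s) ^ 4 = (Z_limit W t \<omega> - Z_limit W s \<omega>) ^ 4"
      using YZ by eventually_elim (simp add: s t del: atLeastAtMost_iff)
    have "integrable M (\<lambda>\<omega>. (Y \<omega> t - Y \<omega> s) ^ 4) \<longleftrightarrow> integrable M (\<lambda>\<omega>. (Z_limit W t \<omega> - Z_limit W s \<omega>) ^ 4)"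
      by (rule integrable_cong_AE[OF _ _ eq]) measurable
    moreover have "expectation (\<lambda>\<omega>. (Y \<omega> t - Y \<omega> s) ^ 4) = expectation (\<lambda>\<omega>. (Z_limit W t \<omega> - Z_limit W s \<omega>) ^ 4)"
      by (rule integral_cong_AE[OF _ _ eq]) measurable
    moreover have "120 * (t - s)\<^sup>2 \<le> 378 * (t - s)\<^sup>2" by (intro mult_right_mono) auto
    ultimately show "integrable M (\<lambda>\<omega>. (Y \<omega> t - Y \<omega> s) ^ 4) \<and>
        expectation (\<lambda>\<omega>. (Y \<omega> t - Y \<omega> s) ^ 4) \<le> 378 * (t - s)\<^sup>2"
      using Z_limit_fourth_moment[OF st] by (intro conjI) (simp, linarith)
  qed
next
  fix m :: nat and \<theta> :: "nat \<Rightarrow> real"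
  have k01: "real k / 2 ^ m \<in> {0..1}" if "k < Suc (2 ^ m)" for k
  proof -
    have "real k \<le> real (2 ^ m)" using that by (simp only: of_nat_le_iff less_Suc_eq_le)
    then show ?thesis by simp
  qed
  have "(\<integral>\<omega>. iexp (\<Sum>k<Suc (2 ^ m). \<theta> k * Y \<omega> (real k / 2 ^ m)) \<partial>M) =
      (\<integral>\<omega>. iexp (\<Sum>k<Suc (2 ^ m). \<theta> k * Z_limit W (real k / 2 ^ m) \<omega>) \<partial>M)"
  proof (rule integral_cong_AE)
    note [measurable] = measurable_apply_bcontfun[OF Y(1)]
    show "(\<lambda>\<omega>. iexp (\<Sum>k<Suc (2 ^ m). \<theta> k * Y \<omega> (real k / 2 ^ m))) \<in> borel_measurable M" by measurable
    have "(\<lambda>\<omega>. \<Sum>k<Suc (2 ^ m). \<theta> k * Z_limit W (real k / 2 ^ m) \<omega>) \<in> borel_measurable M"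
      using k01 by (intro borel_measurable_sum borel_measurable_times borel_measurable_const Z_limit_measurable) auto
    then show "(\<lambda>\<omega>. iexp (\<Sum>k<Suc (2 ^ m). \<theta> k * Z_limit W (real k / 2 ^ m) \<omega>)) \<in> borel_measurable M" by measurable
    show "AE \<omega> in M. iexp (\<Sum>k<Suc (2 ^ m). \<theta> k * Y \<omega> (real k / 2 ^ m)) =
        iexp (\<Sum>k<Suc (2 ^ m). \<theta> k * Z_limit W (real k / 2 ^ m) \<omega>)"
      using YZ
    proof eventually_elim
      case (elim \<omega>)
      then have "(\<Sum>k<Suc (2 ^ m). \<theta> k * Y \<omega> (real k / 2 ^ m)) = (\<Sum>k<Suc (2 ^ m). \<theta> k * Z_limit W (real k / 2 ^ m) \<omega>)"
        using k01 by (intro sum.cong refl) simp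
      then show ?case by (simp only:)
    qed
  qed
  then show "(\<lambda>n. \<integral>u. iexp (\<Sum>k<Suc (2 ^ m). \<theta> k * fluct_path n u (real k / 2 ^ m)) \<partial>random_map n)
     \<longlonglongrightarrow> (\<integral>\<omega>. iexp (\<Sum>k<Suc (2 ^ m). \<theta> k * Y \<omega> (real k / 2 ^ m)) \<partial>M)"
    unfolding Z_limit_char using k01 by (simp only:) (intro fluct_path_char_limit; simp)
qed (use Y lip B measure_pmf.prob_space_axioms prob_space_axioms measurable_pmf_metric in auto)

lemma (in std_wiener_process) scaled_path_converges:
  fixes Y :: "'a \<Rightarrow> real \<Rightarrow>\<^sub>C real" and F :: "(real \<Rightarrow>\<^sub>C real) \<Rightarrow> real"
  assumes Y: "Y \<in> borel_measurable M" "\<And>\<omega> t. Y \<omega> (clamp01 t) = Y \<omega> t" "\<And>\<omega>. Y \<omega> 0 = 0"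
    and YZ: "AE \<omega> in M. \<forall>t\<in>{0..1}. Y \<omega> t = Z_limit W t \<omega>"
    and F: "continuous_on UNIV F" and B: "\<And>x. \<bar>F x\<bar> \<le> B"
  shows "(\<lambda>n. \<integral>u. F (map_path n u) \<partial>random_map n) \<longlonglongrightarrow> (\<integral>\<omega>. F (Y \<omega>) \<partial>M)"
proof (rule weak_convergence_of_lipschitz[OF measure_pmf.prob_space_axioms prob_space_axioms measurable_pmf_metric Y(1) _ F B])
  fix G :: "(real \<Rightarrow>\<^sub>C real) \<Rightarrow> real" and L B'
  assume lip: "\<And>x y. \<bar>G x - G y\<bar> \<le> L * dist x y" and B': "\<And>x. \<bar>G x\<bar> \<le> B'"
    have lip': "\<bar>G x - G y\<bar> \<le> \<bar>L\<bar> * dist x y" for x y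
    by (rule order_trans[OF lip]) (auto intro: mult_right_mono)
  have bound: "\<bar>(\<integral>u. G (map_path n u) \<partial>random_map n) - (\<integral>u. G (fluct_path n u) \<partial>random_map n)\<bar> \<le> \<bar>L\<bar> * sqrt (1 / real n)"
    if "0 < n" for n
  proof -
    have "AE u in random_map n. dist (map_path n u) (fluct_path n u) \<le> 1 / sqrt (real n)"
      by (intro AE_I2 scaled_path_near_fluct_path that)
    from lipschitz_integral_diff[OF measure_pmf.prob_space_axioms measurable_pmf_metric measurable_pmf_metric lip' B' abs_ge_zero this]
    show ?thesis by (simp add: real_sqrt_divide)
  qed
  have "(\<lambda>n. \<bar>L\<bar> * sqrt (1 / real n)) \<longlonglongrightarrow> \<bar>L\<bar> * sqrt 0" by (intro tendsto_intros lim_1_over_n)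
  then have err: "(\<lambda>n. \<bar>L\<bar> * sqrt (1 / real n)) \<longlonglongrightarrow> 0" by simp
  have "(\<lambda>n. (\<integral>u. G (map_path n u) \<partial>random_map n) - (\<integral>u. G (fluct_path n u) \<partial>random_map n)) \<longlonglongrightarrow> 0"
  proof (rule tendsto_norm_zero_cancel, rule tendsto_sandwich[OF _ _ tendsto_const err])
    show "\<forall>\<^sub>F n in sequentially. norm ((\<integral>u. G (map_path n u) \<partial>random_map n) - (\<integral>u. G (fluct_path n u) \<partial>random_map n)) \<le> \<bar>L\<bar> * sqrt (1 / real n)"
      by (rule eventually_sequentiallyI[of 1]) (use bound in simp)
  qed simp
  from tendsto_add[OF this fluct_path_converges[OF Y YZ lip B']]
  show "(\<lambda>n. \<integral>u. G (map_path n u) \<partial>random_map n) \<longlonglongrightarrow> (\<integral>\<omega>. G (Y \<omega>) \<partial>M)" by simp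
qed

lemma tree_integral_eq_map_integral:
  fixes F :: "(real \<Rightarrow>\<^sub>C real) \<Rightarrow> real"
  assumes n: "1 \<le> n"
  shows "(\<integral>E. F (scaled_path n (\<lambda>j. induced_edges j E)) \<partial>random_labeled_tree n) =
    (\<integral>u. F (map_path n u) \<partial>random_map n)"
proof -
  have cut: "scaled_path n (restrict K {..n}) = scaled_path n K" for K
    by (rule scaled_path_cong) simp
  have "(\<integral>E. F (scaled_path n (\<lambda>j. induced_edges j E)) \<partial>random_labeled_tree n) =
    (\<integral>K. F (scaled_path n K) \<partial>map_pmf (\<lambda>E. \<lambda>j\<in>{..n}. induced_edges j E) (random_labeled_tree n))"
    by (simp add: cut)
  also have "\<dots> = (\<integral>u. F (map_path n u) \<partial>random_map n)"
    unfolding induced_edges_law[OF n] by (simp add: cut)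
  finally show ?thesis .
qed

lemma (in std_wiener_process) Z_proc_weak_conv:
  "process_weak_conv_C01 (\<lambda>n. measure_pmf (random_labeled_tree n)) Z_proc M (Z_limit W)"
proof -
  obtain Y :: "'a \<Rightarrow> real \<Rightarrow>\<^sub>C real" where Y: "Y \<in> borel_measurable M" "\<And>\<omega> t. Y \<omega> (clamp01 t) = Y \<omega> t" "\<And>\<omega>. Y \<omega> 0 = 0"
      and YZ: "AE \<omega> in M. \<forall>t\<in>{0..1}. Y \<omega> t = Z_limit W t \<omega>"
    by (rule Z_limit_version) (rule that; simp)
  let ?X = "\<lambda>n E. to_C01 (scaled_path n (\<lambda>j. induced_edges j E))"
  have X: "?X n \<in> measure_pmf (random_labeled_tree n) \<rightarrow>\<^sub>M borel_C01" for n
    by (simp add: measurable_pmf_measure1 space_borel_C01 to_C01_mspace)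
  have Y': "(\<lambda>\<omega>. to_C01 (Y \<omega>)) \<in> M \<rightarrow>\<^sub>M borel_C01"
    by (rule measurable_compose[OF Y(1) to_C01_measurable])
  have v1: "C01_version (measure_pmf (random_labeled_tree n)) (Z_proc n) (?X n)" for n
    unfolding C01_version_def using X[of n] by (auto simp: to_C01_def scaled_path_eq_Z_proc)
  have v2: "C01_version M (Z_limit W) (\<lambda>\<omega>. to_C01 (Y \<omega>))"
    unfolding C01_version_def
  proof
    show "AE \<omega> in M. \<forall>t\<in>{0..1}. to_C01 (Y \<omega>) t = Z_limit W t \<omega>"
      using YZ by eventually_elim (simp add: to_C01_def)
  qed (rule Y')
  have wc: "weak_conv_C01 (\<lambda>n. distr (measure_pmf (random_labeled_tree n)) borel_C01 (?X n))
      (distr M borel_C01 (\<lambda>\<omega>. to_C01 (Y \<omega>)))"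
    unfolding weak_conv_C01_def
  proof (intro allI impI, elim conjE)
    fix F :: "(real \<Rightarrow> real) \<Rightarrow> real"
    assume F: "continuous_map (mtopology_of C01) euclidean F" and bdd: "bounded (F ` mspace C01)"
    have meas: "F \<in> borel_measurable borel_C01" by (rule continuous_map_measurable_C01[OF F])
    have "continuous_map euclidean euclidean (F \<circ> to_C01)"
      by (rule continuous_map_compose[OF to_C01_continuous F])
    then have cont: "continuous_on UNIV (\<lambda>f. F (to_C01 f))" by (simp add: o_def)
    obtain B where "\<And>f. f \<in> mspace C01 \<Longrightarrow> \<bar>F f\<bar> \<le> B"
      using bdd unfolding bounded_iff by auto
    then have B: "\<bar>F (to_C01 f)\<bar> \<le> B" for f using to_C01_mspace by blast
    have "(\<lambda>n. \<integral>u. F (to_C01 (map_path n u)) \<partial>random_map n)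
        \<longlonglongrightarrow> (\<integral>\<omega>. F (to_C01 (Y \<omega>)) \<partial>M)"
      by (rule scaled_path_converges[OF Y YZ cont B])
    then have "(\<lambda>n. \<integral>E. F (?X n E) \<partial>random_labeled_tree n) \<longlonglongrightarrow> (\<integral>\<omega>. F (to_C01 (Y \<omega>)) \<partial>M)"
    proof (rule Lim_transform_eventually)
      show "\<forall>\<^sub>F n in sequentially. (\<integral>u. F (to_C01 (map_path n u)) \<partial>random_map n)
         = (\<integral>E. F (?X n E) \<partial>random_labeled_tree n)"
        using tree_integral_eq_map_integral[of _ "\<lambda>f. F (to_C01 f)"]
        by (intro eventually_sequentiallyI[of 1]) simp
    qed
    then show "(\<lambda>n. \<integral>f. F f \<partial>distr (measure_pmf (random_labeled_tree n)) borel_C01 (?X n))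
        \<longlonglongrightarrow> (\<integral>f. F f \<partial>distr M borel_C01 (\<lambda>\<omega>. to_C01 (Y \<omega>)))"
      unfolding integral_distr[OF X meas] integral_distr[OF Y' meas] .
  qed
  show ?thesis
    unfolding process_weak_conv_C01_def
    by (rule exI[of _ ?X], rule exI[of _ "\<lambda>\<omega>. to_C01 (Y \<omega>)"]) (intro conjI allI v1 v2 wc)
qed

theorem theorem3:
  fixes M :: "'w measure" and W :: "real \<Rightarrow> 'w \<Rightarrow> real"
  assumes "std_wiener_process M W"
  shows "process_weak_conv_C01 (\<lambda>n. measure_pmf (random_labeled_tree n)) Z_proc M (Z_limit W)
    \<and> (\<forall>t\<in>{0..1}. integrable M (Z_limit W t) \<and> integrable M (\<lambda>\<omega>. (Z_limit W t \<omega>)\<^sup>2)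
         \<and> prob_space.expectation M (Z_limit W t) = 0
         \<and> prob_space.variance M (Z_limit W t) = t\<^sup>2 * (1 - t))
    \<and> (\<forall>s\<in>{0..1}. \<forall>t\<in>{0..1}. s < t \<longrightarrow>
         covariance M (Z_limit W s) (Z_limit W t) = s\<^sup>2 * (1 - t))"
proof -
  interpret std_wiener_process M W by fact
  show ?thesis
  proof (intro conjI ballI impI)
    fix t :: real assume "t \<in> {0..1}"
    then have t: "0 \<le> t" "t \<le> 1" by auto
    show "integrable M (Z_limit W t)" using Z_limit_moments(1)[OF t, of 1] by simp
    show "integrable M (\<lambda>\<omega>. (Z_limit W t \<omega>)\<^sup>2)" by (rule Z_limit_moments(1)[OF t])
    show "expectation (Z_limit W t) = 0" by (rule Z_limit_moments(2)[OF t])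
    then show "variance (Z_limit W t) = t\<^sup>2 * (1 - t)" using Z_limit_moments(3)[OF t] by simp
  next
    fix s t :: real assume "s \<in> {0..1}" "t \<in> {0..1}" "s < t"
    then show "covariance M (Z_limit W s) (Z_limit W t) = s\<^sup>2 * (1 - t)" by (intro Z_limit_covariance) auto
  qed (rule Z_proc_weak_conv)
qed

end
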